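(* Let $\mathcal{M}$ be a factor of type ${\rm II}_1$ with a faithful normal finite trace $\tau$ with $\tau(I)=1$. Let $\varphi_\alpha$ be the non-linear trace of the Choquet type associated with a monotone increasing and continuous function $\alpha:[0,1]\to[0,1]$ with $\alpha(0)=0$ and $\alpha(1)=1$. Let $a\in\mathcal{M}$ be self-adjoint and let $f\in C(\sigma(a))$ be a monotone increasing positive (i.e. $[0,\infty)$-valued) function on the spectrum $\sigma(a)$. Take a real number $k\in\sigma(a)$ such that $f(k)>0$. Then $$\varphi_\alpha\big(e_{[k,\infty)}(a)\big)\le \frac{\varphi_\alpha(f(a))}{f(k)} .$$
   Context: $e_B(a)$ denotes the spectral projection of the self-adjoint operator $a$ for the Borel set $B\subset\mathbb{R}$, and $f(a)$ is given by continuous functional calculus. For a positive operator $b\in\mathcal{M}$, the non-linear trace of the Choquet type associated with $\alpha$ is $$\varphi_\alpha(b):=\int_0^\infty \alpha\big(\tau(e_{(s,\infty)}(b))\big)\,ds .$$ *)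

theory Defs
  imports "HOL-Analysis.Analysis"
begin

text \<open>
  Complex Hilbert spaces. The norm, metric and completeness come from the underlying real
  inner product space, whose inner product is the real part of the complex one; the complex
  inner product is linear in its first argument.
\<close>

class complex_hilbert_space = real_inner + complete_space +
  fixes scaleC :: "complex \<Rightarrow> 'a \<Rightarrow> 'a"  (infixr \<open>*\<^sub>C\<close> 75)
    and cinner :: "'a \<Rightarrow> 'a \<Rightarrow> complex"
  assumes scaleC_add_right: "c *\<^sub>C (x + y) = c *\<^sub>C x + c *\<^sub>C y"
    and scaleC_add_left: "(c + d) *\<^sub>C x = c *\<^sub>C x + d *\<^sub>C x"
    and scaleC_scaleC: "c *\<^sub>C (d *\<^sub>C x) = (c * d) *\<^sub>C x"
    and scaleC_of_real: "complex_of_real r *\<^sub>C x = r *\<^sub>R x"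
    and cinner_add_left: "cinner (x + y) z = cinner x z + cinner y z"
    and cinner_scaleC_left: "cinner (c *\<^sub>C x) y = c * cinner x y"
    and cinner_commute: "cinner x y = cnj (cinner y x)"
    and Re_cinner: "Re (cinner x y) = inner x y"

lemma norm_scaleC: "norm (c *\<^sub>C x) = norm c * norm (x :: 'h::complex_hilbert_space)"
proof -
  have "cinner (c *\<^sub>C x) (c *\<^sub>C x) = c * cnj (c * cinner x x)"
    by (metis cinner_commute cinner_scaleC_left)
  also have "\<dots> = complex_of_real ((norm c)\<^sup>2) * cinner x x"
    by (metis cinner_commute complex_cnj_mult complex_norm_square mult.assoc)
  finally have "inner (c *\<^sub>C x) (c *\<^sub>C x) = (norm c)\<^sup>2 * inner x x"
    by (simp flip: Re_cinner)
  then have "(norm (c *\<^sub>C x))\<^sup>2 = (norm c * norm x)\<^sup>2"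
    by (simp add: power2_norm_eq_inner power_mult_distrib)
  then show ?thesis
    by simp
qed

lemma bounded_linear_scaleC:
  "bounded_linear (scaleC c :: 'h \<Rightarrow> 'h::complex_hilbert_space)"
proof (rule bounded_linear_intro[where K = "norm c"])
  show "c *\<^sub>C (r *\<^sub>R x) = r *\<^sub>R (c *\<^sub>C x)" for r :: real and x :: 'h
    by (metis scaleC_of_real scaleC_scaleC mult.commute)
qed (simp_all add: scaleC_add_right norm_scaleC mult.commute)

text \<open>
  Operators are elements of the library type of real-linear bounded maps, which supplies the
  operator norm and composition; B(H) is the subset of complex-linear ones.
\<close>

type_synonym 'h op = "'h \<Rightarrow>\<^sub>L 'h"

definition bounded_ops :: "'h::complex_hilbert_space op set" where
  "bounded_ops = {T. \<forall>c x. blinfun_apply T (c *\<^sub>C x) = c *\<^sub>C blinfun_apply T x}"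

definition cscale :: "complex \<Rightarrow> 'h::complex_hilbert_space op \<Rightarrow> 'h op" where
  "cscale c T = Blinfun (scaleC c) o\<^sub>L T"

lemma cscale_apply: "blinfun_apply (cscale c T) x = c *\<^sub>C blinfun_apply T x"
  by (simp add: cscale_def bounded_linear_Blinfun_apply[OF bounded_linear_scaleC])

definition adj :: "'h::complex_hilbert_space op \<Rightarrow> 'h op" where
  "adj T = (THE S. S \<in> bounded_ops \<and>
     (\<forall>x y. cinner (blinfun_apply T x) y = cinner x (blinfun_apply S y)))"

definition selfadjoint :: "'h::complex_hilbert_space op \<Rightarrow> bool" where
  "selfadjoint a \<longleftrightarrow> a \<in> bounded_ops \<and> adj a = a"

definition positive_op :: "'h::complex_hilbert_space op \<Rightarrow> bool" where
  "positive_op a \<longleftrightarrow> selfadjoint a \<and> (\<forall>x. 0 \<le> Re (cinner (blinfun_apply a x) x))"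

definition op_le :: "'h::complex_hilbert_space op \<Rightarrow> 'h op \<Rightarrow> bool" where
  "op_le a b \<longleftrightarrow> positive_op (b - a)"

definition projection :: "'h::complex_hilbert_space op \<Rightarrow> bool" where
  "projection p \<longleftrightarrow> selfadjoint p \<and> p o\<^sub>L p = p"

definition spectrum :: "'h::complex_hilbert_space op \<Rightarrow> complex set" where
  "spectrum a = {z. \<not> (\<exists>S\<in>bounded_ops. S o\<^sub>L (a - cscale z id_blinfun) = id_blinfun \<and>
                                     (a - cscale z id_blinfun) o\<^sub>L S = id_blinfun)}"

text \<open>For self-adjoint operators this is the whole spectrum, viewed as a subset of the reals.\<close>

definition real_spectrum :: "'h::complex_hilbert_space op \<Rightarrow> real set" where
  "real_spectrum a = {t. complex_of_real t \<in> spectrum a}"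


subsection \<open>Spectral projections and continuous functional calculus\<close>

definition projection_valued_measure ::
    "(real set \<Rightarrow> 'h::complex_hilbert_space op) \<Rightarrow> bool" where
  "projection_valued_measure E \<longleftrightarrow>
     (\<forall>B\<in>sets borel. projection (E B)) \<and>
     E {} = 0 \<and> E UNIV = id_blinfun \<and>
     (\<forall>A\<in>sets borel. \<forall>B\<in>sets borel. E (A \<inter> B) = E A o\<^sub>L E B) \<and>
     (\<forall>B :: nat \<Rightarrow> real set. range B \<subseteq> sets borel \<longrightarrow> disjoint_family B \<longrightarrow>
        (\<forall>x. (\<lambda>n. blinfun_apply (E (B n)) x) sums blinfun_apply (E (\<Union>n. B n)) x))"

definition vector_measure ::
    "(real set \<Rightarrow> 'h::complex_hilbert_space op) \<Rightarrow> 'h \<Rightarrow> real measure" where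
  "vector_measure E x =
     measure_of UNIV (sets borel) (\<lambda>B. ennreal (Re (cinner (blinfun_apply (E B) x) x)))"

text \<open>
  The spectral measure of a self-adjoint operator: it is carried by the spectrum, and \<open>a\<close> is
  the weak integral of the identity function against it. By polarization the diagonal vector
  measures suffice.
\<close>

definition spectral_measure_of ::
    "'h::complex_hilbert_space op \<Rightarrow> (real set \<Rightarrow> 'h op) \<Rightarrow> bool" where
  "spectral_measure_of a E \<longleftrightarrow>
     projection_valued_measure E \<and> E (real_spectrum a) = id_blinfun \<and>
     (\<forall>x. cinner (blinfun_apply a x) x = complex_of_real (\<integral>t. t \<partial>vector_measure E x))"

definition spectral_projection ::
    "real set \<Rightarrow> 'h::complex_hilbert_space op \<Rightarrow> 'h op" where
  "spectral_projection B a = (THE p. \<exists>E. spectral_measure_of a E \<and> p = E B)"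

text \<open>
  The isometric unital *-homomorphism from the continuous functions on the spectrum that sends
  the identity function to \<open>a\<close>. The isometry condition makes its values depend only on the
  restriction of the function to the spectrum.
\<close>

definition functional_calculus ::
    "'h::complex_hilbert_space op \<Rightarrow> ((real \<Rightarrow> complex) \<Rightarrow> 'h op) \<Rightarrow> bool" where
  "functional_calculus a \<Phi> \<longleftrightarrow>
     (\<forall>f. continuous_on (real_spectrum a) f \<longrightarrow>
        \<Phi> f \<in> bounded_ops \<and>
        (\<forall>c. \<Phi> (\<lambda>t. c * f t) = cscale c (\<Phi> f)) \<and>
        \<Phi> (\<lambda>t. cnj (f t)) = adj (\<Phi> f) \<and>
        norm (\<Phi> f) = (SUP t\<in>real_spectrum a. norm (f t)) \<and>
        (\<forall>g. continuous_on (real_spectrum a) g \<longrightarrow>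
           \<Phi> (\<lambda>t. f t + g t) = \<Phi> f + \<Phi> g \<and>
           \<Phi> (\<lambda>t. f t * g t) = \<Phi> f o\<^sub>L \<Phi> g)) \<and>
     \<Phi> (\<lambda>t. 1) = id_blinfun \<and>
     \<Phi> complex_of_real = a"

definition cfc :: "(real \<Rightarrow> real) \<Rightarrow> 'h::complex_hilbert_space op \<Rightarrow> 'h op" where
  "cfc f a = (THE b. \<exists>\<Phi>. functional_calculus a \<Phi> \<and> b = \<Phi> (\<lambda>t. complex_of_real (f t)))"


subsection \<open>Factors of type \<open>II\<^sub>1\<close> and traces\<close>

definition commutant :: "'h::complex_hilbert_space op set \<Rightarrow> 'h op set" where
  "commutant A = {T \<in> bounded_ops. \<forall>S\<in>A. T o\<^sub>L S = S o\<^sub>L T}"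

definition von_neumann_algebra :: "'h::complex_hilbert_space op set \<Rightarrow> bool" where
  "von_neumann_algebra M \<longleftrightarrow>
     M \<subseteq> bounded_ops \<and> (\<forall>T\<in>M. adj T \<in> M) \<and> commutant (commutant M) = M"

definition factor :: "'h::complex_hilbert_space op set \<Rightarrow> bool" where
  "factor M \<longleftrightarrow>
     von_neumann_algebra M \<and> M \<inter> commutant M = range (\<lambda>c. cscale c id_blinfun)"

definition abelian_projection :: "'h::complex_hilbert_space op set \<Rightarrow> 'h op \<Rightarrow> bool" where
  "abelian_projection M p \<longleftrightarrow>
     p \<in> M \<and> projection p \<and>
     (\<forall>x\<in>M. \<forall>y\<in>M. (p o\<^sub>L x o\<^sub>L p) o\<^sub>L (p o\<^sub>L y o\<^sub>L p) = (p o\<^sub>L y o\<^sub>L p) o\<^sub>L (p o\<^sub>L x o\<^sub>L p))"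

text \<open>Finiteness in the sense of Murray and von Neumann.\<close>

definition finite_projection :: "'h::complex_hilbert_space op set \<Rightarrow> 'h op \<Rightarrow> bool" where
  "finite_projection M p \<longleftrightarrow>
     p \<in> M \<and> projection p \<and>
     (\<forall>v\<in>M. adj v o\<^sub>L v = p \<longrightarrow> op_le (v o\<^sub>L adj v) p \<longrightarrow> v o\<^sub>L adj v = p)"

text \<open>
  Type \<open>II\<close> asks for no nonzero abelian projection and a finite projection of central support
  one; in type \<open>II\<^sub>1\<close> the latter is the identity. The zero space is excluded.
\<close>

definition type_II1_factor :: "'h::complex_hilbert_space op set \<Rightarrow> bool" where
  "type_II1_factor M \<longleftrightarrow>
     factor M \<and> (id_blinfun :: 'h op) \<noteq> 0 \<and>
     finite_projection M id_blinfun \<and> (\<forall>p. abelian_projection M p \<longrightarrow> p = 0)"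

definition finite_trace ::
    "'h::complex_hilbert_space op set \<Rightarrow> ('h op \<Rightarrow> complex) \<Rightarrow> bool" where
  "finite_trace M \<tau> \<longleftrightarrow>
     (\<forall>x\<in>M. \<forall>y\<in>M. \<tau> (x + y) = \<tau> x + \<tau> y) \<and>
     (\<forall>c. \<forall>x\<in>M. \<tau> (cscale c x) = c * \<tau> x) \<and>
     (\<forall>x\<in>M. positive_op x \<longrightarrow> \<tau> x \<in> \<real>\<^sub>\<ge>\<^sub>0) \<and>
     (\<forall>x\<in>M. \<forall>y\<in>M. \<tau> (x o\<^sub>L y) = \<tau> (y o\<^sub>L x))"

definition faithful_on ::
    "'h::complex_hilbert_space op set \<Rightarrow> ('h op \<Rightarrow> complex) \<Rightarrow> bool" where
  "faithful_on M \<tau> \<longleftrightarrow> (\<forall>x\<in>M. positive_op x \<longrightarrow> \<tau> x = 0 \<longrightarrow> x = 0)"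

text \<open>
  Normality: suprema of upward directed families of positive operators are preserved.
\<close>

definition normal_on ::
    "'h::complex_hilbert_space op set \<Rightarrow> ('h op \<Rightarrow> complex) \<Rightarrow> bool" where
  "normal_on M \<tau> \<longleftrightarrow>
     (\<forall>D b. D \<noteq> {} \<longrightarrow> D \<subseteq> M \<longrightarrow> (\<forall>x\<in>D. positive_op x) \<longrightarrow>
        (\<forall>x\<in>D. \<forall>y\<in>D. \<exists>z\<in>D. op_le x z \<and> op_le y z) \<longrightarrow>
        b \<in> M \<longrightarrow> (\<forall>x\<in>D. op_le x b) \<longrightarrow>
        (\<forall>c\<in>M. (\<forall>x\<in>D. op_le x c) \<longrightarrow> op_le b c) \<longrightarrow>
        Re (\<tau> b) = (SUP x\<in>D. Re (\<tau> x)))"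

text \<open>
  The trace of a projection is real, so taking the real part only changes the type. For positive
  \<open>b\<close> the integrand is decreasing and vanishes for \<open>s \<ge> norm b\<close>, so it is integrable.
\<close>

definition choquet_trace ::
    "('h::complex_hilbert_space op \<Rightarrow> complex) \<Rightarrow> (real \<Rightarrow> real) \<Rightarrow> 'h op \<Rightarrow> real" where
  "choquet_trace \<tau> \<alpha> b = (LBINT s:{0..}. \<alpha> (Re (\<tau> (spectral_projection {s<..} b))))"

end

theory Submission
  imports Defs "HOL-Probability.Distribution_Functions"
begin

text \<open>
  Let \<open>F\<close> be the spectral measure of \<open>a\<close>, so that \<open>f(a)\<close> is the integral of \<open>f\<close> against \<open>F\<close> and
  \<open>F {t. f t > s}\<close> is the spectral projection of \<open>f(a)\<close> for \<open>(s,\<infinity>)\<close>. For \<open>s < f k\<close> the set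
  \<open>{t. f t > s}\<close> contains \<open>[k,\<infinity>)\<close> up to points outside the spectrum. Hence the
  integrand of \<open>\<phi>\<^sub>\<alpha>(f(a))\<close> is at least \<open>\<alpha>(\<tau>(F [k,\<infinity>)))\<close> on \<open>[0, f k)\<close>, whereas \<open>\<phi>\<^sub>\<alpha>\<close> of a
  projection \<open>p\<close> is just \<open>\<alpha>(\<tau>(p))\<close>.

  The spectral theorem behind this is obtained without Gelfand theory: the projection
  \<open>F (-\<infinity>,t]\<close> is the one onto the kernel of the positive part of \<open>a - t\<close>, and a Dynkin class
  argument extends it to all Borel sets. As all of these projections commute with
  whatever bounded real-linear map commutes with \<open>a\<close>, most of the work takes place in the
  underlying real Hilbert space; complex linearity and membership in the von Neumann algebra
  come for free.
\<close>

section \<open>Symmetric operators\<close>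

text \<open>\<open>spectral_projection\<close> and \<open>cfc\<close> are definite descriptions, so
  constructing a spectral measure and a calculus is only half of the work: both must also be unique.
  For the measure this is reduced to the calculus, whose values at continuous ramps already
  determine the diagonal measures on half-lines. The claim about the spectral projections of f(a)
  then means that the push-forward of \<open>F\<close> along f is a spectral measure of f(a), hence
  the only one. Commutation is stated for all bounded real-linear maps because multiplication by a
  complex scalar is such a map, and commuting with all of these is complex linearity; membership in
  the algebra is the double commutant condition. The price of working over the reals is that a
  quadratic form sees only the symmetric part of an operator: symmetry has to accompany every
  identification by forms, and products are reached through simple functions. Taking the whole
  kernel of the positive part, which includes the kernel of a - t, is what makes the resolution
  right-continuous, as a distribution function must be.\<close>

instance complex_hilbert_space \<subseteq> banach ..

text \<open>The parallelogram law makes a minimizing sequence for the distance from \<open>x\<close>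
  to \<open>N\<close> Cauchy. Its limit is a nearest point, and moving it along \<open>z\<close>
  cannot decrease the distance, which forces orthogonality.\<close>

lemma orthogonal_decomposition_exists:
  fixes N :: "'a::{real_inner,complete_space} set"
  assumes "closed N" "subspace N"
  shows "\<exists>y\<in>N. \<forall>z\<in>N. inner (x - y) z = 0"
proof -
  define d where "d = (INF y\<in>N. (norm (x - y))\<^sup>2)"
  have ne: "N \<noteq> {}"
    using assms(2) subspace_0 by auto
  have bb: "bdd_below ((\<lambda>y. (norm (x - y))\<^sup>2) ` N)"
    by (rule bdd_belowI[of _ 0]) auto
  have d_le: "d \<le> (norm (x - y))\<^sup>2" if "y \<in> N" for y
    unfolding d_def by (rule cINF_lower[OF bb that])
  have "\<exists>y\<in>N. (norm (x - y))\<^sup>2 < d + 1 / real (Suc n)" for n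
    using cINF_less_iff[OF ne bb, of "d + 1 / real (Suc n)"] unfolding d_def by simp
  then obtain y where yN: "\<And>n. y n \<in> N"
    and y_less: "\<And>n. (norm (x - y n))\<^sup>2 < d + 1 / real (Suc n)"
    by metis
  have par: "(norm (y m - y n))\<^sup>2 \<le> 2 / real (Suc m) + 2 / real (Suc n)" for m n
  proof -
    have "(1/2) *\<^sub>R (y m + y n) \<in> N"
      using yN assms(2) by (simp add: subspace_add subspace_scale)
    then have 1: "d \<le> (norm (x - (1/2) *\<^sub>R (y m + y n)))\<^sup>2"
      by (rule d_le)
    have "(norm (y m - y n))\<^sup>2 = 2 * (norm (x - y m))\<^sup>2 + 2 * (norm (x - y n))\<^sup>2
        - 4 * (norm (x - (1/2) *\<^sub>R (y m + y n)))\<^sup>2"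
      by (simp add: power2_norm_eq_inner inner_commute algebra_simps)
    then show ?thesis
      using 1 y_less[of m] y_less[of n] by linarith
  qed
  have "Cauchy y"
  proof (rule metric_CauchyI)
    fix e :: real assume e: "0 < e"
    obtain K where K: "inverse (real (Suc K)) < e\<^sup>2 / 4"
      using reals_Archimedean[of "e\<^sup>2 / 4"] e by auto
    have "dist (y m) (y n) < e" if "m \<ge> K" "n \<ge> K" for m n
    proof -
      have "2 / real (Suc m) \<le> 2 / real (Suc K)" "2 / real (Suc n) \<le> 2 / real (Suc K)"
        using that by (auto intro!: divide_left_mono)
      then have "(norm (y m - y n))\<^sup>2 \<le> 4 * inverse (real (Suc K))"
        using par[of m n] unfolding divide_inverse by linarith
      also have "\<dots> < e\<^sup>2"
        using K by simp
      finally show ?thesis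
        using e by (simp add: dist_norm power2_less_imp_less)
    qed
    then show "\<exists>K. \<forall>m\<ge>K. \<forall>n\<ge>K. dist (y m) (y n) < e"
      by blast
  qed
  then obtain l where l: "y \<longlonglongrightarrow> l"
    using Cauchy_convergent convergent_def by blast
  have lN: "l \<in> N"
    using assms(1) yN l closed_sequentially by blast
  have "(norm (x - l))\<^sup>2 \<le> d"
  proof (rule LIMSEQ_le)
    show "(\<lambda>n. (norm (x - y n))\<^sup>2) \<longlonglongrightarrow> (norm (x - l))\<^sup>2"
      by (intro tendsto_intros l)
    show "(\<lambda>n. d + inverse (real (Suc n))) \<longlonglongrightarrow> d"
      using LIMSEQ_inverse_real_of_nat_add by blast
    show "\<exists>N. \<forall>n\<ge>N. (norm (x - y n))\<^sup>2 \<le> d + inverse (real (Suc n))"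
      using y_less by (auto simp: divide_inverse intro: less_imp_le)
  qed
  then have min: "(norm (x - l))\<^sup>2 \<le> (norm (x - z))\<^sup>2" if "z \<in> N" for z
    using d_le[OF that] by linarith
  have "inner (x - l) z = 0" if z: "z \<in> N" for z
  proof (rule ccontr)
    assume c: "inner (x - l) z \<noteq> 0"
    \<comment> \<open>This is the minimizer of the quadratic polynomial that sends r to the squared
      norm of x - l - r z.\<close>
    define r where "r = inner (x - l) z / (norm z)\<^sup>2"
    have z0: "z \<noteq> 0" using c by auto
    have "l + r *\<^sub>R z \<in> N"
      using lN z assms(2) by (simp add: subspace_add subspace_scale)
    from min[OF this] have "(norm (x - l))\<^sup>2 \<le> (norm ((x - l) - r *\<^sub>R z))\<^sup>2"
      by (simp add: algebra_simps)
    also have "\<dots> = (norm (x - l))\<^sup>2 - 2 * r * inner (x - l) z + r\<^sup>2 * (norm z)\<^sup>2"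
      unfolding power2_norm_eq_inner
      by (simp add: inner_diff_left inner_diff_right inner_commute power2_eq_square)
    also have "r\<^sup>2 * (norm z)\<^sup>2 = r * inner (x - l) z"
      using z0 by (simp add: r_def power2_eq_square)
    finally have "r * inner (x - l) z \<le> 0"
      by simp
    moreover have "r * inner (x - l) z = (inner (x - l) z)\<^sup>2 / (norm z)\<^sup>2"
      by (simp add: r_def power2_eq_square)
    moreover have "0 < (inner (x - l) z)\<^sup>2 / (norm z)\<^sup>2"
      using c z0 by simp
    ultimately show False by linarith
  qed
  with lN show ?thesis by blast
qed

text \<open>The kernel of a nonzero functional is a closed hyperplane; the representing vector is a
  multiple of a vector orthogonal to it.\<close>

lemma Riesz_representation:
  fixes f :: "'a::{real_inner,complete_space} \<Rightarrow> real"
  assumes "bounded_linear f"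
  shows "\<exists>y. \<forall>x. f x = inner x y"
proof (cases "\<forall>x. f x = 0")
  case True
  then show ?thesis by (intro exI[of _ 0]) simp
next
  case False
  then obtain x0 where x0: "f x0 \<noteq> 0" by auto
  interpret f: bounded_linear f by fact
  let ?N = "{x. f x = 0}"
  have "closed ?N"
    by (intro closed_Collect_eq continuous_intros linear_continuous_on assms)
  moreover have "subspace ?N"
    by (auto simp: subspace_def f.add f.scaleR)
  ultimately obtain y where y: "f y = 0" and orth: "\<And>z. f z = 0 \<Longrightarrow> inner (x0 - y) z = 0"
    using orthogonal_decomposition_exists[of ?N x0] by auto
  define w where "w = x0 - y"
  have fw: "f w \<noteq> 0" using x0 y by (simp add: w_def f.diff)
  then have w0: "inner w w \<noteq> 0" by auto
  have "f x = inner x ((f w / inner w w) *\<^sub>R w)" for x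
  proof -
    have "f (x - (f x / f w) *\<^sub>R w) = 0"
      using fw by (simp add: f.diff f.scaleR)
    then have "inner w (x - (f x / f w) *\<^sub>R w) = 0"
      unfolding w_def by (rule orth)
    then have "inner w x = f x / f w * inner w w"
      by (simp add: inner_diff_right)
    then show ?thesis
      using fw w0 by (simp add: inner_commute field_simps)
  qed
  then show ?thesis by blast
qed

lemma inner_eq_imp_eq:
  fixes x y :: "'a::real_inner"
  assumes "\<And>z. inner z x = inner z y"
  shows "x = y"
proof -
  have "inner (x - y) (x - y) = 0"
    using assms[of "x - y"] by (simp add: inner_diff_right)
  then show ?thesis by simp
qed

text \<open>Riesz representation of each functional that sends x to the inner product of T x and y.
  It is used twice: to show that an invariant subspace reduces the operators in question, and to
  give meaning to the definite description in \<open>adj\<close>.\<close>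

lemma real_adjoint_exists:
  fixes T :: "'a::{real_inner,complete_space} \<Rightarrow>\<^sub>L 'a"
  shows "\<exists>S :: 'a \<Rightarrow>\<^sub>L 'a. \<forall>x y. inner (T x) y = inner x (S y)"
proof -
  have "\<exists>w. \<forall>x. inner (T x) y = inner x w" for y
    by (rule Riesz_representation) (intro bounded_linear_intros)
  then obtain g where g: "\<And>x y. inner (T x) y = inner x (g y)"
    by metis
  have "bounded_linear g"
  proof (rule bounded_linear_intro[where K = "norm T"])
    show "g (x + y) = g x + g y" for x y
      by (rule inner_eq_imp_eq) (simp add: inner_add_right flip: g)
    show "g (r *\<^sub>R x) = r *\<^sub>R g x" for r x
      by (rule inner_eq_imp_eq) (simp flip: g)
    show "norm (g x) \<le> norm x * norm T" for x
    proof (cases "g x = 0")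
      case False
      have "(norm (g x))\<^sup>2 = inner (T (g x)) x"
        by (simp add: g power2_norm_eq_inner)
      also have "\<dots> \<le> norm (T (g x)) * norm x"
        by (rule norm_cauchy_schwarz)
      also have "\<dots> \<le> norm T * norm (g x) * norm x"
        by (intro mult_right_mono norm_blinfun) auto
      finally show ?thesis
        using False by (simp add: power2_eq_square mult.commute mult.left_commute)
    qed simp
  qed
  then have "\<forall>x y. inner (T x) y = inner x (Blinfun g y)"
    by (simp add: g bounded_linear_Blinfun_apply)
  then show ?thesis by blast
qed

text \<open>Self-adjointness for the real inner product alone. \<open>selfadjoint_iff\<close> shows
  that for complex-linear maps this is the usual notion.\<close>

definition symmetric_op :: "('a::real_inner \<Rightarrow>\<^sub>L 'a) \<Rightarrow> bool" where
  "symmetric_op T \<longleftrightarrow> (\<forall>x y. inner (T x) y = inner x (T y))"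

lemma symmetric_opD: "symmetric_op T \<Longrightarrow> inner (T x) y = inner x (T y)"
  by (simp add: symmetric_op_def)

section \<open>Symmetric operators and their quadratic forms\<close>

lemma symmetric_op_0 [simp]: "symmetric_op 0"
  and symmetric_op_id [simp]: "symmetric_op id_blinfun"
  by (simp_all add: symmetric_op_def)

lemma symmetric_op_add: "symmetric_op S \<Longrightarrow> symmetric_op T \<Longrightarrow> symmetric_op (S + T)"
  and symmetric_op_diff: "symmetric_op S \<Longrightarrow> symmetric_op T \<Longrightarrow> symmetric_op (S - T)"
  and symmetric_op_scaleR: "symmetric_op S \<Longrightarrow> symmetric_op (r *\<^sub>R S)"
  and symmetric_op_square: "symmetric_op S \<Longrightarrow> symmetric_op (S o\<^sub>L S)"
  by (simp_all add: symmetric_op_def blinfun.bilinear_simps inner_add_left inner_add_right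
      inner_diff_left inner_diff_right)

lemma symmetric_op_sum: "(\<And>i. i \<in> I \<Longrightarrow> symmetric_op (T i)) \<Longrightarrow> symmetric_op (\<Sum>i\<in>I. T i)"
  by (induction I rule: infinite_finite_induct) (auto intro: symmetric_op_add)

lemma symmetric_op_limit:
  fixes L :: "'a::real_inner \<Rightarrow>\<^sub>L 'a"
  assumes "\<And>n::nat. symmetric_op (T n)" and lim: "\<And>x. (\<lambda>n. T n x) \<longlonglongrightarrow> L x"
  shows "symmetric_op L"
  unfolding symmetric_op_def
proof (intro allI)
  fix x y
  have "(\<lambda>n. inner (T n x) y) \<longlonglongrightarrow> inner (L x) y"
    by (intro tendsto_intros lim)
  moreover have "(\<lambda>n. inner (T n x) y) \<longlonglongrightarrow> inner x (L y)"
    unfolding symmetric_opD[OF assms(1)] by (intro tendsto_intros lim)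
  ultimately show "inner (L x) y = inner x (L y)"
    by (rule LIMSEQ_unique)
qed

lemma symmetric_op_polarization:
  fixes T :: "'a::real_inner \<Rightarrow>\<^sub>L 'a"
  assumes "symmetric_op T"
  shows "inner (T (x + y)) (x + y) - inner (T (x - y)) (x - y) = 4 * inner (T x) y"
  using symmetric_opD[OF assms, of y x]
  by (simp add: blinfun.bilinear_simps inner_add_left inner_add_right
      inner_diff_left inner_diff_right inner_commute)

text \<open>Polarization recovers the bilinear form from its diagonal. In a real space symmetry is
  essential here: rotation of the plane by a right angle has the zero form.\<close>

lemma symmetric_op_eqI:
  fixes S T :: "'a::real_inner \<Rightarrow>\<^sub>L 'a"
  assumes "symmetric_op S" "symmetric_op T" "\<And>x. inner (S x) x = inner (T x) x"
  shows "S = T"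
proof (rule blinfun_eqI, rule inner_eq_imp_eq)
  fix x z
  have "4 * inner (S x) z = 4 * inner (T x) z"
    by (simp add: assms flip: symmetric_op_polarization)
  then show "inner z (S x) = inner z (T x)"
    by (simp add: inner_commute)
qed

text \<open>For \<open>y\<close> parallel to T x and as long as x, polarization expresses the
  product of the norms of T x and x by two values of the form, and the parallelogram law evaluates
  the resulting bound.\<close>

lemma symmetric_op_norm_le:
  fixes T :: "'a::real_inner \<Rightarrow>\<^sub>L 'a"
  assumes "symmetric_op T" "\<And>x. \<bar>inner (T x) x\<bar> \<le> c * (norm x)\<^sup>2" "0 \<le> c"
  shows "norm T \<le> c"
proof (rule norm_blinfun_bound[OF assms(3)])
  fix x
  show "norm (T x) \<le> c * norm x"
  proof (cases "x = 0 \<or> T x = 0")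
    case False
    define y where "y = (norm x / norm (T x)) *\<^sub>R T x"
    have ny: "norm y = norm x" using False by (simp add: y_def)
    have "4 * inner (T x) y = inner (T (x + y)) (x + y) - inner (T (x - y)) (x - y)"
      by (simp add: symmetric_op_polarization assms(1))
    also have "\<dots> \<le> c * (norm (x + y))\<^sup>2 + c * (norm (x - y))\<^sup>2"
      using assms(2)[of "x + y"] assms(2)[of "x - y"] by linarith
    also have "\<dots> = c * (2 * (norm x)\<^sup>2 + 2 * (norm y)\<^sup>2)"
      by (simp add: power2_norm_eq_inner inner_add_left inner_add_right
          inner_diff_left inner_diff_right inner_commute algebra_simps)
    also have "\<dots> = 4 * c * norm x * norm x"
      by (simp add: ny power2_eq_square)
    finally have "inner (T x) y \<le> c * norm x * norm x" by simp
    moreover have "inner (T x) y = norm x * norm (T x)"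
      using False by (simp add: y_def power2_eq_square flip: power2_norm_eq_inner)
    ultimately show ?thesis
      using False by (simp add: mult.commute mult.left_commute)
  qed (use assms(3) in auto)
qed

lemma blinfun_limit_bound:
  assumes "(\<lambda>n. T n) \<longlonglongrightarrow> (L :: 'a::real_normed_vector \<Rightarrow>\<^sub>L 'b::real_normed_vector)"
  shows "(\<lambda>n. T n x) \<longlonglongrightarrow> L x"
  by (intro tendsto_intros assms)

text \<open>
  Iterating \<open>Q \<mapsto> (S + Q\<^sup>2) / 2\<close> from \<open>0\<close> is dominated, step by step, by the same iteration
  for the number \<open>1\<close> in place of \<open>S\<close>; the limit solves \<open>(I - Q)\<^sup>2 = I - S\<close>.
\<close>

lemma sqrt_iteration:
  fixes S :: "'h::complex_hilbert_space op"
  assumes S: "symmetric_op S" "norm S \<le> 1"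
  shows "\<exists>Q. symmetric_op Q \<and> norm Q \<le> 1 \<and>
      (id_blinfun - Q) o\<^sub>L (id_blinfun - Q) = id_blinfun - S \<and>
      (\<forall>T. T o\<^sub>L S = S o\<^sub>L T \<longrightarrow> T o\<^sub>L Q = Q o\<^sub>L T)"
proof -
  define Q :: "nat \<Rightarrow> 'h op" where "Q = rec_nat 0 (\<lambda>_ q. (1/2) *\<^sub>R (S + (q o\<^sub>L q)))"
  define r :: "nat \<Rightarrow> real" where "r = rec_nat 0 (\<lambda>_ q. (1 + q\<^sup>2) / 2)"
  have Q0: "Q 0 = 0" and QS: "Q (Suc n) = (1/2) *\<^sub>R (S + (Q n o\<^sub>L Q n))" for n
    by (simp_all add: Q_def)
  have r0: "r 0 = 0" and rS: "r (Suc n) = (1 + (r n)\<^sup>2) / 2" for n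
    by (simp_all add: r_def)
  have r_bounds: "0 \<le> r n \<and> r n \<le> 1" for n
  proof (induction n)
    case (Suc n)
    then have "(r n)\<^sup>2 \<le> 1\<^sup>2" by (intro power_mono) auto
    then show ?case by (simp add: rS)
  qed (simp add: r0)
  have comm: "T o\<^sub>L Q n = Q n o\<^sub>L T" if "T o\<^sub>L S = S o\<^sub>L T" for T n
  proof (induction n)
    case (Suc n)
    have "T (S x) = S (T x)" "T (Q n x) = Q n (T x)" for x
      using that Suc by (metis blinfun_apply_blinfun_compose)+
    then show ?case
      by (intro blinfun_eqI) (simp add: QS blinfun.bilinear_simps)
  qed (simp add: Q0 blinfun_eqI)
  have sym: "symmetric_op (Q n)" for n
  proof (induction n)
    case (Suc n)
    then show ?case
      unfolding QS by (rule symmetric_op_scaleR[OF symmetric_op_add[OF S(1) symmetric_op_square]])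
  qed (simp add: Q0)
  \<comment> \<open>\<open>comm\<close> is used twice: S commutes with every iterate, and hence so
    does every iterate with every other.\<close>
  have QQ: "Q m o\<^sub>L Q n = Q n o\<^sub>L Q m" for m n
    by (rule comm[OF comm[OF refl, symmetric]])
  have Qr: "norm (Q n) \<le> r n" for n
  proof (induction n)
    case (Suc n)
    have "norm (Q (Suc n)) = norm (S + (Q n o\<^sub>L Q n)) / 2"
      by (simp add: QS)
    also have "\<dots> \<le> (norm S + norm (Q n) * norm (Q n)) / 2"
      by (intro divide_right_mono norm_triangle_mono norm_blinfun_compose) auto
    also have "\<dots> \<le> (1 + r n * r n) / 2"
      by (intro divide_right_mono add_mono mult_mono S Suc) (auto simp: r_bounds)
    finally show ?case by (simp add: rS power2_eq_square)
  qed (simp add: Q0 r0)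
  have step: "norm (Q (Suc n) - Q n) \<le> r (Suc n) - r n" for n
  proof (induction n)
    case 0
    show ?case using Qr[of "Suc 0"] by (simp add: Q0 r0)
  next
    case (Suc n)
    \<comment> \<open>Commuting iterates allow the difference of two squares to be factored. The
      numbers \<open>r n\<close> satisfy the same identity, so the bound passes from one step to the
      next.\<close>
    have "Q (Suc (Suc n)) - Q (Suc n) = (1/2) *\<^sub>R ((Q (Suc n) - Q n) o\<^sub>L (Q (Suc n) + Q n))"
    proof (rule blinfun_eqI)
      fix x
      have "Q (Suc n) (Q n x) = Q n (Q (Suc n) x)"
        by (metis QQ blinfun_apply_blinfun_compose)
      then show "(Q (Suc (Suc n)) - Q (Suc n)) x
          = ((1/2) *\<^sub>R ((Q (Suc n) - Q n) o\<^sub>L (Q (Suc n) + Q n))) x"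
        by (simp add: QS[of "Suc n"] blinfun.bilinear_simps)
           (simp add: QS[of n] blinfun.bilinear_simps algebra_simps)
    qed
    then have "norm (Q (Suc (Suc n)) - Q (Suc n))
        \<le> (norm (Q (Suc n) - Q n) * norm (Q (Suc n) + Q n)) / 2"
      by (simp add: norm_blinfun_compose)
    also have "\<dots> \<le> ((r (Suc n) - r n) * (r (Suc n) + r n)) / 2"
    proof (intro divide_right_mono mult_mono Suc norm_triangle_mono Qr)
      show "0 \<le> r (Suc n) - r n" using norm_ge_zero Suc by (rule order_trans)
    qed auto
    also have "\<dots> = r (Suc (Suc n)) - r (Suc n)"
      by (simp add: rS[of "Suc n"]) (simp add: rS[of n] field_simps power2_eq_square)
    finally show ?case .
  qed
  have r_mono: "r n \<le> r (Suc n)" for n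
    using order_trans[OF norm_ge_zero step[of n]] by simp
  \<comment> \<open>The numbers \<open>r n\<close> increase and are bounded, hence form a Cauchy
    sequence. Telescoping transfers this to \<open>Q\<close> in the operator norm.\<close>
  have tele: "norm (Q (m + k) - Q m) \<le> r (m + k) - r m" for m k
  proof (induction k)
    case (Suc k)
    have "norm (Q (m + Suc k) - Q m) \<le> norm (Q (Suc (m + k)) - Q (m + k)) + norm (Q (m + k) - Q m)"
      using norm_triangle_ineq[of "Q (Suc (m + k)) - Q (m + k)" "Q (m + k) - Q m"] by simp
    also have "\<dots> \<le> r (m + Suc k) - r m"
      using Suc step[of "m + k"] by simp
    finally show ?case .
  qed simp
  have "convergent r"
  proof (rule Bseq_monoseq_convergent)
    show "Bseq r"
      using r_bounds by (intro BseqI[where K = 1]) auto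
    show "monoseq r"
      using r_mono by (simp add: monoseq_Suc)
  qed
  then have Cr: "Cauchy r" by (rule convergent_Cauchy)
  have "Cauchy Q"
  proof (rule CauchyI')
    fix e :: real assume "0 < e"
    then obtain M where M: "\<forall>m\<ge>M. \<forall>n\<ge>M. norm (r m - r n) < e"
      using Cr CauchyD by blast
    have "norm (Q m - Q n) < e" if "m \<ge> M" "n > m" for m n
    proof -
      have "norm (Q m - Q n) \<le> r n - r m"
        using tele[of m "n - m"] that by (simp add: norm_minus_commute)
      also have "\<dots> < e"
        using M[rule_format, of n m] that by (simp add: abs_if split: if_splits)
      finally show ?thesis .
    qed
    then show "\<exists>M. \<forall>m\<ge>M. \<forall>n>m. dist (Q m) (Q n) < e"
      unfolding dist_norm by blast
  qed
  then obtain L where L: "Q \<longlonglongrightarrow> L"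
    using Cauchy_convergent convergent_def by blast
  have Lx: "(\<lambda>n. Q n x) \<longlonglongrightarrow> L x" for x
    by (rule blinfun_limit_bound[OF L])
  have "symmetric_op L"
    by (rule symmetric_op_limit[OF sym Lx])
  moreover have "norm L \<le> 1"
  proof (rule LIMSEQ_le_const2[OF tendsto_norm[OF L]])
    show "\<exists>N. \<forall>n\<ge>N. norm (Q n) \<le> 1" using Qr r_bounds order_trans by blast
  qed
  moreover have fix_L: "L = (1/2) *\<^sub>R (S + (L o\<^sub>L L))"
  proof (rule LIMSEQ_unique)
    show "(\<lambda>n. Q (Suc n)) \<longlonglongrightarrow> L" using L by (rule LIMSEQ_Suc)
    show "(\<lambda>n. Q (Suc n)) \<longlonglongrightarrow> (1/2) *\<^sub>R (S + (L o\<^sub>L L))"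
      unfolding QS
      by (intro tendsto_intros bounded_bilinear.tendsto[OF bounded_bilinear_blinfun_compose] L)
  qed
  moreover have "(id_blinfun - L) o\<^sub>L (id_blinfun - L) = id_blinfun - S"
  proof (rule blinfun_eqI)
    fix x
    have "L x = (1/2) *\<^sub>R (S x + L (L x))"
      using arg_cong[OF fix_L, of "\<lambda>T. blinfun_apply T x"] by (simp add: blinfun.bilinear_simps)
    then have "2 *\<^sub>R L x = 2 *\<^sub>R ((1/2) *\<^sub>R (S x + L (L x)))"
      by (rule arg_cong)
    then have "L (L x) = L x + L x - S x" by (simp add: scaleR_2 algebra_simps)
    then show "((id_blinfun - L) o\<^sub>L (id_blinfun - L)) x = (id_blinfun - S) x"
      by (simp add: blinfun.bilinear_simps)
  qed
  moreover have "T o\<^sub>L L = L o\<^sub>L T" if "T o\<^sub>L S = S o\<^sub>L T" for T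
  proof (rule LIMSEQ_unique)
    show "(\<lambda>n. T o\<^sub>L Q n) \<longlonglongrightarrow> (T o\<^sub>L L)"
      by (intro bounded_bilinear.tendsto[OF bounded_bilinear_blinfun_compose] tendsto_const L)
    show "(\<lambda>n. T o\<^sub>L Q n) \<longlonglongrightarrow> (L o\<^sub>L T)"
      unfolding comm[OF that]
      by (intro bounded_bilinear.tendsto[OF bounded_bilinear_blinfun_compose] tendsto_const L)
  qed
  ultimately show ?thesis by blast
qed

section \<open>Orthogonal projections\<close>

definition orth_proj :: "('a::real_inner \<Rightarrow>\<^sub>L 'a) \<Rightarrow> bool" where
  "orth_proj P \<longleftrightarrow> symmetric_op P \<and> P o\<^sub>L P = P"

lemma orth_proj_symmetric: "orth_proj P \<Longrightarrow> symmetric_op P"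
  by (simp add: orth_proj_def)

lemma orth_proj_idem: "orth_proj P \<Longrightarrow> P (P x) = P x"
  by (metis orth_proj_def blinfun_apply_blinfun_compose)

lemma orth_proj_inner: "orth_proj P \<Longrightarrow> inner (P x) x = (norm (P x))\<^sup>2"
  by (metis orth_proj_symmetric orth_proj_idem symmetric_opD power2_norm_eq_inner)

lemma orth_proj_0 [simp]: "orth_proj 0" and orth_proj_id [simp]: "orth_proj id_blinfun"
  by (simp_all add: orth_proj_def blinfun_eqI)

lemma orth_proj_compl: "orth_proj P \<Longrightarrow> orth_proj (id_blinfun - P)"
  unfolding orth_proj_def[of "id_blinfun - P"]
  by (auto simp: blinfun.bilinear_simps orth_proj_idem orth_proj_symmetric
      intro!: blinfun_eqI symmetric_op_diff)

lemma orth_proj_norm_le: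
  assumes "orth_proj P" shows "norm (P x) \<le> norm x"
proof -
  have "(norm (P x))\<^sup>2 \<le> norm (P x) * norm x"
    using norm_cauchy_schwarz[of "P x" x] by (simp add: orth_proj_inner[OF assms])
  then show ?thesis
    by (cases "P x = 0") (auto simp: power2_eq_square)
qed

lemma orth_proj_norm_diff:
  assumes "orth_proj P" shows "(norm (x - P x))\<^sup>2 = (norm x)\<^sup>2 - (norm (P x))\<^sup>2"
proof -
  have "(norm (x - P x))\<^sup>2 = (norm x)\<^sup>2 - 2 * inner (P x) x + (norm (P x))\<^sup>2"
    by (simp add: power2_norm_eq_inner inner_diff_left inner_diff_right inner_commute)
  then show ?thesis by (simp add: orth_proj_inner[OF assms])
qed

text \<open>On the range of Q the summand for Q already exhausts the squared norm, so nothing is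
  left for P. This turns additivity and total mass of measures into orthogonality of
  projections.\<close>

lemma orth_proj_comp_eq_0:
  assumes "orth_proj P" "orth_proj Q" "\<And>x. inner (P x) x + inner (Q x) x \<le> (norm x)\<^sup>2"
  shows "P o\<^sub>L Q = 0"
proof (rule blinfun_eqI)
  fix x
  have "(norm (P (Q x)))\<^sup>2 + (norm (Q x))\<^sup>2 \<le> (norm (Q x))\<^sup>2"
    using assms(3)[of "Q x"]
    by (simp add: orth_proj_inner[OF assms(1)] orth_proj_idem[OF assms(2)] power2_norm_eq_inner[of "Q x"])
  then show "(P o\<^sub>L Q) x = blinfun_apply 0 x" by simp
qed

text \<open>Take adjoints on both sides of the equation.\<close>

lemma symmetric_op_comp_swap:
  assumes "symmetric_op P" "symmetric_op Q" "symmetric_op R" "P o\<^sub>L Q = R"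
  shows "Q o\<^sub>L P = R"
proof (rule blinfun_eqI, rule inner_eq_imp_eq)
  fix x z
  have "inner z (Q (P x)) = inner (P (Q z)) x"
    using assms(1,2) by (simp add: symmetric_opD)
  also have "\<dots> = inner z (R x)"
    using assms(3,4) by (metis blinfun_apply_blinfun_compose symmetric_opD)
  finally show "inner z ((Q o\<^sub>L P) x) = inner z (R x)" by simp
qed

lemma orth_proj_add:
  assumes "orth_proj P" "orth_proj Q" "P o\<^sub>L Q = 0"
  shows "orth_proj (P + Q)"
proof -
  have "P (Q x) = 0" "Q (P x) = 0" for x
    using symmetric_op_comp_swap[OF _ _ _ assms(3)] assms orth_proj_symmetric
    by (metis blinfun_apply_blinfun_compose zero_blinfun.rep_eq symmetric_op_0)+
  then show ?thesis
    using assms(1,2)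
    by (auto simp: orth_proj_def blinfun.bilinear_simps orth_proj_idem
        intro!: blinfun_eqI symmetric_op_add)
qed

text \<open>The orthogonal decomposition is unique, and this uniqueness makes the map to the
  component in \<open>N\<close> linear.\<close>

lemma orth_proj_onto_exists:
  fixes N :: "'a::{real_inner,complete_space} set"
  assumes N: "closed N" "subspace N"
  shows "\<exists>P. orth_proj P \<and> (\<forall>x. P x \<in> N) \<and> (\<forall>x\<in>N. P x = x)"
proof -
  obtain p where pN: "\<And>x. p x \<in> N" and p_orth: "\<And>x z. z \<in> N \<Longrightarrow> inner (x - p x) z = 0"
    using orthogonal_decomposition_exists[OF N] by metis
  have p_unique: "p x = y" if "y \<in> N" "\<And>z. z \<in> N \<Longrightarrow> inner (x - y) z = 0" for x y
  proof -
    have d: "p x - y \<in> N" using pN that(1) N(2) by (simp add: subspace_diff)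
    have "inner (p x - y) (p x - y) = inner (x - y) (p x - y) - inner (x - p x) (p x - y)"
      by (simp add: inner_diff_left inner_diff_right)
    also have "\<dots> = 0" using that(2)[OF d] p_orth[OF d] by simp
    finally show ?thesis by simp
  qed
  have p_norm: "norm (p x) \<le> norm x" for x
  proof -
    have "inner x (p x) = (norm (p x))\<^sup>2"
      using p_orth[OF pN, of x x] by (simp add: inner_diff_left power2_norm_eq_inner)
    then have "norm (p x) * norm (p x) \<le> norm x * norm (p x)"
      using norm_cauchy_schwarz[of x "p x"] by (simp add: power2_eq_square)
    then show ?thesis by (cases "p x = 0") auto
  qed
  have "bounded_linear p"
  proof (rule bounded_linear_intro[where K = 1])
    show "p (x + y) = p x + p y" for x y
    proof (rule p_unique)
      fix z assume z: "z \<in> N"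
      show "inner (x + y - (p x + p y)) z = 0"
        using p_orth[OF z, of x] p_orth[OF z, of y] by (simp add: inner_diff_left inner_add_left)
    qed (use pN N(2) subspace_add in blast)
    show "p (r *\<^sub>R x) = r *\<^sub>R p x" for r x
    proof (rule p_unique)
      fix z assume z: "z \<in> N"
      show "inner (r *\<^sub>R x - r *\<^sub>R p x) z = 0"
        using p_orth[OF z, of x] by (simp add: inner_diff_left)
    qed (use pN N(2) subspace_scale in blast)
  qed (simp add: p_norm)
  then have P: "blinfun_apply (Blinfun p) = p"
    by (rule bounded_linear_Blinfun_apply)
  have "inner (p x) y = inner x (p y)" for x y
    using p_orth[OF pN, of x y] p_orth[OF pN, of y x]
    by (simp add: inner_diff_left inner_diff_right inner_commute[of y] inner_commute[of "p y"])
  moreover have fixN: "p x = x" if "x \<in> N" for x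
    using that by (intro p_unique) auto
  ultimately have "orth_proj (Blinfun p)"
    by (auto simp: orth_proj_def symmetric_op_def P pN intro!: blinfun_eqI)
  then show ?thesis
    using pN fixN by (intro exI[of _ "Blinfun p"]) (simp add: P)
qed

lemma commute_apply: "S o\<^sub>L T = T o\<^sub>L S \<Longrightarrow> S (T x) = T (S x)"
  by (metis blinfun_apply_blinfun_compose)

section \<open>The spectral resolution\<close>

text \<open>The absolute value of A is the square root I - Q that the iteration yields for S = I -
  A^2. It is positive because Q is a contraction, and it inherits every commutation from
  A^2.\<close>

lemma operator_abs_exists:
  fixes A :: "'h::complex_hilbert_space op"
  assumes A: "symmetric_op A" "norm A \<le> 1"
  shows "\<exists>R. symmetric_op R \<and> (\<forall>x. 0 \<le> inner (R x) x) \<and> R o\<^sub>L R = A o\<^sub>L A \<and>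
     (\<forall>T. T o\<^sub>L A = A o\<^sub>L T \<longrightarrow> T o\<^sub>L R = R o\<^sub>L T)"
proof -
  define S where "S = id_blinfun - (A o\<^sub>L A)"
  have S_sym: "symmetric_op S"
    unfolding S_def by (intro symmetric_op_diff symmetric_op_square A symmetric_op_id)
  have "norm S \<le> 1"
  proof (rule symmetric_op_norm_le[OF S_sym])
    fix x
    have "norm (A x) \<le> norm x"
      using norm_blinfun[of A x] mult_right_mono[OF A(2), of "norm x"] by simp
    then have "(norm (A x))\<^sup>2 \<le> (norm x)\<^sup>2"
      by (rule power_mono) simp
    moreover have "inner (S x) x = (norm x)\<^sup>2 - (norm (A x))\<^sup>2"
      by (simp add: S_def blinfun.bilinear_simps inner_diff_left power2_norm_eq_inner symmetric_opD[OF A(1)])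
    ultimately show "\<bar>inner (S x) x\<bar> \<le> 1 * (norm x)\<^sup>2" by simp
  qed simp
  then obtain Q where Q: "symmetric_op Q" "norm Q \<le> 1"
      "(id_blinfun - Q) o\<^sub>L (id_blinfun - Q) = id_blinfun - S"
    and Q_comm: "\<And>T. T o\<^sub>L S = S o\<^sub>L T \<Longrightarrow> T o\<^sub>L Q = Q o\<^sub>L T"
    using sqrt_iteration[OF S_sym] by blast
  show ?thesis
  proof (intro exI[of _ "id_blinfun - Q"] conjI allI impI)
    show "symmetric_op (id_blinfun - Q)"
      by (intro symmetric_op_diff Q symmetric_op_id)
    show "(id_blinfun - Q) o\<^sub>L (id_blinfun - Q) = A o\<^sub>L A"
      using Q(3) by (simp add: S_def)
    show "0 \<le> inner ((id_blinfun - Q) x) x" for x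
    proof -
      have "inner (Q x) x \<le> norm (Q x) * norm x" by (rule norm_cauchy_schwarz)
      also have "\<dots> \<le> norm x * norm x"
        using norm_blinfun[of Q x] mult_right_mono[OF Q(2), of "norm x"]
        by (intro mult_right_mono) auto
      finally show ?thesis
        by (simp add: blinfun.bilinear_simps inner_diff_left flip: power2_norm_eq_inner power2_eq_square)
    qed
    fix T assume T: "T o\<^sub>L A = A o\<^sub>L T"
    have "T o\<^sub>L S = S o\<^sub>L T"
      by (rule blinfun_eqI) (simp add: S_def blinfun.bilinear_simps commute_apply[OF T])
    from commute_apply[OF Q_comm[OF this]] show "T o\<^sub>L (id_blinfun - Q) = (id_blinfun - Q) o\<^sub>L T"
      by (intro blinfun_eqI) (simp add: blinfun.bilinear_simps)
  qed
qed

text \<open>A Cauchy-Schwarz argument: if R z were nonzero, moving from z a little against R z would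
  make the form negative.\<close>

lemma positive_form_eq_0:
  fixes R :: "'a::real_inner \<Rightarrow>\<^sub>L 'a"
  assumes R: "symmetric_op R" "\<And>x. 0 \<le> inner (R x) x" and "inner (R z) z = 0"
  shows "R z = 0"
proof (rule ccontr)
  assume "R z \<noteq> 0"
  define c where "c = inner (R (R z)) (R z)"
  \<comment> \<open>The form along this line is smallest for denominator c; the added 1 covers c = 0
    and still leaves it negative.\<close>
  define e where "e = (norm (R z))\<^sup>2 / (c + 1)"
  have c: "0 \<le> c" unfolding c_def by (rule R(2))
  have e: "0 < e" using c \<open>R z \<noteq> 0\<close> by (simp add: e_def)
  have "0 \<le> inner (R (z - e *\<^sub>R R z)) (z - e *\<^sub>R R z)"
    by (rule R(2))
  also have "\<dots> = e * (e * c - 2 * (norm (R z))\<^sup>2)"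
    using assms(3) symmetric_opD[OF R(1), of "R z" z]
    by (simp add: blinfun.bilinear_simps inner_diff_left inner_diff_right power2_norm_eq_inner
        c_def inner_commute algebra_simps)
  finally have "2 * (norm (R z))\<^sup>2 \<le> e * c"
    using e by (simp add: zero_le_mult_iff)
  also have "\<dots> \<le> (norm (R z))\<^sup>2"
    using c by (simp add: e_def field_simps)
  finally show False using \<open>R z \<noteq> 0\<close> by simp
qed

text \<open>
  The projection is onto the kernel of \<open>\<bar>A\<bar> + A\<close>: there \<open>A = - \<bar>A\<bar>\<close>, whereas
  \<open>A = \<bar>A\<bar>\<close> on its orthogonal complement because
  \<open>(\<bar>A\<bar> + A) (\<bar>A\<bar> - A) = 0\<close>.
\<close>

lemma nonpositive_projection_contraction:
  fixes A :: "'h::complex_hilbert_space op"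
  assumes A: "symmetric_op A" "norm A \<le> 1"
  shows "\<exists>P. orth_proj P \<and> (\<forall>T. T o\<^sub>L A = A o\<^sub>L T \<longrightarrow> T o\<^sub>L P = P o\<^sub>L T) \<and>
     (\<forall>x. P x = x \<longrightarrow> inner (A x) x \<le> 0) \<and>
     (\<forall>x. P x = 0 \<longrightarrow> 0 \<le> inner (A x) x) \<and>
     (\<forall>x. P x = 0 \<longrightarrow> inner (A x) x = 0 \<longrightarrow> x = 0)"
proof -
  obtain R where R: "symmetric_op R" "\<And>x. 0 \<le> inner (R x) x" "R o\<^sub>L R = A o\<^sub>L A"
    and R_comm: "\<And>T. T o\<^sub>L A = A o\<^sub>L T \<Longrightarrow> T o\<^sub>L R = R o\<^sub>L T"
    using operator_abs_exists[OF A] by blast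
  have RR: "R (R x) = A (A x)" for x
    using R(3) by (metis blinfun_apply_blinfun_compose)
  have AR: "A (R x) = R (A x)" for x
    by (rule commute_apply[OF R_comm]) simp
  define N where "N = {x. R x + A x = 0}"
  have clo: "closed N"
    unfolding N_def by (intro closed_Collect_eq continuous_intros)
  have sub: "subspace N"
    by (auto simp: N_def subspace_def blinfun.bilinear_simps algebra_simps
        simp flip: scaleR_right_distrib)
  obtain P where P: "orth_proj P" and PN: "\<And>x. P x \<in> N" and P_fix: "\<And>x. x \<in> N \<Longrightarrow> P x = x"
    using orth_proj_onto_exists[OF clo sub] by blast
  have orth: "inner (x - P x) z = 0" if "z \<in> N" for x z
    using symmetric_opD[OF orth_proj_symmetric[OF P], of x z] P_fix[OF that]
    by (simp add: inner_diff_left)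
  have comm: "T o\<^sub>L P = P o\<^sub>L T" if T: "T o\<^sub>L A = A o\<^sub>L T" for T
  proof (rule blinfun_eqI)
    fix x
    \<comment> \<open>Invariance of \<open>N\<close> under T alone does not give commutation with P.
      The adjoint also commutes with A and so preserves \<open>N\<close>, hence T preserves the
      orthogonal complement too.\<close>
    obtain T' :: "'h op" where T': "\<And>x y. inner (T x) y = inner x (T' y)"
      using real_adjoint_exists[of T] by blast
    have "T' o\<^sub>L A = A o\<^sub>L T'"
      by (rule blinfun_eqI, rule inner_eq_imp_eq)
         (simp add: symmetric_opD[OF A(1), symmetric] commute_apply[OF T] flip: T')
    note T'A = this
    have invar: "U y \<in> N" if "U o\<^sub>L A = A o\<^sub>L U" "y \<in> N" for U :: "'h op" and y
    proof -
      have "R (U y) + A (U y) = U (R y + A y)"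
        by (simp add: blinfun.add_right commute_apply[OF that(1)] commute_apply[OF R_comm[OF that(1)]])
      then show ?thesis using that(2) by (simp add: N_def)
    qed
    have "T (P x) \<in> N"
      by (rule invar[OF T PN])
    moreover have "P (T (x - P x)) = 0"
    proof -
      have "(norm (P (T (x - P x))))\<^sup>2 = inner (T (x - P x)) (P (T (x - P x)))"
        using orth_proj_inner[OF P, of "T (x - P x)"] by (simp add: inner_commute)
      also have "\<dots> = 0"
        unfolding T' by (rule orth[OF invar[OF T'A PN]])
      finally show ?thesis by simp
    qed
    ultimately show "(T o\<^sub>L P) x = (P o\<^sub>L T) x"
      using P_fix by (simp add: blinfun.bilinear_simps)
  qed
  have on_N: "inner (A x) x \<le> 0" if "P x = x" for x
  proof -
    have "A x = - R x" using PN[of x] that by (simp add: N_def eq_neg_iff_add_eq_0 add.commute)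
    then show ?thesis using R(2)[of x] by simp
  qed
  have A_eq_R: "A x = R x" if "P x = 0" for x
  proof -
    have "R x - A x \<in> N"
      by (simp add: N_def blinfun.bilinear_simps RR AR)
    \<comment> \<open>Since (R + A)(R - A) = 0, the vector (R - A)^2 x lies in \<open>N\<close> and
      is orthogonal to x. By symmetry of R - A this says that (R - A) x has norm 0.\<close>
    moreover from this have "R (R x - A x) - A (R x - A x) \<in> N"
      by (simp add: N_def blinfun.bilinear_simps RR AR)
    then have "inner x (R (R x - A x) - A (R x - A x)) = 0"
      using orth[of _ x] that by simp
    then have "inner (R x - A x) (R x - A x) = 0"
      by (simp add: inner_diff_left symmetric_opD[OF R(1)] symmetric_opD[OF A(1)] inner_diff_right blinfun.diff_right)
    then show ?thesis by simp
  qed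
  have "x = 0" if "P x = 0" "inner (A x) x = 0" for x
  proof -
    have "R x = 0"
      using positive_form_eq_0[OF R(1,2)] that A_eq_R by simp
    then have "x \<in> N" using A_eq_R[OF that(1)] by (simp add: N_def)
    then show ?thesis using P_fix that by simp
  qed
  then show ?thesis
    using P comm on_N A_eq_R R(2) by (intro exI[of _ P]) auto
qed

text \<open>All conditions on P survive positive scaling of A, so A may be scaled into the unit
  ball. The last clause says that P also absorbs the null directions of A; right-continuity of the
  resolution rests on it.\<close>

lemma nonpositive_projection_exists:
  fixes A :: "'h::complex_hilbert_space op"
  assumes A: "symmetric_op A"
  shows "\<exists>P. orth_proj P \<and> (\<forall>T. T o\<^sub>L A = A o\<^sub>L T \<longrightarrow> T o\<^sub>L P = P o\<^sub>L T) \<and>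
     (\<forall>x. P x = x \<longrightarrow> inner (A x) x \<le> 0) \<and>
     (\<forall>x. P x = 0 \<longrightarrow> 0 \<le> inner (A x) x) \<and>
     (\<forall>x. P x = 0 \<longrightarrow> inner (A x) x = 0 \<longrightarrow> x = 0)"
proof -
  define c where "c = 1 / (norm A + 1)"
  have c: "0 < c" by (simp add: c_def add_nonneg_pos)
  have 1: "symmetric_op (c *\<^sub>R A)" using A by (rule symmetric_op_scaleR)
  have 2: "norm (c *\<^sub>R A) \<le> 1"
    by (simp add: c_def divide_le_eq add_nonneg_pos)
  have 3: "T o\<^sub>L (c *\<^sub>R A) = (c *\<^sub>R A) o\<^sub>L T" if "T o\<^sub>L A = A o\<^sub>L T" for T
    by (rule blinfun_eqI) (simp add: blinfun.bilinear_simps commute_apply[OF that])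
  have 4: "inner ((c *\<^sub>R A) x) x = c * inner (A x) x" for x
    by (simp add: blinfun.bilinear_simps)
  show ?thesis
    using nonpositive_projection_contraction[OF 1 2] 3 c
    unfolding 4 by (auto simp: mult_le_0_iff zero_le_mult_iff)
qed

text \<open>By Pythagoras the squared distance between S n x and S m x is the increment of the
  squared norms, a bounded increasing sequence. Hence the convergence is strong, at each vector, and
  in general not in norm.\<close>

lemma orth_proj_limit:
  fixes S :: "nat \<Rightarrow> 'a::{real_inner,complete_space} \<Rightarrow>\<^sub>L 'a"
  assumes S: "\<And>n. orth_proj (S n)" and le: "\<And>m n. m \<le> n \<Longrightarrow> S n o\<^sub>L S m = S m"
  shows "\<exists>P. orth_proj P \<and> (\<forall>x. (\<lambda>n. S n x) \<longlonglongrightarrow> P x)"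
proof -
  have le': "S m (S n x) = S m x" "S n (S m x) = S m x" if "m \<le> n" for m n x
    using symmetric_op_comp_swap[OF _ _ _ le[OF that]] le[OF that] S orth_proj_symmetric
    by (metis blinfun_apply_blinfun_compose)+
  have diff: "(norm (S n x - S m x))\<^sup>2 = (norm (S n x))\<^sup>2 - (norm (S m x))\<^sup>2" if "m \<le> n" for m n x
    using orth_proj_norm_diff[OF S, of "S n x" m] by (simp add: le'[OF that])
  have "\<exists>y. (\<lambda>n. S n x) \<longlonglongrightarrow> y" for x
  proof -
    let ?r = "\<lambda>n. (norm (S n x))\<^sup>2"
    have "convergent ?r"
    proof (rule Bseq_monoseq_convergent)
      show "Bseq ?r"
        using orth_proj_norm_le[OF S, of _ x]
        by (intro BseqI'[where K = "(norm x)\<^sup>2"]) (simp add: power_mono)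
      have "?r n \<le> ?r (Suc n)" for n
        using diff[of n "Suc n" x] zero_le_power2[of "norm (S (Suc n) x - S n x)"] by linarith
      then show "monoseq ?r"
        by (simp add: monoseq_Suc)
    qed
    then have Cr: "Cauchy ?r" by (rule convergent_Cauchy)
    have "Cauchy (\<lambda>n. S n x)"
    proof (rule CauchyI')
      fix e :: real assume e: "0 < e"
      then obtain M where M: "\<forall>m\<ge>M. \<forall>n\<ge>M. norm (?r m - ?r n) < e\<^sup>2"
        using CauchyD[OF Cr, of "e\<^sup>2"] by auto
      have "norm (S m x - S n x) < e" if "m \<ge> M" "n > m" for m n
      proof -
        have "(norm (S m x - S n x))\<^sup>2 < e\<^sup>2"
          using diff[of m n x] M[rule_format, of n m] that by (simp add: norm_minus_commute)
        then show ?thesis using e by (simp add: power2_less_imp_less)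
      qed
      then show "\<exists>M. \<forall>m\<ge>M. \<forall>n>m. dist (S m x) (S n x) < e"
        unfolding dist_norm by blast
    qed
    then show ?thesis
      using Cauchy_convergent convergent_def by blast
  qed
  then obtain p where p: "\<And>x. (\<lambda>n. S n x) \<longlonglongrightarrow> p x"
    by metis
  have "bounded_linear p"
  proof (rule bounded_linear_intro[where K = 1])
    show "p (x + y) = p x + p y" for x y
      using tendsto_add[OF p[of x] p[of y]] p[of "x + y"]
      by (simp add: blinfun.add_right LIMSEQ_unique)
    show "p (r *\<^sub>R x) = r *\<^sub>R p x" for r x
      using tendsto_scaleR[OF tendsto_const p[of x], of r] p[of "r *\<^sub>R x"]
      by (simp add: blinfun.scaleR_right LIMSEQ_unique)
    show "norm (p x) \<le> norm x * 1" for x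
      by (rule LIMSEQ_le_const2[OF tendsto_norm[OF p]]) (simp add: orth_proj_norm_le S)
  qed
  then have P: "blinfun_apply (Blinfun p) = p"
    by (rule bounded_linear_Blinfun_apply)
  have "symmetric_op (Blinfun p)"
    by (rule symmetric_op_limit[of S]) (simp_all add: S orth_proj_symmetric P p)
  moreover have "p (p x) = p x" for x
  proof -
    have "S m (p x) = S m x" for m
    proof (rule LIMSEQ_unique)
      show "(\<lambda>n. S m (S n x)) \<longlonglongrightarrow> S m (p x)"
        by (intro tendsto_intros p)
      show "(\<lambda>n. S m (S n x)) \<longlonglongrightarrow> S m x"
        by (rule tendsto_eventually) (auto simp: eventually_sequentially le' intro!: exI[of _ m])
    qed
    then show ?thesis using p[of "p x"] p[of x] by (simp add: LIMSEQ_unique)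
  qed
  ultimately have "orth_proj (Blinfun p)"
    by (auto simp: orth_proj_def P intro!: blinfun_eqI)
  then show ?thesis
    using p by (intro exI[of _ "Blinfun p"]) (simp add: P)
qed

text \<open>\<open>E t\<close> is the projection of the previous lemmas for a - t. Everything else
  is read off from the two-sided estimates of the form on its range and on its kernel.\<close>

lemma spectral_resolution_exists:
  fixes a :: "'h::complex_hilbert_space op"
  assumes a: "symmetric_op a"
  obtains E where "\<And>t. orth_proj (E t)"
    and "\<And>T t. T o\<^sub>L a = a o\<^sub>L T \<Longrightarrow> T o\<^sub>L E t = E t o\<^sub>L T"
    and "\<And>s t. s \<le> t \<Longrightarrow> E t o\<^sub>L E s = E s"
    and "\<And>x t. continuous (at_right t) (\<lambda>t. inner (E t x) x)"
    and "\<And>t. t < - norm a \<Longrightarrow> E t = 0" and "\<And>t. t \<ge> norm a \<Longrightarrow> E t = id_blinfun"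
    and "\<And>x t. E t x = x \<Longrightarrow> inner (a x) x \<le> t * (norm x)\<^sup>2"
    and "\<And>x t. E t x = 0 \<Longrightarrow> t * (norm x)\<^sup>2 \<le> inner (a x) x"
proof -
  have sym: "symmetric_op (a - t *\<^sub>R id_blinfun)" for t
    by (intro symmetric_op_diff symmetric_op_scaleR a symmetric_op_id)
  have comm_shift: "T o\<^sub>L (a - t *\<^sub>R id_blinfun) = (a - t *\<^sub>R id_blinfun) o\<^sub>L T"
    if "T o\<^sub>L a = a o\<^sub>L T" for T t
    by (rule blinfun_eqI) (simp add: blinfun.bilinear_simps commute_apply[OF that])
  have form: "inner ((a - t *\<^sub>R id_blinfun) x) x = inner (a x) x - t * (norm x)\<^sup>2" for t x
    by (simp add: blinfun.bilinear_simps inner_diff_left power2_norm_eq_inner)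
  have "\<exists>P. orth_proj P \<and> (\<forall>T. T o\<^sub>L a = a o\<^sub>L T \<longrightarrow> T o\<^sub>L P = P o\<^sub>L T) \<and>
     (\<forall>x. P x = x \<longrightarrow> inner (a x) x \<le> t * (norm x)\<^sup>2) \<and>
     (\<forall>x. P x = 0 \<longrightarrow> t * (norm x)\<^sup>2 \<le> inner (a x) x) \<and>
     (\<forall>x. P x = 0 \<longrightarrow> inner (a x) x = t * (norm x)\<^sup>2 \<longrightarrow> x = 0)" for t
    using nonpositive_projection_exists[OF sym[of t]] comm_shift unfolding form by auto
  then obtain E where E: "\<And>t. orth_proj (E t)"
    and comm: "\<And>T t. T o\<^sub>L a = a o\<^sub>L T \<Longrightarrow> T o\<^sub>L E t = E t o\<^sub>L T"
    and le: "\<And>t x. E t x = x \<Longrightarrow> inner (a x) x \<le> t * (norm x)\<^sup>2"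
    and ge: "\<And>t x. E t x = 0 \<Longrightarrow> t * (norm x)\<^sup>2 \<le> inner (a x) x"
    and strict: "\<And>t x. E t x = 0 \<Longrightarrow> inner (a x) x = t * (norm x)\<^sup>2 \<Longrightarrow> x = 0"
    by metis
  have EE: "E s (E t x) = E t (E s x)" for s t x
    by (rule commute_apply, rule comm, rule comm[symmetric]) simp
  have mono: "E t (E s x) = E s x" if "s \<le> t" for s t x
  proof (cases "s = t")
    case False
    \<comment> \<open>This vector is in the range of \<open>E s\<close> and in the kernel of
      \<open>E t\<close>, so its form is at most s and at least t times its squared norm. For s < t
      it must vanish.\<close>
    define y where "y = E s x - E t (E s x)"
    have "E s y = y"
      by (simp add: y_def blinfun.diff_right EE[of s t] orth_proj_idem E)
    then have 1: "inner (a y) y \<le> s * (norm y)\<^sup>2" by (rule le)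
    have "E t y = 0"
      by (simp add: y_def blinfun.diff_right orth_proj_idem E)
    then have 2: "t * (norm y)\<^sup>2 \<le> inner (a y) y" by (rule ge)
    have "(t - s) * (norm y)\<^sup>2 \<le> 0"
      using 1 2 by (simp add: algebra_simps)
    then have "y = 0"
      using that False by (simp add: mult_le_0_iff)
    then show ?thesis by (simp add: y_def)
  qed (simp add: orth_proj_idem E)
  have rcont: "continuous (at_right t) (\<lambda>t. inner (E t x) x)" for x t
    unfolding continuous_within
  proof (rule tendsto_at_right_sequentially[of t "t + 1"])
    fix S :: "nat \<Rightarrow> real"
    assume S: "\<And>n. t < S n" "decseq S" "S \<longlonglongrightarrow> t"
    \<comment> \<open>Along a decreasing sequence the complements increase, so
      \<open>orth_proj_limit\<close> applies to them.\<close>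
    have "\<exists>P. orth_proj P \<and> (\<forall>x. (\<lambda>n. (id_blinfun - E (S n)) x) \<longlonglongrightarrow> P x)"
    proof (rule orth_proj_limit)
      show "orth_proj (id_blinfun - E (S n))" for n
        by (intro orth_proj_compl E)
      fix m n :: nat assume "m \<le> n"
      then have "S n \<le> S m" using S(2) by (simp add: decseq_def)
      then show "(id_blinfun - E (S n)) o\<^sub>L (id_blinfun - E (S m)) = id_blinfun - E (S m)"
        by (intro blinfun_eqI)
           (simp add: blinfun.bilinear_simps EE[of "S n" "S m"] mono flip: EE[of "S m" "S n"])
    qed
    then obtain P where P: "\<And>x. (\<lambda>n. (id_blinfun - E (S n)) x) \<longlonglongrightarrow> P x"
      by blast
    define y where "y = x - P x"
    have "(\<lambda>n. x - (id_blinfun - E (S n)) x) \<longlonglongrightarrow> y"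
      unfolding y_def by (intro tendsto_intros P)
    then have lim: "(\<lambda>n. E (S n) x) \<longlonglongrightarrow> y"
      by (simp add: blinfun.bilinear_simps)
    have Ey: "E (S m) y = y" for m
    proof (rule LIMSEQ_unique)
      show "(\<lambda>n. E (S m) (E (S n) x)) \<longlonglongrightarrow> E (S m) y"
        by (intro tendsto_intros lim)
      have "E (S m) (E (S n) x) = E (S n) x" if "n \<ge> m" for n
        using that S(2) by (intro mono) (simp add: decseq_def)
      then show "(\<lambda>n. E (S m) (E (S n) x)) \<longlonglongrightarrow> y"
        by (intro Lim_transform_eventually[OF lim]) (auto simp: eventually_sequentially intro!: exI[of _ m])
    qed
    have Ety: "E t y = E t x"
    proof (rule LIMSEQ_unique)
      show "(\<lambda>n. E t (E (S n) x)) \<longlonglongrightarrow> E t y"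
        by (intro tendsto_intros lim)
      have "E t (E (S n) x) = E t x" for n
        using mono[of t "S n" x] S(1)[of n] by (simp add: EE[of t])
      then show "(\<lambda>n. E t (E (S n) x)) \<longlonglongrightarrow> E t x" by simp
    qed
    \<comment> \<open>The possible jump at t: it lies in the range of every \<open>E (S m)\<close>
      but in the kernel of \<open>E t\<close>. Its form is therefore exactly t times its squared
      norm, which \<open>strict\<close> excludes unless z = 0.\<close>
    define z where "z = y - E t x"
    have z1: "E (S m) z = z" for m
      using Ey[of m] mono[of t "S m" x] S(1)[of m] by (simp add: z_def blinfun.diff_right)
    have z2: "E t z = 0"
      by (simp add: z_def blinfun.diff_right Ety orth_proj_idem E)
    have "inner (a z) z \<le> t * (norm z)\<^sup>2"
    proof (rule LIMSEQ_le_const)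
      show "(\<lambda>n. S n * (norm z)\<^sup>2) \<longlonglongrightarrow> t * (norm z)\<^sup>2"
        by (intro tendsto_intros S)
      show "\<exists>N. \<forall>n\<ge>N. inner (a z) z \<le> S n * (norm z)\<^sup>2"
        using le[OF z1] by blast
    qed
    then have "z = 0"
      using ge[OF z2] by (intro strict[OF z2]) simp
    then have "y = E t x" by (simp add: z_def)
    then show "(\<lambda>n. inner (E (S n) x) x) \<longlonglongrightarrow> inner (E t x) x"
      using tendsto_inner[OF lim tendsto_const, of x] by simp
  qed simp
  have a_bound: "\<bar>inner (a x) x\<bar> \<le> norm a * (norm x)\<^sup>2" for x
  proof -
    have "\<bar>inner (a x) x\<bar> \<le> norm (a x) * norm x" by (rule Cauchy_Schwarz_ineq2)
    also have "\<dots> \<le> (norm a * norm x) * norm x"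
      by (intro mult_right_mono norm_blinfun) auto
    finally show ?thesis by (simp add: power2_eq_square mult.assoc)
  qed
  have low: "E t = 0" if "t < - norm a" for t
  proof (rule blinfun_eqI)
    fix x
    have "inner (a (E t x)) (E t x) \<le> t * (norm (E t x))\<^sup>2"
      by (rule le) (simp add: orth_proj_idem E)
    then have "(- norm a - t) * (norm (E t x))\<^sup>2 \<le> 0"
      using a_bound[of "E t x"] by (simp add: algebra_simps abs_le_iff)
    then show "E t x = blinfun_apply 0 x"
      using that by (simp add: mult_le_0_iff)
  qed
  have high: "E t = id_blinfun" if "t \<ge> norm a" for t
  proof (rule blinfun_eqI)
    fix x
    define y where "y = x - E t x"
    have y0: "E t y = 0" by (simp add: y_def blinfun.diff_right orth_proj_idem E)
    have "norm a * (norm y)\<^sup>2 \<le> t * (norm y)\<^sup>2" using that by (intro mult_right_mono) auto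
    then have "inner (a y) y = t * (norm y)\<^sup>2"
      using a_bound[of y] ge[OF y0] by (simp add: abs_le_iff)
    then have "y = 0" by (rule strict[OF y0])
    then show "E t x = id_blinfun x" by (simp add: y_def)
  qed
  have mono': "E t o\<^sub>L E s = E s" if "s \<le> t" for s t
    using mono[OF that] by (intro blinfun_eqI) simp
  show thesis
    by (rule that[OF E comm mono' rcont low high le ge])
qed

text \<open>Half-lines form an intersection-stable generator, so only complements and disjoint
  unions have to be treated. Both the orthogonality of the summands and the monotonicity of the
  partial sums are read off from the diagonal measures.\<close>

lemma projections_extend_to_borel:
  fixes E :: "real \<Rightarrow> 'h::complex_hilbert_space op" and \<mu> :: "'h \<Rightarrow> real measure"
  assumes sets_\<mu>: "\<And>x. sets (\<mu> x) = sets borel"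
    and fin: "\<And>x. finite_measure (\<mu> x)" and total: "\<And>x. measure (\<mu> x) UNIV = (norm x)\<^sup>2"
    and E: "\<And>t. orth_proj (E t)" "\<And>t x. measure (\<mu> x) {..t} = inner (E t x) x"
    and B: "B \<in> sets borel"
  shows "\<exists>P. orth_proj P \<and> (\<forall>x. inner (P x) x = measure (\<mu> x) B) \<and>
           (\<forall>T. (\<forall>t. T o\<^sub>L E t = E t o\<^sub>L T) \<longrightarrow> T o\<^sub>L P = P o\<^sub>L T)"
    (is "\<exists>P. ?Q P B")
proof -
  have space_\<mu>: "space (\<mu> x) = UNIV" for x
    using sets_eq_imp_space_eq[OF sets_\<mu>] by simp
  let ?G = "range (\<lambda>t::real. {..t})"
  have borel: "sets borel = sigma_sets UNIV ?G"
    by (subst borel_eq_atMost) simp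
  have Int: "Int_stable ?G"
    by (auto simp: Int_stable_def)
  have "?G \<subseteq> Pow UNIV" "B \<in> sigma_sets UNIV ?G"
    using B by (auto simp: borel)
  with Int show ?thesis
  proof (induction rule: sigma_sets_induct_disjoint)
    case (basic A)
    then obtain t where "A = {..t}" by auto
    then show ?case using E by (intro exI[of _ "E t"]) auto
  next
    case empty
    show ?case by (intro exI[of _ 0]) auto
  next
    case (compl A)
    then obtain P where P: "?Q P A" by blast
    have A: "A \<in> sets borel" using compl by (simp add: borel)
    have "measure (\<mu> x) (UNIV - A) = inner ((id_blinfun - P) x) x" for x
    proof -
      interpret finite_measure "\<mu> x" by (rule fin)
      show ?thesis
        using finite_measure_compl[of A] A P
        by (simp add: sets_\<mu> space_\<mu> total blinfun.bilinear_simps inner_diff_left power2_norm_eq_inner)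
    qed
    moreover have "T o\<^sub>L (id_blinfun - P) = (id_blinfun - P) o\<^sub>L T"
      if "\<forall>t. T o\<^sub>L E t = E t o\<^sub>L T" for T
      using P that commute_apply[of T P] by (intro blinfun_eqI) (simp add: blinfun.bilinear_simps)
    ultimately show ?case
      using P orth_proj_compl by (intro exI[of _ "id_blinfun - P"]) auto
  next
    case (union A)
    have A: "A i \<in> sets borel" for i using union(2) by (auto simp: borel)
    obtain P where P: "\<And>i. ?Q (P i) (A i)" using union(3) by metis
    define S where "S n = (\<Sum>i<n. P i)" for n
    have S0: "S 0 = 0" and SS: "S (Suc n) = S n + P n" for n
      by (simp_all add: S_def)
    have inner_S: "inner (S n x) x = measure (\<mu> x) (\<Union>i<n. A i)" for n x
    proof -
      interpret finite_measure "\<mu> x" by (rule fin)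
      have "measure (\<mu> x) (\<Union>i<n. A i) = (\<Sum>i<n. measure (\<mu> x) (A i))"
        using union(1) A by (intro finite_measure_finite_Union) (auto simp: sets_\<mu> disjoint_family_on_def)
      then show ?thesis
        using P by (simp add: S_def blinfun.sum_left inner_sum_left)
    qed
    have S_proj: "orth_proj (S n)" for n
    proof (induction n)
      case (Suc n)
      have "S n o\<^sub>L P n = 0"
      proof (rule orth_proj_comp_eq_0)
        fix x
        interpret finite_measure "\<mu> x" by (rule fin)
        have "inner (S n x) x + inner (P n x) x = inner (S (Suc n) x) x"
          by (simp add: SS blinfun.add_left inner_add_left)
        also have "\<dots> \<le> (norm x)\<^sup>2"
          using bounded_measure[of "\<Union>i<Suc n. A i"] by (simp add: inner_S space_\<mu> total)
        finally show "inner (S n x) x + inner (P n x) x \<le> (norm x)\<^sup>2" .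
      qed (use Suc P in auto)
      then show ?case using Suc P by (simp add: SS orth_proj_add)
    qed (simp add: S0)
    have S_le: "S n o\<^sub>L S m = S m" if "m \<le> n" for m n
    proof -
      \<comment> \<open>Domination of S m by S n, phrased as orthogonality of S m to the complement
        of S n.\<close>
      have "(id_blinfun - S n) o\<^sub>L S m = 0"
      proof (rule orth_proj_comp_eq_0[OF orth_proj_compl[OF S_proj] S_proj])
        fix x
        interpret finite_measure "\<mu> x" by (rule fin)
        have "measure (\<mu> x) (\<Union>i<m. A i) \<le> measure (\<mu> x) (\<Union>i<n. A i)"
          using that A by (intro finite_measure_mono UN_mono) (auto simp: sets_\<mu>)
        then show "inner ((id_blinfun - S n) x) x + inner (S m x) x \<le> (norm x)\<^sup>2"
          by (simp add: blinfun.bilinear_simps inner_diff_left inner_S power2_norm_eq_inner)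
      qed
      from arg_cong[OF this, of blinfun_apply] show ?thesis
        by (auto simp: blinfun.bilinear_simps fun_eq_iff intro!: blinfun_eqI)
    qed
    obtain L where L: "orth_proj L" and lim: "\<And>x. (\<lambda>n. S n x) \<longlonglongrightarrow> L x"
      using orth_proj_limit[of S, OF S_proj S_le] by blast
    have "inner (L x) x = measure (\<mu> x) (\<Union>i. A i)" for x
    proof (rule LIMSEQ_unique)
      interpret finite_measure "\<mu> x" by (rule fin)
      show "(\<lambda>n. inner (S n x) x) \<longlonglongrightarrow> inner (L x) x"
        by (intro tendsto_intros lim)
      have "incseq (\<lambda>n. \<Union>i<n. A i)"
        by (intro incseq_SucI UN_mono) auto
      then have "(\<lambda>n. measure (\<mu> x) (\<Union>i<n. A i)) \<longlonglongrightarrow> measure (\<mu> x) (\<Union>n. \<Union>i<n. A i)"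
        using A by (intro finite_Lim_measure_incseq) (auto simp: sets_\<mu>)
      also have "(\<Union>n. \<Union>i<n. A i) = (\<Union>i. A i)" by auto
      finally show "(\<lambda>n. inner (S n x) x) \<longlonglongrightarrow> measure (\<mu> x) (\<Union>i. A i)"
        by (simp add: inner_S)
    qed
    moreover have "T o\<^sub>L L = L o\<^sub>L T" if T: "\<forall>t. T o\<^sub>L E t = E t o\<^sub>L T" for T
    proof (rule blinfun_eqI)
      fix x
      have "T (P i x) = P i (T x)" for i x
        using P T by (blast intro: commute_apply)
      then have "T (S n x) = S n (T x)" for n
        by (simp add: S_def blinfun.sum_left blinfun.sum_right)
      moreover have "(\<lambda>n. T (S n x)) \<longlonglongrightarrow> T (L x)"
        by (intro tendsto_intros lim)
      ultimately show "(T o\<^sub>L L) x = (L o\<^sub>L T) x"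
        using lim[of "T x"] by (simp add: LIMSEQ_unique)
    qed
    ultimately show ?case using L by blast
  qed
qed

section \<open>Integration against a family of projections\<close>

definition bounded_borel :: "(real \<Rightarrow> real) \<Rightarrow> bool" where
  "bounded_borel g \<longleftrightarrow> g \<in> borel_measurable borel \<and> (\<exists>C. \<forall>t. \<bar>g t\<bar> \<le> C)"

lemma bounded_borel_const [simp]: "bounded_borel (\<lambda>t. c)"
  by (auto simp: bounded_borel_def)

lemma bounded_borel_indicator [simp]: "B \<in> sets borel \<Longrightarrow> bounded_borel (indicator B)"
  by (auto simp: bounded_borel_def intro!: exI[of _ 1] split: split_indicator)

lemma bounded_borel_add:
  assumes "bounded_borel g" "bounded_borel h" shows "bounded_borel (\<lambda>t. g t + h t)"
proof -
  obtain C D where "\<And>t. \<bar>g t\<bar> \<le> C" "\<And>t. \<bar>h t\<bar> \<le> D"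
    using assms by (auto simp: bounded_borel_def)
  then have "\<bar>g t + h t\<bar> \<le> C + D" for t
    using abs_triangle_ineq[of "g t" "h t"] add_mono by (blast intro: order_trans)
  then show ?thesis
    using assms by (auto simp: bounded_borel_def)
qed

lemma bounded_borel_mult:
  assumes "bounded_borel g" "bounded_borel h" shows "bounded_borel (\<lambda>t. g t * h t)"
proof -
  obtain C D where "\<And>t. \<bar>g t\<bar> \<le> C" "\<And>t. \<bar>h t\<bar> \<le> D"
    using assms by (auto simp: bounded_borel_def)
  then have "\<bar>g t * h t\<bar> \<le> C * D" for t
    unfolding abs_mult by (intro mult_mono) (auto intro: order_trans[OF abs_ge_zero])
  then show ?thesis
    using assms by (auto simp: bounded_borel_def)
qed

lemma bounded_borel_diff:
  "bounded_borel g \<Longrightarrow> bounded_borel h \<Longrightarrow> bounded_borel (\<lambda>t. g t - h t)"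
  using bounded_borel_add[of g "\<lambda>t. - 1 * h t"] bounded_borel_mult[OF bounded_borel_const, of h "- 1"]
  by simp

lemma bounded_borel_power: "bounded_borel g \<Longrightarrow> bounded_borel (\<lambda>t. (g t)\<^sup>2)"
  unfolding power2_eq_square by (rule bounded_borel_mult)

lemmas bounded_borel_intros =
  bounded_borel_const bounded_borel_indicator bounded_borel_add bounded_borel_diff
  bounded_borel_mult bounded_borel_power

text \<open>Rounding down to a grid of mesh 1 / (n + 1). The error is uniform in t, which later
  gives convergence in operator norm.\<close>

definition discretization :: "nat \<Rightarrow> (real \<Rightarrow> real) \<Rightarrow> real \<Rightarrow> real" where
  "discretization n g t = of_int \<lfloor>real (Suc n) * g t\<rfloor> / real (Suc n)"

lemma discretization_close: "\<bar>g t - discretization n g t\<bar> \<le> inverse (real (Suc n))"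
proof -
  have "\<bar>real (Suc n) * g t - of_int \<lfloor>real (Suc n) * g t\<rfloor>\<bar> \<le> 1"
    by linarith
  then have "\<bar>real (Suc n) * (g t - discretization n g t)\<bar> \<le> 1"
    unfolding discretization_def by (simp add: right_diff_distrib del: of_nat_Suc)
  then show ?thesis
    unfolding abs_mult by (simp add: field_simps del: of_nat_Suc)
qed

lemma discretization_finite_range:
  assumes "bounded_borel g" shows "finite (range (discretization n g))"
proof -
  obtain C where C: "\<And>t. \<bar>g t\<bar> \<le> C"
    using assms by (auto simp: bounded_borel_def)
  \<comment> \<open>The added 1 accounts for negative values, whose floor may lie one below the
    negated floor of the bound.\<close>
  let ?N = "\<lfloor>real (Suc n) * C\<rfloor> + 1"
  have "\<lfloor>real (Suc n) * g t\<rfloor> \<in> {- ?N .. ?N}" for t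
  proof -
    have "\<bar>real (Suc n) * g t\<bar> \<le> real (Suc n) * C"
      using C[of t] by (simp add: abs_mult del: of_nat_Suc)
    then show ?thesis by simp linarith
  qed
  then have "range (discretization n g) \<subseteq> (\<lambda>k. of_int k / real (Suc n)) ` {- ?N .. ?N}"
    unfolding discretization_def by blast
  then show ?thesis
    by (rule finite_subset) simp
qed

lemma discretization_measurable:
  assumes "bounded_borel g" shows "discretization n g \<in> borel_measurable borel"
proof -
  have [measurable]: "g \<in> borel_measurable borel"
    using assms by (simp add: bounded_borel_def)
  show ?thesis
    unfolding discretization_def[abs_def] by measurable
qed

lemma bounded_borel_finite_range:
  assumes "s \<in> borel_measurable borel" "finite (range s)"
  shows "bounded_borel s"
proof -
  have "finite ((\<lambda>t. \<bar>s t\<bar>) ` UNIV)"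
    using finite_imageI[OF assms(2), of abs] by (simp add: image_image)
  then have "\<bar>s t\<bar> \<le> Max (range (\<lambda>t. \<bar>s t\<bar>))" for t
    by (intro Max_ge) auto
  then show ?thesis
    using assms(1) by (auto simp: bounded_borel_def)
qed

text \<open>The factor c serves two uses: 1 for the simple function itself, and the value of a
  second function in the proof of multiplicativity.\<close>

lemma finite_range_eq_sum:
  fixes s :: "'a \<Rightarrow> real"
  assumes "finite (range s)"
  shows "s t * c = (\<Sum>v\<in>range s. v * (indicator (s -` {v}) t * c))"
proof -
  have "(\<Sum>v\<in>range s. v * (indicator (s -` {v}) t * c)) = (\<Sum>v\<in>range s. if v = s t then v * c else 0)"
    by (intro sum.cong) (auto simp: indicator_def)
  then show ?thesis using assms by simp
qed

text \<open>The diagonal measures are parameters rather than \<open>vector_measure F\<close>, so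
  that the theory is available before \<open>F\<close> is known to be a projection-valued measure,
  and applies verbatim to push-forwards.\<close>

locale projection_family =
  fixes F :: "real set \<Rightarrow> 'h::complex_hilbert_space op" and \<mu> :: "'h \<Rightarrow> real measure"
  assumes sets_\<mu> [measurable_cong, simp]: "\<And>x. sets (\<mu> x) = sets borel"
    and finite_\<mu>: "\<And>x. finite_measure (\<mu> x)"
    and total: "\<And>x. measure (\<mu> x) UNIV = (norm x)\<^sup>2"
    and proj: "\<And>B. B \<in> sets borel \<Longrightarrow> orth_proj (F B)"
    and inner_F: "\<And>B x. B \<in> sets borel \<Longrightarrow> inner (F B x) x = measure (\<mu> x) B"
begin

lemma space_\<mu> [simp]: "space (\<mu> x) = UNIV"
  using sets_eq_imp_space_eq[OF sets_\<mu>] by simp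

lemma measurable_\<mu> [simp]: "borel_measurable (\<mu> x) = borel_measurable borel"
  by (rule measurable_cong_sets) simp_all

lemma emeasure_\<mu>: "emeasure (\<mu> x) B = ennreal (measure (\<mu> x) B)"
  using finite_measure.emeasure_eq_measure[OF finite_\<mu>] by blast

lemma integrable_\<mu>: "bounded_borel g \<Longrightarrow> integrable (\<mu> x) g"
  using finite_measure.integrable_const_bound[OF finite_\<mu>, of g _ x]
  by (auto simp: bounded_borel_def)

lemma norm_F: "B \<in> sets borel \<Longrightarrow> (norm (F B x))\<^sup>2 = measure (\<mu> x) B"
  by (metis inner_F orth_proj_inner proj)

lemma F_sym: "B \<in> sets borel \<Longrightarrow> symmetric_op (F B)"
  by (simp add: proj orth_proj_symmetric)

lemma F_eqI:
  assumes "symmetric_op T" "B \<in> sets borel" "\<And>x. inner (T x) x = measure (\<mu> x) B"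
  shows "F B = T"
  using assms by (intro symmetric_op_eqI) (auto simp: F_sym inner_F)

lemma F_empty [simp]: "F {} = 0" and F_UNIV [simp]: "F UNIV = id_blinfun"
  by (auto intro!: F_eqI simp: total power2_norm_eq_inner)

lemma F_Un:
  assumes "A \<in> sets borel" "B \<in> sets borel" "A \<inter> B = {}"
  shows "F (A \<union> B) = F A + F B"
proof (rule F_eqI)
  fix x
  interpret finite_measure "\<mu> x" by (rule finite_\<mu>)
  show "inner ((F A + F B) x) x = measure (\<mu> x) (A \<union> B)"
    using assms by (simp add: blinfun.add_left inner_add_left inner_F finite_measure_Union)
qed (use assms in \<open>auto intro: symmetric_op_add F_sym\<close>)

lemma F_disjoint:
  assumes "A \<in> sets borel" "B \<in> sets borel" "A \<inter> B = {}"
  shows "F A (F B x) = 0"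
proof -
  have "F A o\<^sub>L F B = 0"
  proof (rule orth_proj_comp_eq_0)
    fix x
    interpret finite_measure "\<mu> x" by (rule finite_\<mu>)
    have "measure (\<mu> x) A + measure (\<mu> x) B = measure (\<mu> x) (A \<union> B)"
      using assms by (simp add: finite_measure_Union)
    also have "\<dots> \<le> (norm x)\<^sup>2"
      using bounded_measure[of "A \<union> B"] by (simp add: total)
    finally show "inner (F A x) x + inner (F B x) x \<le> (norm x)\<^sup>2"
      using assms by (simp add: inner_F)
  qed (use assms proj in auto)
  then show ?thesis
    by (metis blinfun_apply_blinfun_compose zero_blinfun.rep_eq)
qed

text \<open>Splitting A and B along their intersection gives four products, three of which involve
  disjoint sets.\<close>

lemma F_Int:
  assumes A: "A \<in> sets borel" and B: "B \<in> sets borel"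
  shows "F A (F B x) = F (A \<inter> B) x"
proof -
  have "A \<inter> B \<union> (A - B) = A" "A \<inter> B \<union> (B - A) = B" by auto
  then have "F A = F (A \<inter> B) + F (A - B)" "F B = F (A \<inter> B) + F (B - A)"
    using F_Un[of "A \<inter> B" "A - B"] F_Un[of "A \<inter> B" "B - A"] A B by auto
  moreover have "F (A \<inter> B) (F (B - A) x) = 0" "F (A - B) (F (A \<inter> B) x) = 0" "F (A - B) (F (B - A) x) = 0"
    by (rule F_disjoint; use A B in auto)+
  moreover have "F (A \<inter> B) (F (A \<inter> B) x) = F (A \<inter> B) x"
    using A B by (simp add: orth_proj_idem proj)
  ultimately show ?thesis
    by (simp add: blinfun.add_left blinfun.add_right)
qed

lemma F_commute: "A \<in> sets borel \<Longrightarrow> B \<in> sets borel \<Longrightarrow> F A (F B x) = F B (F A x)"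
  by (simp add: F_Int Int_commute)

text \<open>The squared distance from a partial sum to the expected limit is the measure of the
  remaining tail, so continuity of the measure gives strong convergence.\<close>

lemma F_sums:
  assumes "range B \<subseteq> sets borel" "disjoint_family B"
  shows "(\<lambda>n. F (B n) x) sums F (\<Union>n. B n) x"
proof -
  interpret finite_measure "\<mu> x" by (rule finite_\<mu>)
  have B: "B i \<in> sets borel" for i using assms(1) by auto
  have part: "(\<Sum>i<n. F (B i) x) = F (\<Union>i<n. B i) x" for n
  proof (induction n)
    case (Suc n)
    have "B n \<inter> B i = {}" if "i < n" for i
      using assms(2) that by (intro disjoint_family_onD) auto
    then have "F (B n \<union> (\<Union>i<n. B i)) = F (B n) + F (\<Union>i<n. B i)"
      using B by (intro F_Un) auto
    then show ?case
      using Suc by (simp add: lessThan_Suc blinfun.add_left)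
  qed simp
  have U: "(\<Union>n. B n) \<in> sets borel" "(\<Union>i<n. B i) \<in> sets borel" for n
    using B by auto
  have "(norm (F (\<Union>i<n. B i) x - F (\<Union>n. B n) x))\<^sup>2
      = measure (\<mu> x) (\<Union>n. B n) - measure (\<mu> x) (\<Union>i<n. B i)" for n
  proof -
    have "(\<Union>i<n. B i) \<inter> (\<Union>n. B n) = (\<Union>i<n. B i)" by auto
    then have "F (\<Union>i<n. B i) (F (\<Union>n. B n) x) = F (\<Union>i<n. B i) x"
      using U by (simp add: F_Int)
    then show ?thesis
      using orth_proj_norm_diff[OF proj[OF U(2)], of "F (\<Union>n. B n) x" n] U
      by (simp add: norm_minus_commute flip: norm_F)
  qed
  moreover have "(\<lambda>n. measure (\<mu> x) (\<Union>n. B n) - measure (\<mu> x) (\<Union>i<n. B i)) \<longlonglongrightarrow> 0"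
  proof -
    have "incseq (\<lambda>n. \<Union>i<n. B i)"
      by (intro incseq_SucI UN_mono) auto
    then have "(\<lambda>n. measure (\<mu> x) (\<Union>i<n. B i)) \<longlonglongrightarrow> measure (\<mu> x) (\<Union>n. \<Union>i<n. B i)"
      using B by (intro finite_Lim_measure_incseq) auto
    also have "(\<Union>n. \<Union>i<n. B i) = (\<Union>n. B n)" by auto
    finally have "(\<lambda>n. measure (\<mu> x) (\<Union>i<n. B i)) \<longlonglongrightarrow> measure (\<mu> x) (\<Union>n. B n)" .
    from tendsto_diff[OF tendsto_const[of "measure (\<mu> x) (\<Union>n. B n)"] this] show ?thesis
      by simp
  qed
  ultimately have "(\<lambda>n. (norm (F (\<Union>i<n. B i) x - F (\<Union>n. B n) x))\<^sup>2) \<longlonglongrightarrow> 0"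
    by simp
  then have "(\<lambda>n. norm (F (\<Union>i<n. B i) x - F (\<Union>n. B n) x)) \<longlonglongrightarrow> 0"
    by (simp add: tendsto_power_zero power_tendsto_0_iff)
  then show ?thesis
    unfolding sums_def part by (simp add: tendsto_norm_zero_iff LIM_zero_iff)
qed

text \<open>Since F A (F B x) = F (A \<inter> B) x, projecting the vector restricts its
  measure.\<close>

lemma \<mu>_F:
  assumes B: "B \<in> sets borel"
  shows "\<mu> (F B x) = density (\<mu> x) (indicator B)"
proof (rule measure_eqI)
  fix A assume "A \<in> sets (\<mu> (F B x))"
  then have A: "A \<in> sets borel" by simp
  have "measure (\<mu> (F B x)) A = measure (\<mu> x) (A \<inter> B)"
    using A B by (simp add: F_Int flip: norm_F)
  moreover have "emeasure (density (\<mu> x) (indicator B)) A = emeasure (\<mu> x) (A \<inter> B)"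
    using A B by (simp add: emeasure_density Int_commute flip: indicator_inter_arith)
  ultimately show "emeasure (\<mu> (F B x)) A = emeasure (density (\<mu> x) (indicator B)) A"
    by (simp add: emeasure_\<mu>)
qed simp

lemma integral_\<mu>_F:
  fixes g :: "real \<Rightarrow> real"
  assumes "B \<in> sets borel" "g \<in> borel_measurable borel"
  shows "(\<integral>t. g t \<partial>\<mu> (F B x)) = (\<integral>t. indicator B t * g t \<partial>\<mu> x)"
proof -
  have eq: "\<mu> (F B x) = density (\<mu> x) (\<lambda>t. ennreal (indicator B t))"
    by (simp add: \<mu>_F assms ennreal_indicator)
  show ?thesis
    unfolding eq using assms by (subst integral_density) auto
qed

text \<open>A weak integral given by its diagonal; symmetry makes T unique. The notion refers to the
  measures only, hence \<open>projection_family.op_integral\<close> takes just \<mu> as argument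
  outside the locale.\<close>

definition is_integral :: "(real \<Rightarrow> real) \<Rightarrow> 'h op \<Rightarrow> bool" where
  "is_integral g T \<longleftrightarrow> symmetric_op T \<and> (\<forall>x. inner (T x) x = (\<integral>t. g t \<partial>\<mu> x))"

definition op_integral :: "(real \<Rightarrow> real) \<Rightarrow> 'h op" where
  "op_integral g = (THE T. is_integral g T)"

lemma op_integral_eqI: "is_integral g T \<Longrightarrow> op_integral g = T"
  unfolding op_integral_def is_integral_def by (rule the_equality) (auto intro: symmetric_op_eqI)

lemma integral_abs_le:
  assumes "bounded_borel g" "\<And>t. \<bar>g t\<bar> \<le> c"
  shows "\<bar>\<integral>t. g t \<partial>\<mu> x\<bar> \<le> c * (norm x)\<^sup>2"
proof -
  interpret finite_measure "\<mu> x" by (rule finite_\<mu>)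
  have "\<bar>\<integral>t. g t \<partial>\<mu> x\<bar> \<le> (\<integral>t. \<bar>g t\<bar> \<partial>\<mu> x)"
    by (rule integral_abs_bound)
  also have "\<dots> \<le> (\<integral>t. c \<partial>\<mu> x)"
    using assms integrable_\<mu>[OF assms(1)] by (intro integral_mono) auto
  finally show ?thesis by (simp add: total mult.commute)
qed

lemma is_integral_diff_norm:
  assumes "is_integral g S" "is_integral h T" "bounded_borel g" "bounded_borel h"
    "\<And>t. \<bar>g t - h t\<bar> \<le> c"
  shows "norm (S - T) \<le> c"
proof (rule symmetric_op_norm_le)
  fix x
  have "inner ((S - T) x) x = (\<integral>t. g t - h t \<partial>\<mu> x)"
    using assms by (simp add: is_integral_def blinfun.diff_left inner_diff_left integrable_\<mu>)
  then show "\<bar>inner ((S - T) x) x\<bar> \<le> c * (norm x)\<^sup>2"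
    using integral_abs_le[OF bounded_borel_diff[OF assms(3,4)] assms(5)] by simp
qed (use assms in \<open>auto simp: is_integral_def intro: symmetric_op_diff order_trans[OF abs_ge_zero]\<close>)

lemma is_integral_simple:
  assumes s: "s \<in> borel_measurable borel" and fin: "finite (range s)"
  shows "is_integral s (\<Sum>v\<in>range s. v *\<^sub>R F (s -` {v}))"
  unfolding is_integral_def
proof (intro conjI allI)
  have sv: "s -` {v} \<in> sets borel" for v
    using measurable_sets[OF s, of "{v}"] by simp
  show "symmetric_op (\<Sum>v\<in>range s. v *\<^sub>R F (s -` {v}))"
    by (intro symmetric_op_sum symmetric_op_scaleR F_sym sv)
  fix x
  interpret finite_measure "\<mu> x" by (rule finite_\<mu>)
  have "s t = (\<Sum>v\<in>range s. v * indicator (s -` {v}) t)" for t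
    using finite_range_eq_sum[OF fin, of t 1] unfolding mult_1_right .
  then have "(\<integral>t. s t \<partial>\<mu> x) = (\<integral>t. (\<Sum>v\<in>range s. v * indicator (s -` {v}) t) \<partial>\<mu> x)"
    by (rule Bochner_Integration.integral_cong[OF refl])
  also have "\<dots> = (\<Sum>v\<in>range s. v * measure (\<mu> x) (s -` {v}))"
    using sv by (subst Bochner_Integration.integral_sum) (auto simp: emeasure_eq_measure)
  finally show "inner ((\<Sum>v\<in>range s. v *\<^sub>R F (s -` {v})) x) x = (\<integral>t. s t \<partial>\<mu> x)"
    by (simp add: blinfun.sum_left blinfun.scaleR_left inner_sum_left inner_F sv)
qed

definition discrete_integral :: "nat \<Rightarrow> (real \<Rightarrow> real) \<Rightarrow> 'h op" where
  "discrete_integral n g = (\<Sum>v\<in>range (discretization n g). v *\<^sub>R F (discretization n g -` {v}))"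

lemma is_integral_discrete:
  "bounded_borel g \<Longrightarrow> is_integral (discretization n g) (discrete_integral n g)"
  unfolding discrete_integral_def
  by (intro is_integral_simple discretization_measurable discretization_finite_range)

lemma bounded_borel_discretization: "bounded_borel g \<Longrightarrow> bounded_borel (discretization n g)"
  by (rule bounded_borel_finite_range[OF discretization_measurable discretization_finite_range])

text \<open>Uniform closeness of the discretizations makes their integrals Cauchy in operator norm.
  The limit is kept in the statement because commutation and multiplicativity are later transferred
  from simple functions.\<close>

lemma is_integral_exists:
  assumes g: "bounded_borel g"
  shows "\<exists>T. is_integral g T \<and> (\<lambda>n. discrete_integral n g) \<longlonglongrightarrow> T"
proof -
  let ?D = "\<lambda>n. discretization n g" and ?T = "\<lambda>n. discrete_integral n g"
  note bb = bounded_borel_discretization[OF g]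
  have "Cauchy ?T"
  proof (rule CauchyI')
    fix e :: real assume e: "0 < e"
    obtain K where K: "inverse (real (Suc K)) < e / 2"
      using reals_Archimedean[of "e / 2"] e by auto
    have "dist (?T m) (?T n) < e" if "m \<ge> K" "n > m" for m n
    proof -
      have "\<bar>?D m t - ?D n t\<bar> \<le> inverse (real (Suc m)) + inverse (real (Suc n))" for t
        using discretization_close[of g t m] discretization_close[of g t n] by linarith
      then have "norm (?T m - ?T n) \<le> inverse (real (Suc m)) + inverse (real (Suc n))"
        by (rule is_integral_diff_norm[OF is_integral_discrete[OF g] is_integral_discrete[OF g] bb bb])
      also have "\<dots> \<le> inverse (real (Suc K)) + inverse (real (Suc K))"
        using that by (intro add_mono le_imp_inverse_le) auto
      finally show ?thesis using K by (simp add: dist_norm)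
    qed
    then show "\<exists>M. \<forall>m\<ge>M. \<forall>n>m. dist (?T m) (?T n) < e" by blast
  qed
  then obtain T where T: "?T \<longlonglongrightarrow> T"
    using Cauchy_convergent convergent_def by blast
  have Tx: "(\<lambda>n. ?T n x) \<longlonglongrightarrow> T x" for x
    by (rule blinfun_limit_bound[OF T])
  have "symmetric_op T"
    by (rule symmetric_op_limit[of ?T]) (use is_integral_discrete[OF g] Tx in \<open>auto simp: is_integral_def\<close>)
  moreover have "inner (T x) x = (\<integral>t. g t \<partial>\<mu> x)" for x
  proof (rule LIMSEQ_unique)
    show "(\<lambda>n. inner (?T n x) x) \<longlonglongrightarrow> inner (T x) x"
      by (intro tendsto_intros T)
    have "(\<lambda>n. (\<integral>t. ?D n t \<partial>\<mu> x) - (\<integral>t. g t \<partial>\<mu> x)) \<longlonglongrightarrow> 0"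
    proof (rule Lim_null_comparison)
      have "norm ((\<integral>t. ?D n t \<partial>\<mu> x) - (\<integral>t. g t \<partial>\<mu> x)) \<le> inverse (real (Suc n)) * (norm x)\<^sup>2" for n
        using integral_abs_le[OF bounded_borel_diff[OF bb g], of n "inverse (real (Suc n))" x]
          discretization_close[of g _ n]
        by (simp add: integrable_\<mu> g bb abs_minus_commute)
      then show "\<forall>\<^sub>F n in sequentially. norm ((\<integral>t. ?D n t \<partial>\<mu> x) - (\<integral>t. g t \<partial>\<mu> x))
          \<le> inverse (real (Suc n)) * (norm x)\<^sup>2"
        by simp
      show "(\<lambda>n. inverse (real (Suc n)) * (norm x)\<^sup>2) \<longlonglongrightarrow> 0"
        by (intro tendsto_mult_left_zero LIMSEQ_inverse_real_of_nat)
    qed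
    then show "(\<lambda>n. inner (?T n x) x) \<longlonglongrightarrow> (\<integral>t. g t \<partial>\<mu> x)"
      using is_integral_discrete[OF g] by (simp add: is_integral_def LIM_zero_iff)
  qed
  ultimately show ?thesis using T by (auto simp: is_integral_def)
qed

lemma is_integral_op_integral: "bounded_borel g \<Longrightarrow> is_integral g (op_integral g)"
  using is_integral_exists op_integral_eqI by blast

lemma op_integral_discrete_limit:
  "bounded_borel g \<Longrightarrow> (\<lambda>n. discrete_integral n g) \<longlonglongrightarrow> op_integral g"
  using is_integral_exists op_integral_eqI by blast

lemma op_integral_sym: "bounded_borel g \<Longrightarrow> symmetric_op (op_integral g)"
  using is_integral_op_integral by (simp add: is_integral_def)

lemma inner_op_integral: "bounded_borel g \<Longrightarrow> inner (op_integral g x) x = (\<integral>t. g t \<partial>\<mu> x)"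
  using is_integral_op_integral by (simp add: is_integral_def)

section \<open>Algebra of the operator integral\<close>

lemma op_integral_add:
  "bounded_borel g \<Longrightarrow> bounded_borel h \<Longrightarrow> op_integral (\<lambda>t. g t + h t) = op_integral g + op_integral h"
  by (rule op_integral_eqI)
     (simp add: is_integral_def op_integral_sym symmetric_op_add blinfun.add_left inner_add_left
       inner_op_integral integrable_\<mu>)

lemma op_integral_diff:
  "bounded_borel g \<Longrightarrow> bounded_borel h \<Longrightarrow> op_integral (\<lambda>t. g t - h t) = op_integral g - op_integral h"
  by (rule op_integral_eqI)
     (simp add: is_integral_def op_integral_sym symmetric_op_diff blinfun.diff_left inner_diff_left
       inner_op_integral integrable_\<mu>)

lemma op_integral_cmult:
  "bounded_borel g \<Longrightarrow> op_integral (\<lambda>t. c * g t) = c *\<^sub>R op_integral g"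
  by (rule op_integral_eqI)
     (simp add: is_integral_def op_integral_sym symmetric_op_scaleR blinfun.scaleR_left inner_op_integral)

lemma op_integral_indicator:
  assumes "B \<in> sets borel" shows "op_integral (indicator B) = F B"
proof (rule op_integral_eqI)
  show "is_integral (indicator B) (F B)"
    using assms by (simp add: is_integral_def F_sym inner_F)
qed

lemma op_integral_const: "op_integral (\<lambda>t. c) = c *\<^sub>R id_blinfun"
  using op_integral_cmult[of "indicator UNIV" c] op_integral_indicator[of UNIV] by simp

text \<open>As \<open>F B\<close> fixes every vector, \<open>integral_\<mu>_F\<close> inserts the
  indicator of B into every diagonal integral at no cost.\<close>

lemma op_integral_cong_on:
  assumes B: "B \<in> sets borel" "F B = id_blinfun"
    and g: "g \<in> borel_measurable borel" and h: "h \<in> borel_measurable borel"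
    and eq: "\<And>t. t \<in> B \<Longrightarrow> g t = h t"
  shows "op_integral g = op_integral h"
proof -
  have "(\<integral>t. g t \<partial>\<mu> x) = (\<integral>t. h t \<partial>\<mu> x)" for x
  proof -
    have "(\<integral>t. indicator B t * g t \<partial>\<mu> x) = (\<integral>t. indicator B t * h t \<partial>\<mu> x)"
      by (rule Bochner_Integration.integral_cong) (auto simp: eq split: split_indicator)
    then show ?thesis
      using integral_\<mu>_F[OF B(1) g, of x] integral_\<mu>_F[OF B(1) h, of x] by (simp add: B(2))
  qed
  then show ?thesis
    by (simp add: op_integral_def is_integral_def)
qed

lemma op_integral_commute:
  assumes g: "bounded_borel g" and T: "\<And>B. B \<in> sets borel \<Longrightarrow> T o\<^sub>L F B = F B o\<^sub>L T"
  shows "T o\<^sub>L op_integral g = op_integral g o\<^sub>L T"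
proof (rule blinfun_eqI)
  fix x
  have "discretization n g -` {v} \<in> sets borel" for n v
    using measurable_sets[OF discretization_measurable[OF g], of "{v}"] by simp
  then have "T (discrete_integral n g x) = discrete_integral n g (T x)" for n
    by (simp add: discrete_integral_def blinfun.sum_left blinfun.sum_right blinfun.scaleR_left
        blinfun.scaleR_right commute_apply[OF T])
  moreover have "(\<lambda>n. T (discrete_integral n g x)) \<longlonglongrightarrow> T (op_integral g x)"
    "(\<lambda>n. discrete_integral n g (T x)) \<longlonglongrightarrow> op_integral g (T x)"
    by (intro tendsto_intros op_integral_discrete_limit g)+
  ultimately show "(T o\<^sub>L op_integral g) x = (op_integral g o\<^sub>L T) x"
    by (simp add: LIMSEQ_unique)
qed

text \<open>
  Only the quadratic form of an integral is known at first. Multiplicativity starts from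
  \<open>F B\<close>, which commutes with the integral of \<open>g\<close>.
\<close>

lemma op_integral_F:
  assumes g: "bounded_borel g" and B: "B \<in> sets borel"
  shows "F B (op_integral g x) = op_integral (\<lambda>t. indicator B t * g t) x"
proof -
  have gm: "g \<in> borel_measurable borel" using g by (simp add: bounded_borel_def)
  have comm: "F B (op_integral g y) = op_integral g (F B y)" for y
    by (rule commute_apply, rule op_integral_commute[OF g], rule blinfun_eqI) (simp add: F_commute B)
  have bb: "bounded_borel (\<lambda>t. indicator B t * g t)"
    using g B by (intro bounded_borel_intros)
  have "op_integral (\<lambda>t. indicator B t * g t) = F B o\<^sub>L op_integral g"
  proof (rule op_integral_eqI, unfold is_integral_def, intro conjI allI)
    show "symmetric_op (F B o\<^sub>L op_integral g)"
      unfolding symmetric_op_def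
      by (simp add: symmetric_opD[OF F_sym[OF B]] symmetric_opD[OF op_integral_sym[OF g]] comm)
    fix x
    have "inner (F B (op_integral g x)) x = inner (op_integral g (F B x)) (F B x)"
      using symmetric_opD[OF F_sym[OF B], of "op_integral g (F B x)" x]
      by (simp add: comm orth_proj_idem[OF proj[OF B]] flip: comm)
    then show "inner ((F B o\<^sub>L op_integral g) x) x = (\<integral>t. indicator B t * g t \<partial>\<mu> x)"
      using integral_\<mu>_F[OF B gm] by (simp add: inner_op_integral g)
  qed
  then show ?thesis by simp
qed

lemma op_integral_sum:
  assumes "finite I" "\<And>i. i \<in> I \<Longrightarrow> bounded_borel (g i)"
  shows "bounded_borel (\<lambda>t. \<Sum>i\<in>I. g i t) \<and> op_integral (\<lambda>t. \<Sum>i\<in>I. g i t) = (\<Sum>i\<in>I. op_integral (g i))"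
  using assms
  by (induction I rule: finite_induct) (auto simp: op_integral_const op_integral_add bounded_borel_add)

lemma op_integral_norm_le:
  assumes "bounded_borel g" "\<And>t. \<bar>g t\<bar> \<le> c"
  shows "norm (op_integral g) \<le> c"
  using is_integral_diff_norm[OF is_integral_op_integral[OF assms(1)]
      is_integral_op_integral[OF bounded_borel_const[of 0]], of c] assms
  by (simp add: op_integral_const)

text \<open>For a discretized g the product is a finite sum covered by \<open>op_integral_F\<close>.
  The same sequence of operators converges to both sides of the equation.\<close>

lemma op_integral_mult:
  assumes g: "bounded_borel g" and h: "bounded_borel h"
  shows "op_integral (\<lambda>t. g t * h t) = op_integral g o\<^sub>L op_integral h"
proof (rule LIMSEQ_unique)
  let ?D = "\<lambda>n. discretization n g"
  have gm: "?D n -` {v} \<in> sets borel" for n v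
    using measurable_sets[OF discretization_measurable[OF g], of "{v}"] by simp
  show "(\<lambda>n. discrete_integral n g o\<^sub>L op_integral h) \<longlonglongrightarrow> (op_integral g o\<^sub>L op_integral h)"
    by (intro bounded_bilinear.tendsto[OF bounded_bilinear_blinfun_compose] tendsto_const
        op_integral_discrete_limit g)
  have eq: "discrete_integral n g o\<^sub>L op_integral h = op_integral (\<lambda>t. ?D n t * h t)" for n
  proof (rule blinfun_eqI)
    fix x
    have bb: "bounded_borel (\<lambda>t. v * (indicator (?D n -` {v}) t * h t))" for v
      by (intro bounded_borel_intros h gm)
    have "?D n t * h t = (\<Sum>v\<in>range (?D n). v * (indicator (?D n -` {v}) t * h t))" for t
      by (rule finite_range_eq_sum[OF discretization_finite_range[OF g]])
    then have "op_integral (\<lambda>t. ?D n t * h t)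
        = op_integral (\<lambda>t. \<Sum>v\<in>range (?D n). v * (indicator (?D n -` {v}) t * h t))"
      by (intro arg_cong[where f = op_integral] ext)
    also have "\<dots> = (\<Sum>v\<in>range (?D n). op_integral (\<lambda>t. v * (indicator (?D n -` {v}) t * h t)))"
      using op_integral_sum[OF discretization_finite_range[OF g, of n] bb, of "\<lambda>v. v"] by blast
    also have "\<dots> = (\<Sum>v\<in>range (?D n). v *\<^sub>R op_integral (\<lambda>t. indicator (?D n -` {v}) t * h t))"
      by (intro sum.cong refl op_integral_cmult bounded_borel_intros h gm)
    finally show "(discrete_integral n g o\<^sub>L op_integral h) x = op_integral (\<lambda>t. ?D n t * h t) x"
      by (simp add: discrete_integral_def blinfun.sum_left blinfun.scaleR_left op_integral_F[OF h gm])
  qed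
  obtain C where C: "\<And>t. \<bar>h t\<bar> \<le> C" using h by (auto simp: bounded_borel_def)
  have "(\<lambda>n. op_integral (\<lambda>t. ?D n t * h t) - op_integral (\<lambda>t. g t * h t)) \<longlonglongrightarrow> 0"
  proof (rule Lim_null_comparison)
    have "norm (op_integral (\<lambda>t. ?D n t * h t) - op_integral (\<lambda>t. g t * h t)) \<le> inverse (real (Suc n)) * C" for n
    proof (rule is_integral_diff_norm[OF is_integral_op_integral is_integral_op_integral])
      show "\<bar>?D n t * h t - g t * h t\<bar> \<le> inverse (real (Suc n)) * C" for t
        unfolding left_diff_distrib[symmetric] abs_mult
        using discretization_close[of g t n] C[of t]
        by (intro mult_mono) (auto simp: abs_minus_commute)
    qed (intro bounded_borel_intros bounded_borel_discretization g h)+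
    then show "\<forall>\<^sub>F n in sequentially. norm (op_integral (\<lambda>t. ?D n t * h t) - op_integral (\<lambda>t. g t * h t))
        \<le> inverse (real (Suc n)) * C"
      by simp
    show "(\<lambda>n. inverse (real (Suc n)) * C) \<longlonglongrightarrow> 0"
      by (intro tendsto_mult_left_zero LIMSEQ_inverse_real_of_nat)
  qed
  then show "(\<lambda>n. discrete_integral n g o\<^sub>L op_integral h) \<longlonglongrightarrow> op_integral (\<lambda>t. g t * h t)"
    unfolding eq by (simp add: LIM_zero_iff)
qed

lemma norm_op_integral:
  assumes "bounded_borel g"
  shows "(norm (op_integral g x))\<^sup>2 = (\<integral>t. (g t)\<^sup>2 \<partial>\<mu> x)"
proof -
  have "(norm (op_integral g x))\<^sup>2 = inner (op_integral (\<lambda>t. g t * g t) x) x"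
    using assms by (simp add: op_integral_mult power2_norm_eq_inner symmetric_opD[OF op_integral_sym])
  then show ?thesis
    using assms by (simp add: inner_op_integral bounded_borel_mult power2_eq_square)
qed

end

section \<open>Null sets and sets of full measure\<close>

context projection_family
begin

lemma F_mono_0:
  assumes "A \<in> sets borel" "B \<in> sets borel" "A \<subseteq> B" "F B = 0" shows "F A = 0"
proof (rule blinfun_eqI)
  fix x
  have "A \<inter> B = A" using assms(3) by auto
  then show "F A x = blinfun_apply 0 x"
    using F_Int[OF assms(1,2), of x] assms(4) by simp
qed

lemma F_mono_id:
  assumes "A \<in> sets borel" "B \<in> sets borel" "A \<subseteq> B" "F A = id_blinfun" shows "F B = id_blinfun"
proof (rule blinfun_eqI)
  fix x
  have "B \<inter> A = A" using assms(3) by auto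
  then show "F B x = id_blinfun x"
    using F_Int[OF assms(2,1), of x] assms(4) by simp
qed

lemma F_Diff_id:
  assumes "A \<in> sets borel" "B \<in> sets borel" "F A = id_blinfun" "F B = 0"
  shows "F (A - B) = id_blinfun"
proof -
  have "F (A \<inter> B) = 0"
    using assms by (intro F_mono_0[of "A \<inter> B" B]) auto
  moreover have "F A = F (A \<inter> B) + F (A - B)"
    using F_Un[of "A \<inter> B" "A - B"] assms by (auto simp: Int_Diff_Un)
  ultimately show ?thesis using assms(3) by simp
qed

text \<open>Translating into null sets makes countable unions available; this is needed for the
  complement of the spectrum.\<close>

lemma F_eq_0_iff:
  assumes "A \<in> sets borel" shows "F A = 0 \<longleftrightarrow> (\<forall>x. A \<in> null_sets (\<mu> x))"
proof -
  have "A \<in> null_sets (\<mu> x) \<longleftrightarrow> F A x = 0" for x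
    using assms norm_F[OF assms, of x] by (auto simp: null_sets_def emeasure_\<mu>)
  then show ?thesis
    by (metis blinfun_eqI zero_blinfun.rep_eq)
qed

end

text \<open>
  The integral is only defined for bounded functions; on the support \<open>{-C..C}\<close> of the spectral
  measure this is the identity.
\<close>

definition truncated_id :: "real \<Rightarrow> real \<Rightarrow> real" where
  "truncated_id C t = indicator {-C..C} t * t"

lemma bounded_borel_truncated_id: "bounded_borel (truncated_id C)"
proof -
  have "\<bar>truncated_id C t\<bar> \<le> \<bar>C\<bar>" for t
    by (auto simp: truncated_id_def split: split_indicator)
  then show ?thesis
    unfolding bounded_borel_def truncated_id_def[abs_def] by auto
qed

lemma spectral_family_exists:
  fixes a :: "'h::complex_hilbert_space op"
  assumes a: "symmetric_op a"
  defines "C \<equiv> norm a + 1"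
  shows "\<exists>F \<mu>. projection_family F \<mu> \<and> F {-C..C} = id_blinfun \<and>
     projection_family.op_integral \<mu> (truncated_id C) = a \<and>
     (\<forall>T B. T o\<^sub>L a = a o\<^sub>L T \<longrightarrow> B \<in> sets borel \<longrightarrow> T o\<^sub>L F B = F B o\<^sub>L T)"
proof -
  obtain E where E: "\<And>t. orth_proj (E t)"
    and comm: "\<And>T t. T o\<^sub>L a = a o\<^sub>L T \<Longrightarrow> T o\<^sub>L E t = E t o\<^sub>L T"
    and EE: "\<And>s t. s \<le> t \<Longrightarrow> E t o\<^sub>L E s = E s"
    and rcont: "\<And>x t. continuous (at_right t) (\<lambda>t. inner (E t x) x)"
    and low: "\<And>t. t < - norm a \<Longrightarrow> E t = 0" and high: "\<And>t. t \<ge> norm a \<Longrightarrow> E t = id_blinfun"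
    and le: "\<And>x t. E t x = x \<Longrightarrow> inner (a x) x \<le> t * (norm x)\<^sup>2"
    and ge: "\<And>x t. E t x = 0 \<Longrightarrow> t * (norm x)\<^sup>2 \<le> inner (a x) x"
    by (rule spectral_resolution_exists[OF a]) (rule that)
  \<comment> \<open>The Lebesgue-Stieltjes measure of the distribution function of a at x. This is
    where right-continuity of the resolution is needed.\<close>
  define \<mu> where "\<mu> x = interval_measure (\<lambda>t. inner (E t x) x)" for x
  have mono: "inner (E s x) x \<le> inner (E t x) x" if "s \<le> t" for s t x
  proof -
    have "E s o\<^sub>L E t = E s"
      by (rule symmetric_op_comp_swap[OF _ _ _ EE[OF that]]) (simp_all add: E orth_proj_symmetric)
    then have "E s (E t x) = E s x"
      by (metis blinfun_apply_blinfun_compose)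
    then have "norm (E s x) \<le> norm (E t x)"
      using orth_proj_norm_le[OF E[of s], of "E t x"] by simp
    then show ?thesis by (simp add: orth_proj_inner E power_mono)
  qed
  have at_bot: "((\<lambda>t. inner (E t x) x) \<longlongrightarrow> 0) at_bot" for x
    by (rule tendsto_eventually)
       (auto simp: eventually_at_bot_dense low intro!: exI[of _ "- norm a"])
  have sets_\<mu>: "sets (\<mu> x) = sets borel" for x by (simp add: \<mu>_def)
  have Iic: "emeasure (\<mu> x) {..t} = ennreal (inner (E t x) x)" for x t
    unfolding \<mu>_def by (rule emeasure_interval_measure_Iic[OF mono rcont at_bot])
  have UNIV: "emeasure (\<mu> x) UNIV = ennreal ((norm x)\<^sup>2)" for x
  proof (rule LIMSEQ_unique)
    have "(\<lambda>n::nat. emeasure (\<mu> x) {..real n}) \<longlonglongrightarrow> emeasure (\<mu> x) (\<Union>n::nat. {..real n})"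
      by (intro Lim_emeasure_incseq) (auto simp: sets_\<mu> incseq_def)
    also have "(\<Union>n::nat. {..real n}) = UNIV"
      using real_arch_simple by auto
    finally show "(\<lambda>n::nat. emeasure (\<mu> x) {..real n}) \<longlonglongrightarrow> emeasure (\<mu> x) UNIV" .
    obtain N :: nat where N: "norm a \<le> real N" using real_arch_simple by blast
    show "(\<lambda>n::nat. emeasure (\<mu> x) {..real n}) \<longlonglongrightarrow> ennreal ((norm x)\<^sup>2)"
    proof (rule tendsto_eventually)
      have "emeasure (\<mu> x) {..real n} = ennreal ((norm x)\<^sup>2)" if "n \<ge> N" for n
        using that N by (simp add: Iic high power2_norm_eq_inner)
      then show "\<forall>\<^sub>F n in sequentially. emeasure (\<mu> x) {..real n} = ennreal ((norm x)\<^sup>2)"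
        unfolding eventually_sequentially by blast
    qed
  qed
  have inner_nn: "0 \<le> inner (E t x) x" for t x
    by (simp add: orth_proj_inner E)
  have fin: "finite_measure (\<mu> x)" for x
    by (rule finite_measureI) (simp add: UNIV sets_eq_imp_space_eq[OF sets_\<mu>])
  have "\<exists>P. orth_proj P \<and> (\<forall>x. inner (P x) x = measure (\<mu> x) B) \<and>
           (\<forall>T. (\<forall>t. T o\<^sub>L E t = E t o\<^sub>L T) \<longrightarrow> T o\<^sub>L P = P o\<^sub>L T)" if "B \<in> sets borel" for B
    by (rule projections_extend_to_borel[OF sets_\<mu> fin _ E _ that])
       (simp_all add: measure_def Iic UNIV inner_nn)
  then obtain F where F: "\<And>B. B \<in> sets borel \<Longrightarrow> orth_proj (F B)"
      "\<And>B x. B \<in> sets borel \<Longrightarrow> inner (F B x) x = measure (\<mu> x) B"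
    and F_comm: "\<And>B T. B \<in> sets borel \<Longrightarrow> (\<And>t. T o\<^sub>L E t = E t o\<^sub>L T) \<Longrightarrow> T o\<^sub>L F B = F B o\<^sub>L T"
    by metis
  interpret projection_family F \<mu>
  proof (rule projection_family.intro)
    show "measure (\<mu> x) UNIV = (norm x)\<^sup>2" for x
      by (simp add: measure_def UNIV)
  qed (fact sets_\<mu> fin F)+
  have F_Iic: "F {..t} = E t" for t
    by (rule F_eqI) (simp_all add: E orth_proj_symmetric measure_def Iic inner_nn)
  have commF: "T o\<^sub>L F B = F B o\<^sub>L T" if "T o\<^sub>L a = a o\<^sub>L T" "B \<in> sets borel" for T B
    by (rule F_comm[OF that(2) comm[OF that(1)]])
  \<comment> \<open>\<open>E\<close> is known to vanish only strictly below - norm a, so C has to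
    exceed the norm for \<open>E (- C)\<close> to be 0.\<close>
  have C: "norm a < C" "0 < C" by (auto simp: C_def add_nonneg_pos)
  have EC: "E C = id_blinfun" "E (- C) = 0"
    using C by (auto simp: high low)
  have "F {..<-C} = 0"
    by (rule F_mono_0[of _ "{..-C}"]) (auto simp: F_Iic EC)
  then have "F ({..C} - {..<-C}) = id_blinfun"
    by (intro F_Diff_id) (auto simp: F_Iic EC)
  moreover have "{..C} - {..<-C} = {-C..C}" by auto
  ultimately have supp: "F {-C..C} = id_blinfun" by simp

  \<comment> \<open>
    The increments of \<open>t \<mapsto> \<langle>(a - T) (E t x), x\<rangle>\<close> over an interval are bounded by its length times
    the increment of \<open>t \<mapsto> \<langle>E t x, x\<rangle>\<close>, so telescoping over ever finer partitions gives \<open>0\<close>.\<close>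
  define T where "T = op_integral (truncated_id C)"
  have T_sym: "symmetric_op T"
    unfolding T_def by (rule op_integral_sym[OF bounded_borel_truncated_id])
  have local: "\<bar>inner ((a - T) (E t x - E s x)) x\<bar> \<le> (t - s) * (inner (E t x) x - inner (E s x) x)"
    if st: "s \<le> t" "- C \<le> s" "t \<le> C" for s t x
  proof -
    define y where "y = F {s<..t} x"
    have "F {..t} = F {..s} + F {s<..t}"
      using F_Un[of "{..s}" "{s<..t}"] st by (simp add: ivl_disj_un ivl_disj_int)
    then have y: "y = E t x - E s x"
      by (simp add: F_Iic y_def blinfun.add_left)
    have ny: "(norm y)\<^sup>2 = inner (E t x) x - inner (E s x) x"
    proof -
      have "(norm y)\<^sup>2 = inner (F {s<..t} x) x"
        by (simp add: y_def orth_proj_inner F)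
      then show ?thesis by (simp add: y[unfolded y_def] inner_diff_left)
    qed
    have "{..t} \<inter> {s<..t} = {s<..t}" "{..s} \<inter> {s<..t} = {}" by auto
    then have "E t y = y" "E s y = 0"
      by (simp_all add: y_def F_Int flip: F_Iic)
    then have 1: "s * (norm y)\<^sup>2 \<le> inner (a y) y" "inner (a y) y \<le> t * (norm y)\<^sup>2"
      by (auto intro: le ge)
    have bb: "bounded_borel (\<lambda>r. indicator {s<..t} r * truncated_id C r)"
      by (intro bounded_borel_intros bounded_borel_truncated_id) auto
    have "inner (T y) y = (\<integral>r. indicator {s<..t} r * truncated_id C r \<partial>\<mu> x)"
      using bounded_borel_truncated_id[of C]
      unfolding T_def inner_op_integral[OF bounded_borel_truncated_id] y_def
      by (intro integral_\<mu>_F) (auto simp: bounded_borel_def)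
    moreover have "(\<integral>r. s * indicator {s<..t} r \<partial>\<mu> x) \<le> (\<integral>r. indicator {s<..t} r * truncated_id C r \<partial>\<mu> x)"
      using st by (intro integral_mono integrable_\<mu> bb bounded_borel_intros)
        (auto simp: truncated_id_def split: split_indicator)
    moreover have "(\<integral>r. indicator {s<..t} r * truncated_id C r \<partial>\<mu> x) \<le> (\<integral>r. t * indicator {s<..t} r \<partial>\<mu> x)"
      using st by (intro integral_mono integrable_\<mu> bb bounded_borel_intros)
        (auto simp: truncated_id_def split: split_indicator)
    moreover have "(norm y)\<^sup>2 = measure (\<mu> x) {s<..t}"
      by (simp add: y_def norm_F)
    ultimately have 2: "s * (norm y)\<^sup>2 \<le> inner (T y) y" "inner (T y) y \<le> t * (norm y)\<^sup>2"
      by simp_all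
    have Fy: "F {s<..t} y = y" by (simp add: y_def orth_proj_idem F)
    \<comment> \<open>Both a and T commute with \<open>F {s<..t}\<close>, so (a - T) y stays in its
      range, and x may be replaced by its projection y in the second argument.\<close>
    have "F {s<..t} ((a - T) y) = (a - T) y"
    proof -
      have "a (F {s<..t} y) = F {s<..t} (a y)"
        by (rule commute_apply[OF commF]) auto
      moreover have "T (F {s<..t} y) = F {s<..t} (T y)"
        unfolding T_def
        by (rule commute_apply[OF op_integral_commute[symmetric]])
           (auto intro!: blinfun_eqI bounded_borel_truncated_id simp: F_commute)
      ultimately show ?thesis by (simp add: blinfun.bilinear_simps Fy)
    qed
    then have "inner ((a - T) y) x = inner ((a - T) y) y"
      using symmetric_opD[OF F_sym[of "{s<..t}"], of "(a - T) y" x] by (simp add: y_def)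
    also have "\<bar>\<dots>\<bar> \<le> (t - s) * (norm y)\<^sup>2"
      using 1 2 by (simp add: blinfun.diff_left inner_diff_left left_diff_distrib abs_le_iff)
    finally show ?thesis by (simp add: ny y[symmetric])
  qed
  have "inner ((a - T) x) x = 0" for x
  proof -
    have bound: "\<bar>inner ((a - T) x) x\<bar> \<le> 2 * C / real N * (norm x)\<^sup>2" if N: "0 < N" for N :: nat
    proof -
      define d where "d = 2 * C / real N"
      define p where "p i = - C + real i * d" for i :: nat
      have d: "0 \<le> d" using C by (simp add: d_def)
      have pN: "p N = C" using N by (simp add: p_def d_def)
      have p0: "p 0 = - C" by (simp add: p_def)
      have pS: "p (Suc i) = p i + d" for i by (simp add: p_def algebra_simps)
      have "\<bar>inner ((a - T) (E (p i) x)) x\<bar> \<le> d * inner (E (p i) x) x" if "i \<le> N" for i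
        using that
      proof (induction i)
        case 0
        then show ?case by (simp add: p0 EC)
      next
        case (Suc i)
        have "real (Suc i) * d \<le> real N * d"
          using Suc.prems d by (intro mult_right_mono) auto
        then have "p (Suc i) \<le> C" using pN by (simp only: p_def)
        moreover have "- C \<le> p i" using d by (simp add: p_def)
        ultimately have "\<bar>inner ((a - T) (E (p (Suc i)) x - E (p i) x)) x\<bar>
            \<le> d * (inner (E (p (Suc i)) x) x - inner (E (p i) x) x)"
          using local[of "p i" "p (Suc i)" x] d by (simp add: pS)
        then show ?case
          using Suc by (simp add: blinfun.diff_right inner_diff_left right_diff_distrib)
      qed
      from this[of N] show ?thesis
        by (simp add: pN EC d_def power2_norm_eq_inner)
    qed
    have "(\<lambda>n. 2 * C * (norm x)\<^sup>2 * inverse (real (Suc n))) \<longlonglongrightarrow> 0"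
      by (intro tendsto_mult_right_zero LIMSEQ_inverse_real_of_nat)
    then have "\<bar>inner ((a - T) x) x\<bar> \<le> 0"
      by (rule LIMSEQ_le_const)
         (use bound[of "Suc _"] in \<open>auto simp: field_simps simp del: of_nat_Suc\<close>)
    then show ?thesis by simp
  qed
  then have "T = a"
    by (intro symmetric_op_eqI[OF T_sym a]) (simp add: blinfun.diff_left inner_diff_left)
  then show ?thesis
    using projection_family_axioms supp commF unfolding T_def by blast
qed

section \<open>The spectral measure and the spectrum\<close>

lemma inner_scaleC_left: "inner (c *\<^sub>C x) y = inner x (cnj c *\<^sub>C (y :: 'h::complex_hilbert_space))"
proof -
  have "cinner (c *\<^sub>C x) y = cinner x (cnj c *\<^sub>C y)"
    by (metis cinner_commute cinner_scaleC_left complex_cnj_cnj complex_cnj_mult)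
  then show ?thesis by (simp flip: Re_cinner)
qed

text \<open>Multiplying by -i turns an imaginary part into a real part; thus the real inner product
  determines the complex one.\<close>

lemma Im_cinner: "Im (cinner x y) = inner ((- \<i>) *\<^sub>C x) (y :: 'h::complex_hilbert_space)"
  by (simp add: cinner_scaleC_left flip: Re_cinner)

lemma scaleC_diff_right: "c *\<^sub>C (x - y) = c *\<^sub>C x - c *\<^sub>C (y :: 'h::complex_hilbert_space)"
  using scaleC_add_right[of c "x - y" y] by (simp add: algebra_simps)

lemma scaleC_zero_right: "c *\<^sub>C 0 = (0 :: 'h::complex_hilbert_space)"
  using scaleC_add_right[of c 0 0] by simp

lemma scaleC_scaleR_commute: "c *\<^sub>C (r *\<^sub>R x) = r *\<^sub>R (c *\<^sub>C (x :: 'h::complex_hilbert_space))"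
  by (metis scaleC_of_real scaleC_scaleC mult.commute)

lemma scaleC_decompose: "c *\<^sub>C x = Re c *\<^sub>R x + Im c *\<^sub>R (\<i> *\<^sub>C (x :: 'h::complex_hilbert_space))"
proof -
  have "c *\<^sub>C x = (complex_of_real (Re c) + complex_of_real (Im c) * \<i>) *\<^sub>C x"
    by (metis complex_eq mult.commute)
  then show ?thesis
    by (simp only: scaleC_add_left scaleC_of_real flip: scaleC_scaleC)
qed

lemma scaleC_minus_1: "(- 1) *\<^sub>C x = - (x :: 'h::complex_hilbert_space)"
  using scaleC_of_real[of "- 1" x] by simp

lemma scaleC_i_i: "\<i> *\<^sub>C (\<i> *\<^sub>C x) = - (x :: 'h::complex_hilbert_space)"
  by (simp add: scaleC_scaleC scaleC_minus_1)

lemma bounded_opsD: "T \<in> bounded_ops \<Longrightarrow> T (c *\<^sub>C x) = c *\<^sub>C T x"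
  by (simp add: bounded_ops_def)

text \<open>This is how complex linearity is inherited: the scalar multiplications are among the
  real-linear maps that commute with a, hence they commute with its spectral projections and
  integrals.\<close>

lemma bounded_ops_iff_commute:
  "T \<in> bounded_ops \<longleftrightarrow> (\<forall>c. T o\<^sub>L cscale c id_blinfun = cscale c id_blinfun o\<^sub>L T)"
proof
  assume "\<forall>c. T o\<^sub>L cscale c id_blinfun = cscale c id_blinfun o\<^sub>L T"
  then have "T (cscale c id_blinfun x) = cscale c id_blinfun (T x)" for c x
    by (simp add: commute_apply)
  then show "T \<in> bounded_ops"
    by (simp add: bounded_ops_def cscale_apply)
qed (auto intro!: blinfun_eqI simp: cscale_apply bounded_opsD)

lemma bounded_ops_add: "S \<in> bounded_ops \<Longrightarrow> T \<in> bounded_ops \<Longrightarrow> S + T \<in> bounded_ops"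
  and bounded_ops_diff: "S \<in> bounded_ops \<Longrightarrow> T \<in> bounded_ops \<Longrightarrow> S - T \<in> bounded_ops"
  and bounded_ops_cscale: "S \<in> bounded_ops \<Longrightarrow> cscale c S \<in> bounded_ops"
  by (auto simp: bounded_ops_def blinfun.bilinear_simps scaleC_add_right scaleC_diff_right
      scaleC_scaleR_commute cscale_apply scaleC_scaleC mult.commute)

lemma cinner_eq_of_inner_eq:
  assumes "T \<in> bounded_ops" "\<And>x y. inner (T x) y = inner x (S y)"
  shows "cinner (T x) y = cinner x (S y)"
proof (rule complex_eqI)
  show "Re (cinner (T x) y) = Re (cinner x (S y))"
    by (simp add: Re_cinner assms(2))
  show "Im (cinner (T x) y) = Im (cinner x (S y))"
    unfolding Im_cinner bounded_opsD[OF assms(1), symmetric] by (rule assms(2))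
qed

lemma adj_eqI:
  assumes T: "T \<in> bounded_ops" and S: "S \<in> bounded_ops" and eq: "\<And>x y. inner (T x) y = inner x (S y)"
  shows "adj T = S"
  unfolding adj_def
proof (rule the_equality)
  show "S \<in> bounded_ops \<and> (\<forall>x y. cinner (T x) y = cinner x (S y))"
    using S cinner_eq_of_inner_eq[OF T eq] by blast
  fix R assume R: "R \<in> bounded_ops \<and> (\<forall>x y. cinner (T x) y = cinner x (R y))"
  then have "inner x (R y) = inner x (S y)" for x y
    by (metis Re_cinner eq)
  then show "R = S"
    by (rule blinfun_eqI[OF inner_eq_imp_eq])
qed

text \<open>From \<open>adj a = a\<close> nothing follows until an adjoint is known to exist. The
  real adjoint from Riesz representation inherits complex linearity from a, and so it is the
  operator described by \<open>adj\<close>.\<close>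

lemma selfadjoint_iff: "selfadjoint a \<longleftrightarrow> a \<in> bounded_ops \<and> symmetric_op a"
proof
  assume "a \<in> bounded_ops \<and> symmetric_op a"
  then show "selfadjoint a"
    by (simp add: selfadjoint_def adj_eqI symmetric_op_def)
next
  assume "selfadjoint a"
  then have a: "a \<in> bounded_ops" "adj a = a" by (auto simp: selfadjoint_def)
  obtain S :: "'a op" where S: "\<And>x y. inner (a x) y = inner x (S y)"
    using real_adjoint_exists[of a] by blast
  have "S (c *\<^sub>C y) = c *\<^sub>C S y" for c y
  proof (rule inner_eq_imp_eq)
    fix z
    have "inner z (S (c *\<^sub>C y)) = inner (a (cnj c *\<^sub>C z)) y"
      by (simp add: inner_scaleC_left bounded_opsD[OF a(1)] flip: S)
    also have "\<dots> = inner z (c *\<^sub>C S y)"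
      by (simp add: S inner_scaleC_left)
    finally show "inner z (S (c *\<^sub>C y)) = inner z (c *\<^sub>C S y)" .
  qed
  then have "S \<in> bounded_ops" by (simp add: bounded_ops_def)
  then have "S = a" using adj_eqI[OF a(1) _ S] a(2) by simp
  then show "a \<in> bounded_ops \<and> symmetric_op a" using a S by (simp add: symmetric_op_def)
qed

section \<open>Projection-valued measures as projection families\<close>

lemma projection_iff: "projection p \<longleftrightarrow> p \<in> bounded_ops \<and> orth_proj p"
  by (auto simp: projection_def selfadjoint_iff orth_proj_def)

text \<open>\<open>measure_of\<close> takes the prescribed values only if they are countably
  additive; here that comes from strong additivity of E, tested against x.\<close>

lemma emeasure_vector_measure:
  assumes E: "projection_valued_measure E" and B: "B \<in> sets borel"
  shows "emeasure (vector_measure E x) B = ennreal (inner (E B x) x)"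
proof -
  have proj: "orth_proj (E A)" if "A \<in> sets borel" for A
    using E that by (simp add: projection_valued_measure_def projection_iff)
  have nn: "0 \<le> inner (E A x) x" if "A \<in> sets borel" for A
    by (simp add: orth_proj_inner proj that)
  have "emeasure (vector_measure E x) B = ennreal (Re (cinner (E B x) x))"
  proof (rule emeasure_measure_of[OF vector_measure_def])
    show "countably_additive (sets (vector_measure E x)) (\<lambda>B. ennreal (Re (cinner (E B x) x)))"
    proof (rule countably_additiveI)
      fix A :: "nat \<Rightarrow> real set"
      assume A: "range A \<subseteq> sets (vector_measure E x)" "disjoint_family A"
      then have A': "range A \<subseteq> sets borel" by (simp add: vector_measure_def sigma_algebra.sigma_sets_eq[OF sets.sigma_algebra_axioms, of borel, simplified])
      have "(\<lambda>n. E (A n) x) sums E (\<Union>n. A n) x"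
        using E A' A(2) by (simp add: projection_valued_measure_def)
      then have "(\<lambda>n. inner (E (A n) x) x) sums inner (E (\<Union>n. A n) x) x"
        by (rule bounded_linear.sums[OF bounded_linear_inner_left])
      then show "(\<Sum>i. ennreal (Re (cinner (E (A i) x) x))) = ennreal (Re (cinner (E (\<Union>n. A n) x) x))"
        unfolding Re_cinner using A' nn by (intro suminf_ennreal_eq) auto
    qed
    show "positive (sets (vector_measure E x)) (\<lambda>B. ennreal (Re (cinner (E B x) x)))"
      using E by (simp add: positive_def projection_valued_measure_def Re_cinner)
    show "B \<in> sets (vector_measure E x)"
      using B by (simp add: vector_measure_def sigma_algebra.sigma_sets_eq[OF sets.sigma_algebra_axioms, of borel, simplified])
  qed simp
  then show ?thesis by (simp add: Re_cinner)
qed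

lemma sets_vector_measure: "sets (vector_measure E x) = sets borel"
  by (simp add: vector_measure_def sigma_algebra.sigma_sets_eq[OF sets.sigma_algebra_axioms, of borel, simplified])

lemma projection_family_vector_measure:
  assumes E: "projection_valued_measure E"
  shows "projection_family E (vector_measure E)"
proof (rule projection_family.intro)
  have proj: "orth_proj (E A)" if "A \<in> sets borel" for A
    using E that by (simp add: projection_valued_measure_def projection_iff)
  show "orth_proj (E B)" if "B \<in> sets borel" for B by (rule proj[OF that])
  show sets: "sets (vector_measure E x) = sets borel" for x
    by (rule sets_vector_measure)
  show "finite_measure (vector_measure E x)" for x
    by (rule finite_measureI) (simp add: sets_eq_imp_space_eq[OF sets] emeasure_vector_measure[OF E])
  show *: "inner (E B x) x = measure (vector_measure E x) B" if "B \<in> sets borel" for B x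
    using that by (simp add: measure_def emeasure_vector_measure[OF E] orth_proj_inner proj)
  show "measure (vector_measure E x) UNIV = (norm x)\<^sup>2" for x
    using *[of UNIV x] E by (simp add: projection_valued_measure_def power2_norm_eq_inner)
qed

text \<open>C is a parameter, not fixed as norm a + 1, since push-forwards and arbitrary spectral
  measures come with bounds of their own.\<close>

locale spectral_family = projection_family F \<mu>
  for F :: "real set \<Rightarrow> 'h::complex_hilbert_space op" and \<mu> +
  fixes a :: "'h op" and C :: real
  assumes complex_linear: "\<And>B. B \<in> sets borel \<Longrightarrow> F B \<in> bounded_ops"
    and supp: "F {-C..C} = id_blinfun"
    and a_eq: "op_integral (truncated_id C) = a"
begin

lemma projection_valued_measure_F: "projection_valued_measure F"
  unfolding projection_valued_measure_def projection_iff
proof (intro conjI ballI allI impI)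
  show "F (A \<inter> B) = F A o\<^sub>L F B" if "A \<in> sets borel" "B \<in> sets borel" for A B
    by (rule blinfun_eqI) (simp add: F_Int that)
qed (simp_all add: complex_linear proj F_sums)

lemma vector_measure_eq: "vector_measure F x = \<mu> x"
  by (rule measure_eqI)
     (auto simp: sets_vector_measure emeasure_vector_measure projection_valued_measure_F inner_F emeasure_\<mu>)

lemma op_integral_bounded_ops: "bounded_borel g \<Longrightarrow> op_integral g \<in> bounded_ops"
  unfolding bounded_ops_iff_commute
  using complex_linear[unfolded bounded_ops_iff_commute] op_integral_commute by metis

lemma a_sym: "symmetric_op a" and a_bounded: "a \<in> bounded_ops"
  using op_integral_sym op_integral_bounded_ops bounded_borel_truncated_id a_eq by auto

lemma shift_eq:
  "(a - cscale (complex_of_real t) id_blinfun) = op_integral (\<lambda>s. truncated_id C s - t)"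
  by (rule blinfun_eqI)
     (simp add: op_integral_diff bounded_borel_truncated_id a_eq op_integral_const blinfun.bilinear_simps
       cscale_apply scaleC_of_real)

text \<open>The function 1 / (s - t), set to 0 near t, is bounded, and its integral inverts a - t
  because \<open>F\<close> ignores the neighbourhood of t.\<close>

lemma not_in_real_spectrumI:
  assumes c: "0 < c" and 0: "F {t - c<..<t + c} = 0"
  shows "t \<notin> real_spectrum a"
proof -
  let ?U = "{t - c<..<t + c}"
  define h where "h s = (if s \<in> ?U then 0 else 1 / (s - t))" for s
  have "\<bar>h s\<bar> \<le> 1 / c" for s
    using c by (auto simp: h_def abs_if field_simps)
  moreover have "h \<in> borel_measurable borel"
    unfolding h_def[abs_def] by measurable
  ultimately have h: "bounded_borel h" by (auto simp: bounded_borel_def)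
  have g: "bounded_borel (\<lambda>s. truncated_id C s - t)"
    by (intro bounded_borel_intros bounded_borel_truncated_id)
  have B: "F ({-C..C} - ?U) = id_blinfun"
    by (intro F_Diff_id supp 0) auto
  have 1: "op_integral (\<lambda>s. (truncated_id C s - t) * h s) = id_blinfun"
  proof -
    have "op_integral (\<lambda>s. (truncated_id C s - t) * h s) = op_integral (\<lambda>s. 1)"
    proof (rule op_integral_cong_on[OF _ B])
      show "(truncated_id C s - t) * h s = 1" if "s \<in> {-C..C} - ?U" for s
        using that c by (auto simp: h_def truncated_id_def)
    qed (use bounded_borel_mult[OF g h] in \<open>auto simp: bounded_borel_def\<close>)
    then show ?thesis by (simp add: op_integral_const)
  qed
  have "op_integral h \<in> bounded_ops" by (rule op_integral_bounded_ops[OF h])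
  moreover have "op_integral h o\<^sub>L (a - cscale (complex_of_real t) id_blinfun) = id_blinfun"
    unfolding shift_eq using 1 by (simp add: mult.commute flip: op_integral_mult[OF h g])
  moreover have "(a - cscale (complex_of_real t) id_blinfun) o\<^sub>L op_integral h = id_blinfun"
    unfolding shift_eq using 1 by (simp flip: op_integral_mult[OF g h])
  ultimately show ?thesis
    unfolding real_spectrum_def spectrum_def by blast
qed

text \<open>On the range of \<open>F\<close> for the interval of radius c around t, the operator a -
  t has norm at most c. This contradicts a left inverse S with norm S * c < 1 unless that range is
  zero.\<close>

lemma not_in_real_spectrumD:
  assumes "t \<notin> real_spectrum a"
  shows "\<exists>c>0. F {t - c<..<t + c} = 0"
proof -
  obtain S where S: "S o\<^sub>L (a - cscale (complex_of_real t) id_blinfun) = id_blinfun"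
    using assms by (auto simp: real_spectrum_def spectrum_def)
  define c where "c = 1 / (2 * (norm S + 1))"
  have c: "0 < c" by (simp add: c_def add_nonneg_pos)
  have Sc: "norm S * c < 1"
    by (simp add: c_def divide_less_eq add_nonneg_pos)
  let ?U = "{t - c<..<t + c}"
  let ?g = "\<lambda>s. truncated_id C s - t" and ?k = "\<lambda>s. indicator ({-C..C} \<inter> ?U) s * (s - t)"
  have g: "bounded_borel ?g"
    by (intro bounded_borel_intros bounded_borel_truncated_id)
  have k_le: "\<bar>?k s\<bar> \<le> c" for s
    using c by (auto split: split_indicator)
  then have k: "bounded_borel ?k"
    by (auto simp: bounded_borel_def)
  have "op_integral (\<lambda>s. indicator ?U s * ?g s) = op_integral ?k"
  proof (rule op_integral_cong_on[OF _ supp])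
    show "(\<lambda>s. indicator ?U s * ?g s) \<in> borel_measurable borel"
      using bounded_borel_mult[OF bounded_borel_indicator g, of ?U] by (simp add: bounded_borel_def)
    show "?k \<in> borel_measurable borel" using k by (simp add: bounded_borel_def)
  qed (auto simp: truncated_id_def split: split_indicator)
  then have small: "norm (op_integral (\<lambda>s. indicator ?U s * ?g s)) \<le> c"
    using op_integral_norm_le[OF k k_le] by simp
  have "F ?U x = 0" for x
  proof (rule ccontr)
    assume ne: "F ?U x \<noteq> 0"
    define y where "y = F ?U x"
    have "op_integral ?g y = op_integral (\<lambda>s. indicator ?U s * ?g s) y"
    proof -
      have "op_integral ?g (F ?U y) = F ?U (op_integral ?g y)"
        by (rule commute_apply[OF op_integral_commute[symmetric]])
           (auto intro!: blinfun_eqI g simp: F_commute)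
      then show ?thesis
        using op_integral_F[OF g, of ?U y] by (simp add: y_def orth_proj_idem proj)
    qed
    then have "norm (op_integral ?g y) \<le> c * norm y"
      using norm_blinfun[of "op_integral (\<lambda>s. indicator ?U s * ?g s)" y]
        mult_right_mono[OF small, of "norm y"] by simp
    moreover have "y = S (op_integral ?g y)"
      using S unfolding shift_eq by (metis blinfun_apply_blinfun_compose id_blinfun.rep_eq id_apply)
    then have "norm y \<le> norm S * norm (op_integral ?g y)"
      by (metis norm_blinfun)
    ultimately have "norm y \<le> norm S * (c * norm y)"
      by (meson mult_left_mono norm_ge_zero order_trans)
    then have "(1 - norm S * c) * norm y \<le> 0"
      by (simp add: algebra_simps)
    then show False using Sc ne by (simp add: mult_le_0_iff y_def)
  qed
  then have "F ?U = 0" by (intro blinfun_eqI) simp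
  with c show ?thesis by blast
qed

lemma real_spectrum_subset: "real_spectrum a \<subseteq> {-C..C}"
proof
  fix t assume t: "t \<in> real_spectrum a"
  show "t \<in> {-C..C}"
  proof (rule ccontr)
    assume "t \<notin> {-C..C}"
    then have c: "0 < \<bar>t\<bar> - C" by auto
    let ?U = "{t - (\<bar>t\<bar> - C)<..<t + (\<bar>t\<bar> - C)}"
    have "?U \<inter> {-C..C} = {}" by (auto simp: abs_if split: if_splits)
    then have "F ?U x = 0" for x
      using F_disjoint[of ?U "{-C..C}" x] by (simp add: supp)
    then have "F ?U = 0" by (intro blinfun_eqI) simp
    then show False using not_in_real_spectrumI[OF c] t by blast
  qed
qed

lemma closed_real_spectrum: "closed (real_spectrum a)"
  unfolding closed_def open_dist
proof (intro ballI)
  fix t assume "t \<in> - real_spectrum a"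
  then obtain c where c: "0 < c" "F {t - c<..<t + c} = 0"
    using not_in_real_spectrumD by auto
  have "s \<in> - real_spectrum a" if "dist s t < c" for s
  proof -
    have "F {s - (c - dist s t)<..<s + (c - dist s t)} = 0"
      by (rule F_mono_0[OF _ _ _ c(2)]) (auto simp: dist_real_def abs_if split: if_splits)
    then show ?thesis using not_in_real_spectrumI[of "c - dist s t" s] that by auto
  qed
  then show "\<exists>e>0. \<forall>y. dist y t < e \<longrightarrow> y \<in> - real_spectrum a"
    using c(1) by blast
qed

lemma compact_real_spectrum: "compact (real_spectrum a)"
  using closed_real_spectrum real_spectrum_subset
  by (meson bounded_closed_interval bounded_subset compact_eq_bounded_closed)

lemma real_spectrum_borel: "real_spectrum a \<in> sets borel"
  using closed_real_spectrum by (rule borel_closed)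

text \<open>Every point outside the spectrum has a neighbourhood of \<open>F\<close>-measure zero;
  by the Lindelof property countably many of them cover the complement.\<close>

lemma F_real_spectrum: "F (real_spectrum a) = id_blinfun"
proof -
  let ?O = "- real_spectrum a"
  obtain c where c: "\<And>t. t \<in> ?O \<Longrightarrow> 0 < c t" "\<And>t. t \<in> ?O \<Longrightarrow> F {t - c t<..<t + c t} = 0"
    using not_in_real_spectrumD by (metis ComplD)
  let ?\<U> = "(\<lambda>t. {t - c t<..<t + c t}) ` ?O"
  obtain \<V> where V: "\<V> \<subseteq> ?\<U>" "countable \<V>" "\<Union>\<V> = \<Union>?\<U>"
  proof (rule Lindelof)
    show "open S" if "S \<in> ?\<U>" for S
      using that by (elim imageE) simp
  qed
  have "?O \<subseteq> \<Union>?\<U>"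
  proof
    fix t assume t: "t \<in> ?O"
    then have "t \<in> {t - c t<..<t + c t}" using c(1) by simp
    with t show "t \<in> \<Union>?\<U>" by blast
  qed
  have "\<Union>\<V> \<in> null_sets (\<mu> x)" for x
  proof (rule null_sets_UN'[where N = "\<lambda>V. V" and I = \<V>, simplified, OF V(2)])
    fix V assume "V \<in> \<V>"
    then obtain t where t: "t \<in> ?O" "V = {t - c t<..<t + c t}" using V(1) by blast
    then show "V \<in> null_sets (\<mu> x)" using F_eq_0_iff[of V] c(2)[OF t(1)] by simp
  qed
  moreover have Vb: "\<Union>\<V> \<in> sets borel"
    using V(1) by (intro borel_open open_Union) auto
  ultimately have "F (\<Union>\<V>) = 0" by (simp add: F_eq_0_iff)
  then have "F ?O = 0"
    by (rule F_mono_0[rotated 3]) (use Vb \<open>?O \<subseteq> \<Union>?\<U>\<close> V(3) real_spectrum_borel in auto)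
  then have "F (UNIV - ?O) = id_blinfun"
    using real_spectrum_borel by (intro F_Diff_id) auto
  then show ?thesis by (simp add: Compl_eq_Diff_UNIV[symmetric])
qed

lemma form_eq_integral: "inner (a x) x = (\<integral>t. t \<partial>\<mu> x)"
proof -
  have "inner (a x) x = (\<integral>t. truncated_id C t \<partial>\<mu> x)"
    using inner_op_integral[OF bounded_borel_truncated_id[of C]] by (simp add: a_eq)
  also have "\<dots> = (\<integral>t. t \<partial>\<mu> x)"
    using integral_\<mu>_F[of "{-C..C}" "\<lambda>t. t" x] by (simp add: supp truncated_id_def)
  finally show ?thesis .
qed

lemma spectral_measure_of_F: "spectral_measure_of a F"
  unfolding spectral_measure_of_def vector_measure_eq
proof (intro conjI allI)
  fix x
  have "cinner (a x) x = cinner x (a x)"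
    by (rule cinner_eq_of_inner_eq[OF a_bounded symmetric_opD[OF a_sym]])
  then have "cnj (cinner (a x) x) = cinner (a x) x"
    by (metis cinner_commute)
  then have "cinner (a x) x \<in> \<real>"
    by (simp add: Reals_cnj_iff)
  then have "cinner (a x) x = complex_of_real (Re (cinner (a x) x))"
    by simp
  then show "cinner (a x) x = complex_of_real (\<integral>t. t \<partial>\<mu> x)"
    by (simp add: Re_cinner form_eq_integral)
qed (fact projection_valued_measure_F F_real_spectrum)+

end

section \<open>The continuous functional calculus\<close>

text \<open>
  The part of a functional calculus that Stone-Weierstrass needs; it is shared by the calculus of
  \<open>functional_calculus\<close> and by integration against any spectral measure of \<open>a\<close>, so that
  both uniqueness statements follow from one lemma.
\<close>

definition real_calculus ::
    "real set \<Rightarrow> 'h::complex_hilbert_space op \<Rightarrow> ((real \<Rightarrow> real) \<Rightarrow> 'h op) \<Rightarrow> bool" where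
  "real_calculus S a \<Psi> \<longleftrightarrow>
     (\<forall>c. \<Psi> (\<lambda>t. c) = c *\<^sub>R id_blinfun) \<and> \<Psi> (\<lambda>t. t) = a \<and>
     (\<forall>f g. continuous_on S f \<longrightarrow> continuous_on S g \<longrightarrow>
        \<Psi> (\<lambda>t. f t + g t) = \<Psi> f + \<Psi> g \<and> \<Psi> (\<lambda>t. f t * g t) = \<Psi> f o\<^sub>L \<Psi> g \<and>
        (\<forall>c\<ge>0. (\<forall>t\<in>S. \<bar>f t - g t\<bar> \<le> c) \<longrightarrow> norm (\<Psi> f - \<Psi> g) \<le> c))"

text \<open>The algebraic clauses fix the values at polynomials, and the sup-norm bound carries the
  agreement to their uniform limits.\<close>

lemma real_calculus_unique:
  assumes S: "compact S" and \<Psi>: "real_calculus S a \<Psi>" and \<Psi>': "real_calculus S a \<Psi>'"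
    and f: "continuous_on S f"
  shows "\<Psi> f = \<Psi>' f"
proof -
  have cont: "continuous_on S p" if "real_polynomial_function p" for p :: "real \<Rightarrow> real"
    using that by (simp add: continuous_at_imp_continuous_on continuous_real_polymonial_function)
  have poly: "\<Psi> p = \<Psi>' p" if "real_polynomial_function p" for p
    using that
  proof induction
    case (linear h)
    then have h: "h = (\<lambda>t. t * h 1)"
      by (metis (no_types) bounded_linear.linear linear_scale mult.right_neutral real_scaleR_def)
    have c: "continuous_on S (\<lambda>t::real. t)" "continuous_on S (\<lambda>t::real. h 1)"
      by (intro continuous_intros)+
    show ?case
      using \<Psi> \<Psi>' c by (subst (1 2) h) (simp add: real_calculus_def)
  next
    case (const c)
    show ?case using \<Psi> \<Psi>' by (simp add: real_calculus_def)
  next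
    case (add p q)
    then show ?case using \<Psi> \<Psi>' cont by (simp add: real_calculus_def)
  next
    case (mult p q)
    then show ?case using \<Psi> \<Psi>' cont by (simp add: real_calculus_def)
  qed
  have "norm (\<Psi> f - \<Psi>' f) \<le> 0 + e" if e: "0 < e" for e
  proof -
    obtain p where p: "real_polynomial_function p" "\<And>t. t \<in> S \<Longrightarrow> \<bar>f t - p t\<bar> < e / 2"
      using Stone_Weierstrass_real_polynomial_function[OF S f, of "e / 2"] e by auto
    have "norm (\<Psi> f - \<Psi> p) \<le> e / 2" "norm (\<Psi>' f - \<Psi>' p) \<le> e / 2"
      using \<Psi> \<Psi>' f cont[OF p(1)] p(2) e unfolding real_calculus_def by (meson less_imp_le half_gt_zero)+
    then show ?thesis
      using norm_triangle_ineq4[of "\<Psi> f - \<Psi> p" "\<Psi>' f - \<Psi>' p"] by (simp add: poly[OF p(1)])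
  qed
  then have "norm (\<Psi> f - \<Psi>' f) \<le> 0" by (rule field_le_epsilon)
  then show ?thesis by simp
qed

text \<open>The norm bound is obtained from the isometry clause; over an empty spectrum its supremum
  would be an unspecified number.\<close>

lemma real_calculus_functional_calculus:
  assumes \<Phi>: "functional_calculus a \<Phi>" and ne: "real_spectrum a \<noteq> {}"
  shows "real_calculus (real_spectrum a) a (\<lambda>f. \<Phi> (\<lambda>t. complex_of_real (f t)))"
  unfolding real_calculus_def
proof (intro conjI allI impI)
  let ?S = "real_spectrum a"
  have c: "continuous_on ?S (\<lambda>t. complex_of_real (f t))" if "continuous_on ?S f" for f
    using that by (intro continuous_intros)
  have mult: "\<Phi> (\<lambda>t. u * h t) = cscale u (\<Phi> h)" if "continuous_on ?S h" for u h
    using \<Phi> that by (simp add: functional_calculus_def)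
  have add: "\<Phi> (\<lambda>t. g t + h t) = \<Phi> g + \<Phi> h" if "continuous_on ?S g" "continuous_on ?S h" for g h
    using \<Phi> that by (simp add: functional_calculus_def)
  have norm: "norm (\<Phi> h) = (SUP t\<in>?S. norm (h t))" if "continuous_on ?S h" for h
    using \<Phi> that by (simp add: functional_calculus_def)
  show "\<Phi> (\<lambda>t. complex_of_real r) = r *\<^sub>R id_blinfun" for r
    using mult[of "\<lambda>t. 1" "complex_of_real r"] \<Phi>
    by (auto simp: functional_calculus_def cscale_apply scaleC_of_real blinfun.scaleR_left intro!: blinfun_eqI)
  show "\<Phi> complex_of_real = a" using \<Phi> by (simp add: functional_calculus_def)
  fix f g :: "real \<Rightarrow> real" assume fg: "continuous_on ?S f" "continuous_on ?S g"
  show "\<Phi> (\<lambda>t. complex_of_real (f t + g t)) = \<Phi> (\<lambda>t. complex_of_real (f t)) + \<Phi> (\<lambda>t. complex_of_real (g t))"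
    using add[OF c[OF fg(1)] c[OF fg(2)]] by simp
  show "\<Phi> (\<lambda>t. complex_of_real (f t * g t)) = \<Phi> (\<lambda>t. complex_of_real (f t)) o\<^sub>L \<Phi> (\<lambda>t. complex_of_real (g t))"
    using \<Phi> c[OF fg(1)] c[OF fg(2)] by (simp add: functional_calculus_def)
  fix r :: real assume r: "\<forall>t\<in>?S. \<bar>f t - g t\<bar> \<le> r"
  \<comment> \<open>\<open>functional_calculus\<close> has no clause for differences, so f - g is
    assembled from a sum and a multiple by -1.\<close>
  have cg: "continuous_on ?S (\<lambda>t. - 1 * complex_of_real (g t))"
    by (intro continuous_intros c fg)
  have "\<Phi> (\<lambda>t. complex_of_real (f t) + - 1 * complex_of_real (g t))
      = \<Phi> (\<lambda>t. complex_of_real (f t)) + cscale (- 1) (\<Phi> (\<lambda>t. complex_of_real (g t)))"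
    by (simp only: add[OF c[OF fg(1)] cg] mult[OF c[OF fg(2)]])
  also have "\<dots> = \<Phi> (\<lambda>t. complex_of_real (f t)) - \<Phi> (\<lambda>t. complex_of_real (g t))"
    by (rule blinfun_eqI) (simp add: blinfun.bilinear_simps cscale_apply scaleC_minus_1)
  finally have "norm (\<Phi> (\<lambda>t. complex_of_real (f t)) - \<Phi> (\<lambda>t. complex_of_real (g t)))
      = (SUP t\<in>?S. norm (complex_of_real (f t) + - 1 * complex_of_real (g t)))"
    using norm[OF continuous_on_add[OF c[OF fg(1)] cg]] by simp
  also have "\<dots> \<le> r"
  proof (rule cSUP_least[OF ne])
    fix t assume "t \<in> ?S"
    then show "norm (complex_of_real (f t) + - 1 * complex_of_real (g t)) \<le> r"
      using r by (simp flip: of_real_diff)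
  qed
  finally show "norm (\<Phi> (\<lambda>t. complex_of_real (f t)) - \<Phi> (\<lambda>t. complex_of_real (g t))) \<le> r" .
qed

context spectral_family
begin

abbreviation "S \<equiv> real_spectrum a"

text \<open>Functions of the calculus are controlled only on the spectrum. Cutting them off outside
  makes them bounded and Borel, and \<open>F\<close> does not see the change.\<close>

definition restricted_integral :: "(real \<Rightarrow> real) \<Rightarrow> 'h op" where
  "restricted_integral f = op_integral (\<lambda>t. indicator S t * f t)"

lemma bounded_borel_restrict:
  assumes "continuous_on S f" shows "bounded_borel (\<lambda>t. indicator S t * f t)"
proof -
  have "bounded (f ` S)"
    using compact_continuous_image[OF assms compact_real_spectrum] by (rule compact_imp_bounded)
  then obtain D where D: "\<And>t. t \<in> S \<Longrightarrow> \<bar>f t\<bar> \<le> D"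
    by (auto simp: bounded_iff)
  have "\<bar>indicator S t * f t\<bar> \<le> \<bar>D\<bar>" for t
    using D[of t] by (auto split: split_indicator)
  moreover have "(\<lambda>t. indicator S t *\<^sub>R f t) \<in> borel_measurable borel"
    by (rule borel_measurable_continuous_on_indicator[OF real_spectrum_borel assms])
  ultimately show ?thesis by (auto simp: bounded_borel_def)
qed

lemma restricted_integral_add:
  assumes "continuous_on S f" "continuous_on S g"
  shows "restricted_integral (\<lambda>t. f t + g t) = restricted_integral f + restricted_integral g"
  unfolding restricted_integral_def
  using op_integral_add[OF assms[THEN bounded_borel_restrict]] by (simp add: distrib_left)

lemma restricted_integral_diff:
  assumes "continuous_on S f" "continuous_on S g"
  shows "restricted_integral (\<lambda>t. f t - g t) = restricted_integral f - restricted_integral g"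
  unfolding restricted_integral_def
  using op_integral_diff[OF assms[THEN bounded_borel_restrict]] by (simp add: right_diff_distrib)

lemma restricted_integral_cmult:
  assumes "continuous_on S f"
  shows "restricted_integral (\<lambda>t. c * f t) = c *\<^sub>R restricted_integral f"
  unfolding restricted_integral_def
  using op_integral_cmult[OF bounded_borel_restrict[OF assms], of c] by (simp add: mult.left_commute)

lemma restricted_integral_mult:
  assumes "continuous_on S f" "continuous_on S g"
  shows "restricted_integral (\<lambda>t. f t * g t) = restricted_integral f o\<^sub>L restricted_integral g"
proof -
  have "(\<lambda>t. indicator S t * (f t * g t)) = (\<lambda>t. (indicator S t * f t) * (indicator S t * g t))"
    by (auto split: split_indicator)
  then show ?thesis
    unfolding restricted_integral_def
    using op_integral_mult[OF assms[THEN bounded_borel_restrict]] by simp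
qed

lemma restricted_integral_eq:
  assumes "bounded_borel g" shows "restricted_integral g = op_integral g"
  unfolding restricted_integral_def
proof (rule op_integral_cong_on[OF real_spectrum_borel F_real_spectrum])
  show "g \<in> borel_measurable borel" "(\<lambda>t. indicator S t * g t) \<in> borel_measurable borel"
    using assms bounded_borel_mult[OF bounded_borel_indicator[OF real_spectrum_borel] assms]
    by (auto simp: bounded_borel_def)
qed simp

lemma restricted_integral_id: "restricted_integral (\<lambda>t. t) = a"
proof -
  have "(\<lambda>t. indicator S t * t) = (\<lambda>t. indicator S t * truncated_id C t)"
    using real_spectrum_subset by (intro ext) (auto simp: truncated_id_def split: split_indicator)
  then show ?thesis
    using restricted_integral_eq[OF bounded_borel_truncated_id[of C]] a_eq
    by (simp add: restricted_integral_def)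
qed

lemma restricted_integral_sym: "continuous_on S f \<Longrightarrow> symmetric_op (restricted_integral f)"
  and restricted_integral_bounded_ops: "continuous_on S f \<Longrightarrow> restricted_integral f \<in> bounded_ops"
  by (simp_all add: restricted_integral_def op_integral_sym op_integral_bounded_ops bounded_borel_restrict)

lemma real_calculus_restricted_integral: "real_calculus S a restricted_integral"
  unfolding real_calculus_def
proof (intro conjI allI impI)
  show "restricted_integral (\<lambda>t. c) = c *\<^sub>R id_blinfun" for c
    by (simp add: restricted_integral_eq op_integral_const)
  show "restricted_integral (\<lambda>t. t) = a" by (rule restricted_integral_id)
  fix f g :: "real \<Rightarrow> real" assume fg: "continuous_on S f" "continuous_on S g"
  show "restricted_integral (\<lambda>t. f t + g t) = restricted_integral f + restricted_integral g"
    by (rule restricted_integral_add[OF fg])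
  show "restricted_integral (\<lambda>t. f t * g t) = restricted_integral f o\<^sub>L restricted_integral g"
    by (rule restricted_integral_mult[OF fg])
  fix c :: real assume c: "0 \<le> c" "\<forall>t\<in>S. \<bar>f t - g t\<bar> \<le> c"
  have "\<bar>indicator S t * (f t - g t)\<bar> \<le> c" for t
    using c by (auto split: split_indicator)
  then have "norm (restricted_integral (\<lambda>t. f t - g t)) \<le> c"
    unfolding restricted_integral_def
    by (intro op_integral_norm_le bounded_borel_restrict continuous_intros fg)
  then show "norm (restricted_integral f - restricted_integral g) \<le> c"
    by (simp add: restricted_integral_diff fg)
qed

definition complex_integral :: "(real \<Rightarrow> complex) \<Rightarrow> 'h op" where
  "complex_integral f =
     restricted_integral (\<lambda>t. Re (f t)) + cscale \<i> (restricted_integral (\<lambda>t. Im (f t)))"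

text \<open>The Pythagorean identity for a normal operator A + i B with commuting symmetric A and
  B.\<close>

lemma norm_complex_integral:
  assumes f: "continuous_on S f"
  shows "(norm (complex_integral f x))\<^sup>2 = (\<integral>t. indicator S t * (cmod (f t))\<^sup>2 \<partial>\<mu> x)"
proof -
  let ?R = "\<lambda>t. Re (f t)" and ?I = "\<lambda>t. Im (f t)"
  have cRI: "continuous_on S ?R" "continuous_on S ?I"
    by (intro continuous_intros f)+
  note bb = cRI[THEN bounded_borel_restrict]
  define A where "A = restricted_integral ?R"
  define B where "B = restricted_integral ?I"
  have AB: "symmetric_op A" "symmetric_op B" "B \<in> bounded_ops" "A \<in> bounded_ops"
    using cRI by (simp_all add: A_def B_def restricted_integral_sym restricted_integral_bounded_ops)
  have comm: "A (B y) = B (A y)" for y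
    unfolding A_def B_def
    by (rule commute_apply) (simp add: mult.commute cRI flip: restricted_integral_mult)
  \<comment> \<open>The mixed term equals its own negative: multiplication by i is skew for the real
    inner product, while A and B are symmetric and commute.\<close>
  have "inner (A x) (\<i> *\<^sub>C B x) = inner (B (A x)) (\<i> *\<^sub>C x)"
    by (simp add: symmetric_opD[OF AB(2)] bounded_opsD[OF AB(3)])
  also have "\<dots> = inner x (\<i> *\<^sub>C A (B x))"
    by (simp add: symmetric_opD[OF AB(2)] symmetric_opD[OF AB(1)] bounded_opsD[OF AB(3)] bounded_opsD[OF AB(4)])
  also have "\<dots> = - inner (A x) (\<i> *\<^sub>C B x)"
  proof -
    have "inner x (\<i> *\<^sub>C A (B x)) = inner ((- \<i>) *\<^sub>C x) (A (B x))"
      by (simp add: inner_scaleC_left)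
    also have "\<dots> = inner (- (\<i> *\<^sub>C B x)) (A x)"
      using scaleC_scaleC[of "- 1" \<i> x] 
      by (simp add: comm scaleC_minus_1 flip: symmetric_opD[OF AB(2)] bounded_opsD[OF AB(3)])
         (metis blinfun.minus_right bounded_opsD[OF AB(3)] inner_minus_left symmetric_opD[OF AB(2)])
    finally show ?thesis by (simp add: inner_commute)
  qed
  finally have orth: "inner (A x) (\<i> *\<^sub>C B x) = 0" by simp
  have "(norm (complex_integral f x))\<^sup>2 = (norm (A x + \<i> *\<^sub>C B x))\<^sup>2"
    by (simp add: complex_integral_def A_def B_def blinfun.add_left cscale_apply)
  also have "\<dots> = (norm (A x))\<^sup>2 + (norm (B x))\<^sup>2"
  proof -
    have "(norm (A x + \<i> *\<^sub>C B x))\<^sup>2 = (norm (A x))\<^sup>2 + (norm (\<i> *\<^sub>C B x))\<^sup>2 + 2 * inner (A x) (\<i> *\<^sub>C B x)"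
      by (simp add: power2_norm_eq_inner inner_add_left inner_add_right inner_commute)
    then show ?thesis by (simp add: orth norm_scaleC)
  qed
  also have "\<dots> = (\<integral>t. (indicator S t * ?R t)\<^sup>2 + (indicator S t * ?I t)\<^sup>2 \<partial>\<mu> x)"
    using bb by (simp add: A_def B_def restricted_integral_def norm_op_integral integrable_\<mu> bounded_borel_power)
  also have "\<dots> = (\<integral>t. indicator S t * (cmod (f t))\<^sup>2 \<partial>\<mu> x)"
    by (rule Bochner_Integration.integral_cong) (auto simp: cmod_power2 split: split_indicator)
  finally show ?thesis .
qed

text \<open>For the lower bound, \<open>F\<close> is nonzero on every neighbourhood of a spectral
  point t. Vectors in its range there are stretched by at least the modulus of f t up to e, by
  continuity of f.\<close>

lemma norm_complex_integral_eq_SUP: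
  assumes f: "continuous_on S f" and ne: "S \<noteq> {}"
  shows "norm (complex_integral f) = (SUP t\<in>S. norm (f t))"
proof (rule antisym)
  let ?M = "SUP t\<in>S. norm (f t)"
  have bdd: "bdd_above ((\<lambda>t. norm (f t)) ` S)"
    by (intro bounded_imp_bdd_above compact_imp_bounded compact_continuous_image compact_real_spectrum
        continuous_intros f)
  have le_M: "norm (f t) \<le> ?M" if "t \<in> S" for t
    by (rule cSUP_upper[OF that bdd])
  have M0: "0 \<le> ?M"
    using ne le_M norm_ge_zero order_trans by blast
  have c2: "continuous_on S (\<lambda>t. (norm (f t))\<^sup>2)"
    by (intro continuous_intros f)
  note bb = bounded_borel_restrict[OF c2]
  show "norm (complex_integral f) \<le> ?M"
  proof (rule norm_blinfun_bound[OF M0])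
    fix x
    have "(norm (complex_integral f x))\<^sup>2 \<le> \<bar>\<integral>t. indicator S t * (norm (f t))\<^sup>2 \<partial>\<mu> x\<bar>"
      by (simp add: norm_complex_integral f)
    also have "\<dots> \<le> ?M\<^sup>2 * (norm x)\<^sup>2"
    proof (rule integral_abs_le[OF bb])
      show "\<bar>indicator S t * (norm (f t))\<^sup>2\<bar> \<le> ?M\<^sup>2" for t
        using le_M[of t] by (auto intro!: power_mono split: split_indicator)
    qed
    finally have "(norm (complex_integral f x))\<^sup>2 \<le> (?M * norm x)\<^sup>2"
      by (simp add: power_mult_distrib)
    then show "norm (complex_integral f x) \<le> ?M * norm x"
      by (rule power2_le_imp_le) (simp add: M0)
  qed
  show "?M \<le> norm (complex_integral f)"
  proof (rule cSUP_least[OF ne], rule field_le_epsilon)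
    fix t and e :: real assume t: "t \<in> S" and e: "0 < e"
    show "norm (f t) \<le> norm (complex_integral f) + e"
    proof (cases "norm (f t) \<le> e")
      case False
      define r where "r = norm (f t) - e"
      have r: "0 < r" using False by (simp add: r_def)
      obtain d where d: "0 < d" "\<And>s. s \<in> S \<Longrightarrow> dist s t < d \<Longrightarrow> dist (f s) (f t) < e"
        using f t e unfolding continuous_on_iff by blast
      define V where "V = {t - d<..<t + d} \<inter> S"
      have V: "V \<in> sets borel" using real_spectrum_borel by (simp add: V_def)
      have "F V \<noteq> 0"
      proof
        assume "F V = 0"
        then have "F {t - d<..<t + d} x = 0" for x
          using F_Int[of "{t - d<..<t + d}" S x] real_spectrum_borel by (simp add: V_def F_real_spectrum)
        then have "F {t - d<..<t + d} = 0" by (intro blinfun_eqI) simp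
        then show False using not_in_real_spectrumI[OF d(1)] t by blast
      qed
      then obtain x where x: "F V x \<noteq> 0"
        by (metis blinfun_eqI zero_blinfun.rep_eq)
      have "r\<^sup>2 * (norm (F V x))\<^sup>2 = (\<integral>s. r\<^sup>2 * indicator V s \<partial>\<mu> x)"
        by (simp add: norm_F V)
      also have "\<dots> \<le> (\<integral>s. indicator V s * (indicator S s * (norm (f s))\<^sup>2) \<partial>\<mu> x)"
      proof (rule integral_mono)
        show "integrable (\<mu> x) (\<lambda>s. r\<^sup>2 * indicator V s)"
          "integrable (\<mu> x) (\<lambda>s. indicator V s * (indicator S s * (norm (f s))\<^sup>2))"
          using V bb by (auto intro!: integrable_\<mu> bounded_borel_mult[OF bounded_borel_const]
              bounded_borel_mult[OF bounded_borel_indicator])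
        fix s
        show "r\<^sup>2 * indicator V s \<le> indicator V s * (indicator S s * (norm (f s))\<^sup>2)"
        proof (cases "s \<in> V")
          case True
          then have s: "s \<in> S" "dist s t < d" by (auto simp: V_def dist_real_def)
          have "norm (f t) \<le> norm (f s) + dist (f s) (f t)"
            using norm_triangle_ineq[of "f s" "f t - f s"] by (simp add: dist_norm norm_minus_commute)
          then have "r \<le> norm (f s)" using d(2)[OF s] by (simp add: r_def)
          then show ?thesis using True s r by (simp add: power_mono)
        qed simp
      qed
      also have "\<dots> = (norm (complex_integral f (F V x)))\<^sup>2"
        using bb by (subst norm_complex_integral[OF f], subst integral_\<mu>_F[OF V])
          (auto simp: bounded_borel_def)
      finally have "(r * norm (F V x))\<^sup>2 \<le> (norm (complex_integral f (F V x)))\<^sup>2"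
        by (simp add: power_mult_distrib)
      then have "r * norm (F V x) \<le> norm (complex_integral f (F V x))"
        by (rule power2_le_imp_le) simp
      also have "\<dots> \<le> norm (complex_integral f) * norm (F V x)"
        by (rule norm_blinfun)
      finally have "r \<le> norm (complex_integral f)"
        using x by simp
      then show ?thesis by (simp add: r_def)
    qed (use norm_ge_zero[of "complex_integral f"] in linarith)
  qed
qed

lemma functional_calculus_complex_integral:
  assumes ne: "S \<noteq> {}"
  shows "functional_calculus a complex_integral"
  unfolding functional_calculus_def
proof (intro conjI allI impI)
  show "complex_integral (\<lambda>t. 1) = id_blinfun"
    by (rule blinfun_eqI)
       (simp add: complex_integral_def restricted_integral_eq op_integral_const blinfun.bilinear_simps
         cscale_apply scaleC_zero_right)
  show "complex_integral complex_of_real = a"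
    by (rule blinfun_eqI)
       (simp add: complex_integral_def restricted_integral_id restricted_integral_eq[of "\<lambda>t. 0"] 
         op_integral_const blinfun.bilinear_simps cscale_apply scaleC_zero_right)
  fix f :: "real \<Rightarrow> complex" assume f: "continuous_on S f"
  have cf: "continuous_on S (\<lambda>t. Re (f t))" "continuous_on S (\<lambda>t. Im (f t))"
    by (intro continuous_intros f)+
  note Rf = restricted_integral_bounded_ops[OF cf(1)] restricted_integral_bounded_ops[OF cf(2)]
  show bf: "complex_integral f \<in> bounded_ops"
    unfolding complex_integral_def by (intro bounded_ops_add bounded_ops_cscale Rf)
  show "complex_integral (\<lambda>t. c * f t) = cscale c (complex_integral f)" for c
  proof (rule blinfun_eqI)
    fix x
    have c: "continuous_on S (\<lambda>t. u * Re (f t))" "continuous_on S (\<lambda>t. u * Im (f t))" for u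
      by (intro continuous_intros f)+
    have re: "restricted_integral (\<lambda>t. Re (c * f t)) =
        Re c *\<^sub>R restricted_integral (\<lambda>t. Re (f t)) - Im c *\<^sub>R restricted_integral (\<lambda>t. Im (f t))"
      by (simp add: restricted_integral_diff c restricted_integral_cmult cf)
    have im: "restricted_integral (\<lambda>t. Im (c * f t)) =
        Re c *\<^sub>R restricted_integral (\<lambda>t. Im (f t)) + Im c *\<^sub>R restricted_integral (\<lambda>t. Re (f t))"
      by (simp add: restricted_integral_add c restricted_integral_cmult cf)
    show "complex_integral (\<lambda>t. c * f t) x = cscale c (complex_integral f) x"
      unfolding complex_integral_def re im
      by (simp add: blinfun.bilinear_simps cscale_apply scaleC_decompose[of c] scaleC_add_right
          scaleC_diff_right scaleC_scaleR_commute scaleC_i_i scaleR_add_right algebra_simps)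
  qed
  show "complex_integral (\<lambda>t. cnj (f t)) = adj (complex_integral f)"
  proof (rule adj_eqI[symmetric, OF bf])
    have cnj: "complex_integral (\<lambda>t. cnj (f t))
        = restricted_integral (\<lambda>t. Re (f t)) - cscale \<i> (restricted_integral (\<lambda>t. Im (f t)))"
      using restricted_integral_cmult[OF cf(2), of "- 1"]
      by (intro blinfun_eqI) (simp add: complex_integral_def blinfun.bilinear_simps cscale_apply
          scaleC_scaleR_commute[of \<i> "- 1", simplified])
    show "complex_integral (\<lambda>t. cnj (f t)) \<in> bounded_ops"
      unfolding cnj by (intro bounded_ops_diff bounded_ops_cscale Rf)
    fix x y
    have "inner (\<i> *\<^sub>C restricted_integral (\<lambda>t. Im (f t)) x) y
        = - inner x (\<i> *\<^sub>C restricted_integral (\<lambda>t. Im (f t)) y)"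
    proof -
      have "inner (\<i> *\<^sub>C restricted_integral (\<lambda>t. Im (f t)) x) y
          = inner x (restricted_integral (\<lambda>t. Im (f t)) ((- \<i>) *\<^sub>C y))"
        by (simp add: inner_scaleC_left symmetric_opD[OF restricted_integral_sym[OF cf(2)]])
      also have "\<dots> = inner x ((- 1) *\<^sub>C (\<i> *\<^sub>C restricted_integral (\<lambda>t. Im (f t)) y))"
        by (simp add: bounded_opsD[OF Rf(2)] scaleC_scaleC)
      finally show ?thesis by (simp add: scaleC_minus_1)
    qed
    then show "inner (complex_integral f x) y = inner x (complex_integral (\<lambda>t. cnj (f t)) y)"
      unfolding cnj complex_integral_def
      by (simp add: blinfun.bilinear_simps cscale_apply inner_add_left inner_diff_right
          symmetric_opD[OF restricted_integral_sym[OF cf(1)]])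
  qed
  show "norm (complex_integral f) = (SUP t\<in>S. norm (f t))"
    by (rule norm_complex_integral_eq_SUP[OF f ne])
  fix g :: "real \<Rightarrow> complex" assume g: "continuous_on S g"
  have cg: "continuous_on S (\<lambda>t. Re (g t))" "continuous_on S (\<lambda>t. Im (g t))"
    by (intro continuous_intros g)+
  show "complex_integral (\<lambda>t. f t + g t) = complex_integral f + complex_integral g"
    by (rule blinfun_eqI)
       (simp add: complex_integral_def restricted_integral_add cf cg blinfun.bilinear_simps cscale_apply
         scaleC_add_right)
  show "complex_integral (\<lambda>t. f t * g t) = complex_integral f o\<^sub>L complex_integral g"
  proof (rule blinfun_eqI)
    fix x
    have c: "continuous_on S (\<lambda>t. Re (f t) * Re (g t))" "continuous_on S (\<lambda>t. Im (f t) * Im (g t))"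
      "continuous_on S (\<lambda>t. Re (f t) * Im (g t))" "continuous_on S (\<lambda>t. Im (f t) * Re (g t))"
      by (intro continuous_intros f g)+
    show "complex_integral (\<lambda>t. f t * g t) x = (complex_integral f o\<^sub>L complex_integral g) x"
      by (simp add: complex_integral_def restricted_integral_add restricted_integral_diff
          restricted_integral_mult c cf cg blinfun.bilinear_simps cscale_apply scaleC_add_right
          scaleC_i_i bounded_opsD[OF Rf(1)] bounded_opsD[OF Rf(2)])
  qed
qed

text \<open>\<open>complex_integral\<close> witnesses existence. Any other calculus agrees with it
  on real functions by \<open>real_calculus_unique\<close>, which is all that the description in
  \<open>cfc\<close> asks for.\<close>

lemma cfc_eq:
  assumes f: "continuous_on S f" and ne: "S \<noteq> {}"
  shows "cfc f a = restricted_integral f"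
  unfolding cfc_def
proof (rule the_equality)
  have "complex_integral (\<lambda>t. complex_of_real (f t)) = restricted_integral f"
    by (rule blinfun_eqI)
       (simp add: complex_integral_def restricted_integral_eq[of "\<lambda>t. 0"] 
         op_integral_const blinfun.bilinear_simps cscale_apply scaleC_zero_right)
  then show "\<exists>\<Phi>. functional_calculus a \<Phi> \<and> restricted_integral f = \<Phi> (\<lambda>t. complex_of_real (f t))"
    using functional_calculus_complex_integral[OF ne] by metis
  fix b assume "\<exists>\<Phi>. functional_calculus a \<Phi> \<and> b = \<Phi> (\<lambda>t. complex_of_real (f t))"
  then obtain \<Phi> where \<Phi>: "functional_calculus a \<Phi>" "b = \<Phi> (\<lambda>t. complex_of_real (f t))"
    by blast
  then show "b = restricted_integral f"
    using real_calculus_unique[OF compact_real_spectrum real_calculus_functional_calculus[OF \<Phi>(1) ne]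
        real_calculus_restricted_integral f] by simp
qed

end

section \<open>Spectral projections of functions of an operator\<close>

context spectral_family
begin

text \<open>Change of variables: the push-forward of \<open>F\<close> along g resolves the integral
  of g. A bound D of g bounds its support.\<close>

lemma op_integral_spectral_family:
  assumes g: "bounded_borel g"
  shows "\<exists>D. spectral_family (\<lambda>B. F (g -` B)) (\<lambda>x. distr (\<mu> x) borel g) (op_integral g) D"
proof -
  obtain D where D: "\<And>t. \<bar>g t\<bar> \<le> D" using g by (auto simp: bounded_borel_def)
  have gm [measurable]: "g \<in> borel_measurable borel" using g by (simp add: bounded_borel_def)
  have gm' [measurable]: "g \<in> measurable (\<mu> x) borel" for x by simp
  have vimage: "g -` B \<in> sets borel" if "B \<in> sets borel" for B
    using measurable_sets[OF gm that] by simp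
  have meas: "measure (distr (\<mu> x) borel g) B = measure (\<mu> x) (g -` B)" if "B \<in> sets borel" for x B
    using that by (simp add: measure_distr)
  interpret P: projection_family "\<lambda>B. F (g -` B)" "\<lambda>x. distr (\<mu> x) borel g"
  proof (rule projection_family.intro)
    show "finite_measure (distr (\<mu> x) borel g)" for x
      by (rule finite_measure.finite_measure_distr[OF finite_\<mu> gm'])
    show "measure (distr (\<mu> x) borel g) UNIV = (norm x)\<^sup>2" for x
      by (simp add: meas total)
  qed (simp_all add: proj vimage inner_F meas)
  have vD: "g -` {-D..D} = UNIV"
    using D by (auto simp: abs_le_iff) (metis minus_le_iff)
  have trunc: "truncated_id D (g t) = g t" for t
    using D[of t] by (auto simp: truncated_id_def abs_le_iff)
  have "spectral_family (\<lambda>B. F (g -` B)) (\<lambda>x. distr (\<mu> x) borel g) (op_integral g) D"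
  proof (rule spectral_family.intro[OF P.projection_family_axioms], rule spectral_family_axioms.intro)
    show "F (g -` B) \<in> bounded_ops" if "B \<in> sets borel" for B
      by (rule complex_linear[OF vimage[OF that]])
    show "F (g -` {-D..D}) = id_blinfun" by (simp add: vD)
    show "P.op_integral (truncated_id D) = op_integral g"
    proof (rule P.op_integral_eqI)
      have "(\<integral>t. truncated_id D t \<partial>distr (\<mu> x) borel g) = (\<integral>t. g t \<partial>\<mu> x)" for x
        using bounded_borel_truncated_id[of D]
        by (subst integral_distr) (auto simp: bounded_borel_def trunc)
      then show "P.is_integral (truncated_id D) (op_integral g)"
        by (simp add: P.is_integral_def op_integral_sym g inner_op_integral)
    qed
  qed
  then show ?thesis ..
qed

lemma inner_restricted_integral:
  assumes "bounded_borel h" shows "inner (restricted_integral h x) x = (\<integral>t. h t \<partial>\<mu> x)"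
  by (simp add: restricted_integral_eq inner_op_integral assms)

end

text \<open>Both families induce the same continuous calculus on the spectrum of a, so their
  diagonal measures integrate continuous bounded functions alike, and such functions approximate
  indicators of half-lines.\<close>

lemma spectral_family_\<mu>_unique:
  assumes "spectral_family F \<mu> a C" "spectral_family F' \<mu>' a C'"
  shows "\<mu> x = \<mu>' x"
proof (rule measure_eqI_lessThan)
  interpret A: spectral_family F \<mu> a C by fact
  interpret B: spectral_family F' \<mu>' a C' by fact
  show "sets (\<mu> x) = sets borel" "sets (\<mu>' x) = sets borel" by simp_all
  show "emeasure (\<mu> x) {s<..} < \<infinity>" for s by (simp add: A.emeasure_\<mu>)
  fix s :: real
  \<comment> \<open>Ramps that vanish up to s and reach 1 at s + 1 / n for positive n. They converge
    pointwise to the indicator of the open half-line, dominated by 1.\<close>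
  define h where "h n t = max 0 (min 1 (real n * (t - s)))" for n t
  have h_cont: "continuous_on T (h n)" for T n
    unfolding h_def by (intro continuous_intros)
  have hm: "h n \<in> borel_measurable borel" for n
    by (intro borel_measurable_continuous_onI h_cont)
  have h_le: "\<bar>h n t\<bar> \<le> 1" for n t by (simp add: h_def)
  have hb: "bounded_borel (h n)" for n
    using hm h_le by (auto simp: bounded_borel_def)
  have h_lim: "(\<lambda>n. h n t) \<longlonglongrightarrow> indicator {s<..} t" for t
  proof (cases "s < t")
    case True
    obtain N :: nat where N: "1 / (t - s) \<le> real N" using real_arch_simple by blast
    have "h n t = 1" if "n \<ge> N" for n
    proof -
      have "1 / (t - s) \<le> real n" using N that by simp
      then have "1 \<le> real n * (t - s)" using True by (simp add: field_simps)
      then show ?thesis by (simp add: h_def)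
    qed
    then show ?thesis
      using True by (intro tendsto_eventually) (auto simp: eventually_sequentially)
  next
    case False
    then have "real n * (t - s) \<le> 0" for n by (simp add: mult_nonneg_nonpos)
    then have "h n t = 0" for n by (simp add: h_def min.coboundedI2)
    then show ?thesis using False by simp
  qed
  have lim: "(\<lambda>n. \<integral>t. h n t \<partial>\<nu>) \<longlonglongrightarrow> measure \<nu> {s<..}"
    if "finite_measure \<nu>" "sets \<nu> = sets borel" for \<nu>
  proof -
    interpret finite_measure \<nu> by fact
    have "borel_measurable \<nu> = (borel_measurable borel :: (real \<Rightarrow> real) set)"
      by (rule measurable_cong_sets) (use that in auto)
    then have "(\<lambda>n. \<integral>t. h n t \<partial>\<nu>) \<longlonglongrightarrow> (\<integral>t. indicator {s<..} t \<partial>\<nu>)"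
      using h_lim h_le hm
      by (intro integral_dominated_convergence[where w = "\<lambda>t. 1"]) auto
    then show ?thesis using that sets_eq_imp_space_eq[OF that(2)] by simp
  qed
  have "(\<integral>t. h n t \<partial>\<mu> x) = (\<integral>t. h n t \<partial>\<mu>' x)" for n
    using real_calculus_unique[OF A.compact_real_spectrum A.real_calculus_restricted_integral
        B.real_calculus_restricted_integral h_cont, of n]
    by (simp flip: A.inner_restricted_integral[OF hb] B.inner_restricted_integral[OF hb])
  then have "measure (\<mu> x) {s<..} = measure (\<mu>' x) {s<..}"
    using lim[OF A.finite_\<mu> A.sets_\<mu>, of x] lim[OF B.finite_\<mu> B.sets_\<mu>, of x] LIMSEQ_unique by simp
  then show "emeasure (\<mu> x) {s<..} = emeasure (\<mu>' x) {s<..}"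
    by (simp add: A.emeasure_\<mu> B.emeasure_\<mu>)
qed

context spectral_family
begin

text \<open>Any competitor E is itself a spectral family of a with the same C, hence has the same
  diagonal measures, and these determine its projections.\<close>

lemma spectral_measure_of_unique:
  assumes E: "spectral_measure_of a E" and B: "B \<in> sets borel"
  shows "E B = F B"
proof -
  have pvm: "projection_valued_measure E" and ES: "E S = id_blinfun"
    and form: "\<And>x. cinner (a x) x = complex_of_real (\<integral>t. t \<partial>vector_measure E x)"
    using E by (auto simp: spectral_measure_of_def)
  interpret P: projection_family E "vector_measure E"
    by (rule projection_family_vector_measure[OF pvm])
  have EC: "E {-C..C} = id_blinfun"
    by (rule P.F_mono_id[OF real_spectrum_borel _ real_spectrum_subset ES]) simp
  have "P.op_integral (truncated_id C) = a"
  proof (rule P.op_integral_eqI)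
    have "inner (a x) x = (\<integral>t. truncated_id C t \<partial>vector_measure E x)" for x
    proof -
      have "inner (a x) x = (\<integral>t. t \<partial>vector_measure E x)"
        using form[of x] by (simp flip: Re_cinner)
      then show ?thesis
        using P.integral_\<mu>_F[of "{-C..C}" "\<lambda>t. t" x] by (simp add: EC truncated_id_def)
    qed
    then show "P.is_integral (truncated_id C) a"
      by (simp add: P.is_integral_def a_sym)
  qed
  then have "spectral_family E (vector_measure E) a C"
    using pvm EC
    by (intro spectral_family.intro P.projection_family_axioms spectral_family_axioms.intro)
       (auto simp: projection_valued_measure_def projection_iff)
  then have "vector_measure E x = \<mu> x" for x
    using spectral_family_\<mu>_unique[OF _ spectral_family_axioms] by blast
  then show ?thesis
    using P.inner_F[OF B] by (intro F_eqI[symmetric] P.F_sym B) auto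
qed

lemma spectral_projection_eq: "B \<in> sets borel \<Longrightarrow> spectral_projection B a = F B"
  unfolding spectral_projection_def
  by (rule the_equality) (blast intro: spectral_measure_of_F spectral_measure_of_unique)+

lemma spectral_projection_op_integral:
  assumes g: "bounded_borel g" and B: "B \<in> sets borel"
  shows "spectral_projection B (op_integral g) = F (g -` B)"
proof -
  obtain D where "spectral_family (\<lambda>B. F (g -` B)) (\<lambda>x. distr (\<mu> x) borel g) (op_integral g) D"
    using op_integral_spectral_family[OF g] by blast
  then interpret P: spectral_family "\<lambda>B. F (g -` B)" "\<lambda>x. distr (\<mu> x) borel g" "op_integral g" D .
  show ?thesis by (rule P.spectral_projection_eq[OF B])
qed

end

section \<open>The inequality\<close>

text \<open>Whatever lies in the commutant of M commutes with a and so with each projection, which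
  thereby lies in the double commutant.\<close>

lemma spectral_family_in_von_neumann_algebra_exists:
  assumes M: "von_neumann_algebra M" and a: "a \<in> M" "selfadjoint a"
  obtains F \<mu> C where "spectral_family F \<mu> a C" "\<And>B. B \<in> sets borel \<Longrightarrow> F B \<in> M"
proof -
  have a': "a \<in> bounded_ops" "symmetric_op a" using a(2) by (auto simp: selfadjoint_iff)
  obtain F \<mu> where F: "projection_family F \<mu>" "F {-(norm a + 1)..norm a + 1} = id_blinfun"
      "projection_family.op_integral \<mu> (truncated_id (norm a + 1)) = a"
    and comm: "\<And>T B. T o\<^sub>L a = a o\<^sub>L T \<Longrightarrow> B \<in> sets borel \<Longrightarrow> T o\<^sub>L F B = F B o\<^sub>L T"
    using spectral_family_exists[OF a'(2)] by metis
  have lin: "F B \<in> bounded_ops" if "B \<in> sets borel" for B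
    unfolding bounded_ops_iff_commute
    using comm[OF _ that] a'(1) unfolding bounded_ops_iff_commute by metis
  show thesis
  proof (rule that)
    show "spectral_family F \<mu> a (norm a + 1)"
      using F lin by (intro spectral_family.intro spectral_family_axioms.intro)
    fix B :: "real set" assume B: "B \<in> sets borel"
    have "F B \<in> commutant (commutant M)"
      unfolding commutant_def[of "commutant M"]
    proof (intro CollectI conjI ballI lin[OF B])
      fix T assume "T \<in> commutant M"
      then have "T o\<^sub>L a = a o\<^sub>L T" using a(1) by (simp add: commutant_def)
      then show "F B o\<^sub>L T = T o\<^sub>L F B" using comm B by metis
    qed
    then show "F B \<in> M" using M by (simp add: von_neumann_algebra_def)
  qed
qed

theorem proposition2p20:
  fixes M :: "('h::complex_hilbert_space) op set"
    and \<tau> :: "'h op \<Rightarrow> complex"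
    and \<alpha> :: "real \<Rightarrow> real"
    and a :: "'h op"
    and f :: "real \<Rightarrow> real"
    and k :: real
  assumes "type_II1_factor M"
    and "finite_trace M \<tau>" and "faithful_on M \<tau>" and "normal_on M \<tau>"
    and "\<tau> id_blinfun = 1"
    and "\<alpha> ` {0..1} \<subseteq> {0..1}" and "mono_on {0..1} \<alpha>" and "continuous_on {0..1} \<alpha>"
    and "\<alpha> 0 = 0" and "\<alpha> 1 = 1"
    and "a \<in> M" and "selfadjoint a"
    and "continuous_on (real_spectrum a) f" and "mono_on (real_spectrum a) f"
    and "\<And>t. t \<in> real_spectrum a \<Longrightarrow> 0 \<le> f t"
    and "k \<in> real_spectrum a" and "0 < f k"
  shows "choquet_trace \<tau> \<alpha> (spectral_projection {k..} a) \<le> choquet_trace \<tau> \<alpha> (cfc f a) / f k"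
proof -
  have "von_neumann_algebra M"
    using assms(1) by (simp add: type_II1_factor_def factor_def)
  then obtain F \<mu> C where SF: "spectral_family F \<mu> a C" and FM: "\<And>B. B \<in> sets borel \<Longrightarrow> F B \<in> M"
    using spectral_family_in_von_neumann_algebra_exists[OF _ assms(11,12)] by blast
  interpret spectral_family F \<mu> a C by (rule SF)

  define m where "m B = Re (\<tau> (F B))" for B
  have m_nonneg: "0 \<le> m B" if "B \<in> sets borel" for B
  proof -
    have "positive_op (F B)"
      unfolding positive_op_def selfadjoint_iff Re_cinner
      using that by (simp add: complex_linear F_sym orth_proj_inner proj)
    then have "\<tau> (F B) \<in> \<real>\<^sub>\<ge>\<^sub>0"
      using assms(2) FM[OF that] by (simp add: finite_trace_def)
    then show ?thesis by (simp add: m_def complex_nonneg_Reals_iff)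
  qed
  have m_mono: "m A \<le> m B" if "A \<in> sets borel" "B \<in> sets borel" "A \<subseteq> B" for A B
  proof -
    have "F B = F A + F (B - A)"
      using F_Un[of A "B - A"] that by (simp add: Un_absorb1)
    moreover have "\<tau> (F A + F (B - A)) = \<tau> (F A) + \<tau> (F (B - A))"
      using assms(2) FM that by (simp add: finite_trace_def)
    ultimately show ?thesis using m_nonneg[of "B - A"] that by (simp add: m_def)
  qed
  have m_UNIV: "m UNIV = 1" by (simp add: m_def assms(5))
  have m_empty: "m {} = 0"
  proof -
    have "\<tau> (F {} + F {}) = \<tau> (F {}) + \<tau> (F {})"
      using assms(2) FM[of "{}"] unfolding finite_trace_def by blast
    then show ?thesis by (simp add: m_def)
  qed
  have m_01: "m B \<in> {0..1}" if "B \<in> sets borel" for B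
    using m_nonneg[OF that] m_mono[OF that, of UNIV] by (simp add: m_UNIV)
  have \<alpha>_01: "0 \<le> \<alpha> (m B)" "\<alpha> (m B) \<le> 1" if "B \<in> sets borel" for B
    using image_subset_iff[THEN iffD1, OF assms(6), rule_format, OF m_01[OF that]] by simp_all
  have \<alpha>_mono: "\<alpha> (m A) \<le> \<alpha> (m B)" if "A \<in> sets borel" "B \<in> sets borel" "A \<subseteq> B" for A B
    by (rule mono_onD[OF assms(7) m_01[OF that(1)] m_01[OF that(2)] m_mono[OF that]])

  define c where "c = \<alpha> (m {k..})"
  have c: "0 \<le> c" unfolding c_def by (rule \<alpha>_01) simp

  have lhs: "choquet_trace \<tau> \<alpha> (spectral_projection {k..} a) = c"
  proof -
    have p: "spectral_projection {k..} a = op_integral (indicator {k..})"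
      by (simp add: spectral_projection_eq op_integral_indicator)
    \<comment> \<open>A projection is the integral of an indicator, so its own spectral projections
      come from the same push-forward. For s \<ge> 1 they are 0, and \<alpha> 0 = 0 ends the
      integration there.\<close>
    have sp: "spectral_projection {s<..} (op_integral (indicator {k..})) = F (if s < 1 then {k..} else {})"
      if "0 \<le> s" for s
    proof -
      have "(indicator {k..} :: real \<Rightarrow> real) -` {s<..} = (if s < 1 then {k..} else {})"
        using that by (auto split: split_indicator split_indicator_asm)
      then show ?thesis by (simp add: spectral_projection_op_integral)
    qed
    have "choquet_trace \<tau> \<alpha> (spectral_projection {k..} a) = (LBINT s::real. indicator {0..<1} s * c)"
      unfolding choquet_trace_def set_lebesgue_integral_def p
    proof (rule Bochner_Integration.integral_cong[OF refl])
      fix s :: real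
      show "indicator {0..} s *\<^sub>R \<alpha> (Re (\<tau> (spectral_projection {s<..} (op_integral (indicator {k..})))))
          = indicator {0..<1} s * c"
        using sp[of s] m_empty assms(9) by (auto simp: c_def m_def split: split_indicator)
    qed
    then show ?thesis by simp
  qed

  define g where "g t = indicator S t * f t" for t
  have g: "bounded_borel g"
    unfolding g_def[abs_def] by (rule bounded_borel_restrict[OF assms(13)])
  then obtain D where D: "\<And>t. \<bar>g t\<bar> \<le> D" by (auto simp: bounded_borel_def)
  have gv: "g -` {s<..} \<in> sets borel" for s
    using g measurable_sets[of g borel borel "{s<..}"] by (simp add: bounded_borel_def)
  define \<phi> where "\<phi> s = \<alpha> (m (g -` {s<..}))" for s
  have \<phi>_antimono: "\<phi> t \<le> \<phi> s" if "s \<le> t" for s t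
    unfolding \<phi>_def by (intro \<alpha>_mono gv) (use that in auto)
  \<comment> \<open>The library rule is for increasing functions, hence the sign.\<close>
  have "(\<lambda>s. - \<phi> s) \<in> borel_measurable borel"
    by (rule borel_measurable_mono) (simp add: mono_def \<phi>_antimono)
  then have \<phi>_meas [measurable]: "\<phi> \<in> borel_measurable borel"
    using borel_measurable_uminus by fastforce
  have \<phi>_0: "\<phi> s = 0" if "D \<le> s" for s
  proof -
    have "\<not> s < g t" for t using D[of t] that by linarith
    then have "g -` {s<..} = {}" by auto
    then show ?thesis by (simp add: \<phi>_def m_empty assms(9))
  qed
  have \<phi>_bounds: "0 \<le> \<phi> s" "\<phi> s \<le> 1" for s
    unfolding \<phi>_def by (intro \<alpha>_01 gv)+
  have \<phi>_ge: "c \<le> \<phi> s" if "s < f k" for s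
  proof -
    \<comment> \<open>Monotonicity of f is known on the spectrum only; intersecting with it leaves
      the projection unchanged.\<close>
    have "F ({k..} \<inter> S) = F {k..}"
      by (rule blinfun_eqI) (simp add: F_real_spectrum real_spectrum_borel flip: F_Int)
    then have "c = \<alpha> (m ({k..} \<inter> S))" by (simp add: c_def m_def)
    also have "\<dots> \<le> \<phi> s"
      unfolding \<phi>_def
    proof (intro \<alpha>_mono gv)
      show "{k..} \<inter> S \<subseteq> g -` {s<..}"
        using mono_onD[OF assms(14,16)] that by (fastforce simp: g_def)
    qed (simp_all add: real_spectrum_borel sets.Int)
    finally show ?thesis .
  qed
  have "S \<noteq> {}" using assms(16) by blast
  then have cfc: "cfc f a = op_integral g"
    by (simp add: cfc_eq assms(13) restricted_integral_def g_def[abs_def])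
  have rhs: "choquet_trace \<tau> \<alpha> (cfc f a) = (LBINT s::real. indicator {0..} s * \<phi> s)"
    unfolding choquet_trace_def set_lebesgue_integral_def cfc
    by (simp add: spectral_projection_op_integral g m_def \<phi>_def)
  \<comment> \<open>Needed for comparing the integrals: a Bochner integral of a non-integrable
    function is 0 by convention. The integrand is at most 1 and vanishes beyond the bound D of
    g.\<close>
  have int: "integrable lborel (\<lambda>s. indicator {0..} s * \<phi> s)"
  proof (rule Bochner_Integration.integrable_bound)
    show "integrable lborel (indicator {0..\<bar>D\<bar>} :: real \<Rightarrow> real)" by simp
    show "AE s in lborel. norm (indicator {0..} s * \<phi> s) \<le> norm (indicator {0..\<bar>D\<bar>} s :: real)"
      using \<phi>_bounds \<phi>_0 by (intro AE_I2) (auto split: split_indicator)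
  qed measurable
  \<comment> \<open>The product is the area of the rectangle of height c over [0, f k), which lies
    under the graph of \<phi>.\<close>
  have "f k * c = (LBINT s::real. indicator {0..<f k} s * c)"
    using assms(17) by simp
  also have "\<dots> \<le> (LBINT s::real. indicator {0..} s * \<phi> s)"
  proof (rule integral_mono[OF _ int])
    show "integrable lborel (\<lambda>s. indicator {0..<f k} s * c)"
      using assms(17) by (intro integrable_mult_left integrable_real_indicator) simp_all
    show "indicator {0..<f k} s * c \<le> indicator {0..} s * \<phi> s" for s
      using \<phi>_ge[of s] \<phi>_bounds[of s] by (simp split: split_indicator)
  qed
  finally show ?thesis
    using assms(17) by (simp add: lhs rhs pos_le_divide_eq mult.commute)
qed

end
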